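(* Let $(\mathcal{I},\mathcal{J})$ be a compatible pair of standard dyadic partitions. Then $$\mathcal{L}(\mathbb{H}_{\mathcal{I}},\mathbb{H}_{\mathcal{J}})=L_{(\mathcal{I},\mathcal{J})}$$ as oriented links. In particular, if $(\mathcal{I},\mathcal{J})$ is the reduced pair representing some $g\in\vec{F}$, then $\mathcal{L}(\mathbb{H}_{\mathcal{I}},\mathbb{H}_{\mathcal{J}})=L_g$.
   Context: Equality of links is up to isotopy. A standard dyadic (s.d.) interval is an interval $[\frac{k}{2^m},\frac{k+1}{2^m}]$ with integers $m\ge 0$, $0\le k\le 2^m-1$. An s.d. $n$-partition $\mathcal{I}$ is a partition $0=a_0<a_1<\dots<a_n=1$ (the $a_i$ are its breakpoints) all of whose subintervals $[a_i,a_{i+1}]$ are s.d. intervals. Thompson group $F$: the group of piecewise linear orientation-preserving homeomorphisms of $[0,1]$ whose slopes are powers of $2$ and whose breakpoints are dyadic rationals. If $\mathcal{I}$ ($a_0<\dots<a_n$) and $\mathcal{J}$ ($b_0<\dots<b_n$) are s.d. $n$-partitions, the map with $a_i\mapsto b_i$, linear on each $[a_i,a_{i+1}]$, is an element of $F$, said to be represented by $(\mathcal{I},\mathcal{J})$. The pair is reduced if there is no $i$ with $1\le i\le n-1$ such that both $[a_{i-1},a_{i+1}]$ and $[b_{i-1},b_{i+1}]$ are s.d. intervals; every $g\in F$ is represented by a unique reduced pair. Tree and signs: let $\mathcal{S}(\mathcal{I})$ be the set of s.d. intervals of the form $[a_i,a_j]$ (it has $2n-1$ elements). The planar binary tree $F_{\mathcal{I}}$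 (root edge at the top) has one edge for each element of $\mathcal{S}(\mathcal{I})$; the root edge is $[0,1]$, and each $B\in\mathcal{S}(\mathcal{I})$ that is not a subinterval of $\mathcal{I}$ ends below at a trivalent vertex from which the left half and the right half of $B$ descend as left and right edges; the lowermost edges (leaves) are the subintervals of $\mathcal{I}$. S.d. intervals (and the corresponding edges) carry signs: $[0,1]$ has sign $+$, the left half of an s.d. interval has the same sign as that interval, the right half has the opposite sign. Let $\sigma_{\mathcal{I}}$ be the sequence of signs of the $n$ subintervals of $\mathcal{I}$ from left to right. The oriented Thompson group $\vec{F}$ consists of the $g\in F$ for which some (equivalently every) representing pair $(\mathcal{I},\mathcal{J})$ has $\sigma_{\mathcal{I}}=\sigma_{\mathcal{J}}$; a pair representing an element of $\vec{F}$ is called compatible. Jones' link: from $F_{\mathcal{I}}$ form a tangle $T_{\mathcal{I}}$ by attaching at each trivalent vertex a vertical strand going straight down to the bottom, and turning the resulting 4-valent vertex into a crossing whose under-strand is the parent edge continued into the added vertical strand and whose over-strand is the left edge joined to the right edge. It has one top endpoint and $2n-1$ bottom endpoints. Orient the arc of each edge upward if the edge has sign $+$ and downward if it has sign $-$ (the added vertical strand continues the orientation of the parent edge). Add a vertical strand on the far left and join its top to the top endpoint of $T_{\mathcal{I}}$ by a cap; orientation extended along it (so it runs downward). This gives an oriented $(0,2n)$-tangle $\widehat{T_{\mathcal{I}}}$. For a compatible pair $(\mathcal{I},\mathcal{J})$, the oriented link $L_{(\mathcal{I},\mathcal{J})}$ is obtained by placing $\widehat{T_{\mathcal{I}}}$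 on top of $-\overline{\widehat{T_{\mathcal{J}}}}$ (the reflection of the planar diagram of $\widehat{T_{\mathcal{J}}}$ in a horizontal line, keeping which strand is over at each crossing, with reversed orientation) and joining the $2n$ endpoints in order. For $g\in\vec{F}$, $L_g:=L_{(\mathcal{I},\mathcal{J})}$ with $(\mathcal{I},\mathcal{J})$ the reduced pair representing $g$. Half grid diagram of a partition: for an s.d. interval $A\neq[0,1]$, its conjugate $\overline{A}$ is the s.d. interval of the same length such that $A\cup\overline{A}$ is an s.d. interval of twice the length. Order $\mathcal{S}(\mathcal{I})$ by midpoints as $A_1,\dots,A_{2n-1}$ and put $p_x(A_i)=i+1$. The positive elements of $\mathcal{S}(\mathcal{I})$ are $n$ in number; order them by increasing length, ties broken by increasing midpoint, as $B_1,\dots,B_n=[0,1]$, and put $p_y(B_i)=i$ for $1\le i\le n$ and $p_y(\overline{B_i})=i$ for $1\le i\le n-1$ (this defines $p_y$ on all of $\mathcal{S}(\mathcal{I})$). $\mathbb{H}_{\mathcal{I}}$ is the $n\times 2n$ grid (entry $(x,y)$ is in column $x$ from the left, row $y$ from the bottom) with an $O$ at $(1,n)$ and, for each $A\in\mathcal{S}(\mathcal{I})$, a marking at $(p_x(A),p_y(A))$, equal to $X$ if $A$ is positive and $O$ if $A$ is negative. It is a half grid diagram: each row has exactly one $X$ and one $O$ and each column exactly one marking. For a compatible pair $(\mathcal{I},\mathcal{J})$, the $i$-th columns of $\mathbb{H}_{\mathcal{I}}$ and $\mathbb{H}_{\mathcal{J}}$ contain the same symbol for every $i$, so stacking $\mathbb{H}_{\mathcal{I}}$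 on top of $-\overline{\mathbb{H}_{\mathcal{J}}}$ ($\mathbb{H}_{\mathcal{J}}$ flipped upside down with $X$ and $O$ exchanged) gives a $2n\times 2n$ grid diagram $(\mathbb{H}_{\mathcal{I}},\mathbb{H}_{\mathcal{J}})$. Its oriented link $\mathcal{L}(\mathbb{H}_{\mathcal{I}},\mathbb{H}_{\mathcal{J}})$ is obtained by joining $X$ to $O$ in each row and $O$ to $X$ in each column (oriented accordingly), with horizontal segments always over vertical segments. *)

theory Defs
  imports "HOL-Analysis.Analysis"
begin

section \<open>Oriented links in three-space\<close>

text \<open>
  An oriented polygonal link is given by its set of directed segments \<open>(P, Q)\<close>, traversed from
  \<open>P\<close> to \<open>Q\<close>. Such a set also records an oriented link diagram: the diagram is the projection
  \<open>(x, y, z) \<mapsto> (x, y)\<close>, and at a crossing the strand with the larger \<open>z\<close> is the over-strand.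
\<close>

type_synonym point = "real \<times> real \<times> real"

type_synonym polygon = "(point \<times> point) set"

definition support :: "polygon \<Rightarrow> point set" where
  "support E = (\<Union>(P, Q)\<in>E. closed_segment P Q)"

text \<open>
  The parametrizations of the components of the link: simple closed curves on the support that
  run along every segment in the prescribed direction.
\<close>

definition oriented_components :: "polygon \<Rightarrow> (real \<Rightarrow> point) set" where
  "oriented_components E =
     {\<gamma>. simple_path \<gamma> \<and> pathfinish \<gamma> = pathstart \<gamma> \<and> path_image \<gamma> \<subseteq> support E \<and>
         (\<forall>(P, Q)\<in>E. \<forall>s t. 0 \<le> s \<and> s < t \<and> t \<le> 1 \<and> \<gamma> ` {s..t} \<subseteq> closed_segment P Q
            \<longrightarrow> (\<gamma> t - \<gamma> s) \<bullet> (Q - P) > 0)}"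

definition ambient_isotopy :: "(real \<Rightarrow> point \<Rightarrow> point) \<Rightarrow> bool" where
  "ambient_isotopy h \<longleftrightarrow>
     continuous_on ({0..1} \<times> UNIV) (\<lambda>(t, p). h t p) \<and>
     (\<forall>p. h 0 p = p) \<and>
     (\<forall>t\<in>{0..1}. \<exists>k. homeomorphism UNIV UNIV (h t) k)"

definition isotopic :: "polygon \<Rightarrow> polygon \<Rightarrow> bool" where
  "isotopic E E' \<longleftrightarrow>
     (\<exists>h. ambient_isotopy h \<and> h 1 ` support E = support E' \<and>
          (\<forall>\<gamma>. \<gamma> \<in> oriented_components E \<longleftrightarrow> h 1 \<circ> \<gamma> \<in> oriented_components E'))"

definition polyline :: "point list \<Rightarrow> polygon" where
  "polyline ps = set (zip ps (tl ps))"


section \<open>Standard dyadic intervals and partitions\<close>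

text \<open>The pair \<open>(m, k)\<close> stands for the interval \<open>[k / 2^m, (k + 1) / 2^m]\<close>.\<close>

type_synonym sd = "nat \<times> nat"

definition is_sd :: "sd \<Rightarrow> bool" where
  "is_sd A \<longleftrightarrow> snd A < 2 ^ fst A"

definition lo :: "sd \<Rightarrow> real" where
  "lo A = real (snd A) / 2 ^ fst A"

definition hi :: "sd \<Rightarrow> real" where
  "hi A = (real (snd A) + 1) / 2 ^ fst A"

definition len :: "sd \<Rightarrow> real" where
  "len A = hi A - lo A"

definition mid :: "sd \<Rightarrow> real" where
  "mid A = (lo A + hi A) / 2"

text \<open>
  For \<open>A \<noteq> [0,1]\<close>: the interval of twice the length of which \<open>A\<close> is a half. The left halves are
  those with even second index.
\<close>

definition sd_parent :: "sd \<Rightarrow> sd" where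
  "sd_parent A = (fst A - 1, snd A div 2)"

definition sd_conjugate :: "sd \<Rightarrow> sd" where
  "sd_conjugate A = (fst A, if even (snd A) then snd A + 1 else snd A - 1)"

fun sd_positive :: "sd \<Rightarrow> bool" where
  "sd_positive (0, k) = True"
| "sd_positive (Suc m, k) =
     (if even k then sd_positive (m, k div 2) else \<not> sd_positive (m, k div 2))"

text \<open>
  A standard dyadic \<open>n\<close>-partition is given by the list of its \<open>n\<close> subintervals from left to right,
  so its breakpoints are the endpoints of the members of the list.
\<close>

definition sd_partition :: "sd list \<Rightarrow> bool" where
  "sd_partition I \<longleftrightarrow> I \<noteq> [] \<and> (\<forall>A\<in>set I. is_sd A) \<and> lo (hd I) = 0 \<and> hi (last I) = 1 \<and>
     (\<forall>i. Suc i < length I \<longrightarrow> hi (I ! i) = lo (I ! Suc i))"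

definition sd_set :: "sd list \<Rightarrow> sd set" where
  "sd_set I = {A. is_sd A \<and> lo A \<in> lo ` set I \<and> hi A \<in> hi ` set I}"

definition sign_seq :: "sd list \<Rightarrow> bool list" where
  "sign_seq I = map sd_positive I"

definition sd_pair :: "sd list \<Rightarrow> sd list \<Rightarrow> bool" where
  "sd_pair I J \<longleftrightarrow> sd_partition I \<and> sd_partition J \<and> length I = length J"

definition compatible :: "sd list \<Rightarrow> sd list \<Rightarrow> bool" where
  "compatible I J \<longleftrightarrow> sd_pair I J \<and> sign_seq I = sign_seq J"

definition mergeable :: "sd list \<Rightarrow> nat \<Rightarrow> bool" where
  "mergeable I i \<longleftrightarrow> (\<exists>A. is_sd A \<and> lo A = lo (I ! i) \<and> hi A = hi (I ! Suc i))"

definition reduced_pair :: "sd list \<Rightarrow> sd list \<Rightarrow> bool" where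
  "reduced_pair I J \<longleftrightarrow> sd_pair I J \<and> \<not> (\<exists>i. Suc i < length I \<and> mergeable I i \<and> mergeable J i)"


section \<open>The Thompson group and its oriented subgroup\<close>

definition dyadic :: "real \<Rightarrow> bool" where
  "dyadic x \<longleftrightarrow> (\<exists>(k::int) (m::nat). x = of_int k / 2 ^ m)"

text \<open>Homeomorphisms of \<open>[0,1]\<close> are extended by the identity to all of the reals.\<close>

definition thompson_F :: "(real \<Rightarrow> real) set" where
  "thompson_F =
     {g. (\<forall>x. x \<notin> {0..1} \<longrightarrow> g x = x) \<and>
         (\<exists>f. homeomorphism {0..1} {0..1} g f) \<and> strict_mono_on {0..1} g \<and>
         (\<exists>xs. xs \<noteq> [] \<and> hd xs = 0 \<and> last xs = 1 \<and> sorted_wrt (<) xs \<and> (\<forall>x\<in>set xs. dyadic x) \<and>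
            (\<forall>i. Suc i < length xs \<longrightarrow>
               (\<exists>k::int. \<forall>x\<in>{xs ! i..xs ! Suc i}.
                  g x = g (xs ! i) + 2 powi k * (x - xs ! i))))}"

definition represents :: "sd list \<Rightarrow> sd list \<Rightarrow> (real \<Rightarrow> real) \<Rightarrow> bool" where
  "represents I J g \<longleftrightarrow> sd_pair I J \<and>
     (\<forall>i<length I. \<forall>x\<in>{lo (I ! i)..hi (I ! i)}.
        g x = lo (J ! i) + len (J ! i) / len (I ! i) * (x - lo (I ! i)))"

definition oriented_thompson_F :: "(real \<Rightarrow> real) set" where
  "oriented_thompson_F =
     {g \<in> thompson_F. \<exists>I J. represents I J g \<and> sign_seq I = sign_seq J}"


section \<open>The link of Jones\<close>

text \<open>
  Position, from left to right, among the intervals of the partition ordered by midpoint.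
\<close>

definition mid_rank :: "sd list \<Rightarrow> sd \<Rightarrow> nat" where
  "mid_rank I A = card {B \<in> sd_set I. mid B \<le> mid A}"

text \<open>
  The planar tree is drawn with the lower vertex of the edge \<open>A\<close> at \<open>(mid A, len A)\<close>, the top of
  the root edge at \<open>(1/2, 2)\<close> and the bottom line at \<open>y = 0\<close>. Over the vertex of \<open>A\<close>, the
  under-strand passes at height \<open>z = 0\<close> and the over-strand, which joins the left edge to the right
  edge, at \<open>z = 1\<close>; hence every edge other than the root starts at height \<open>1\<close> and descends to
  height \<open>0\<close>.
\<close>

definition edge_top :: "sd \<Rightarrow> point" where
  "edge_top A = (if fst A = 0 then (1/2, 2, 0) else (mid (sd_parent A), len (sd_parent A), 1))"

text \<open>
  The arc of \<open>A\<close>, including the strand going straight down. For a leaf there is no vertex at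
  \<open>(mid A, len A)\<close>, just a bend of the edge, and the vertical piece is the end of the leaf itself.
\<close>

definition arc_points :: "sd \<Rightarrow> point list" where
  "arc_points A = [edge_top A, (mid A, len A, 0), (mid A, 0, 0)]"

definition edge_arc :: "sd \<Rightarrow> polygon" where
  "edge_arc A = polyline (if sd_positive A then rev (arc_points A) else arc_points A)"

definition tangle :: "sd list \<Rightarrow> polygon" where
  "tangle I = (\<Union>A\<in>sd_set I. edge_arc A)"

definition hat_tangle :: "sd list \<Rightarrow> polygon" where
  "hat_tangle I = tangle I \<union> polyline [(1/2, 2, 0), (-1, 2, 0), (-1, 0, 0)]"

text \<open>
  The reflection in the line \<open>y = -1/2\<close>, so that the endpoints on \<open>y = 0\<close> move to \<open>y = -1\<close> and the
  strip between is left for the joining strands.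
\<close>

definition flip_point :: "point \<Rightarrow> point" where
  "flip_point = (\<lambda>(x, y, z). (x, -1 - y, z))"

definition reversed_mirror :: "polygon \<Rightarrow> polygon" where
  "reversed_mirror E = (\<lambda>(P, Q). (flip_point Q, flip_point P)) ` E"

definition joining_strands :: "sd list \<Rightarrow> sd list \<Rightarrow> polygon" where
  "joining_strands I J =
     polyline [(-1, 0, 0), (-1, -1, 0)] \<union>
     (\<Union>A\<in>sd_set I. \<Union>B\<in>{B \<in> sd_set J. mid_rank J B = mid_rank I A}.
        polyline (if sd_positive A then [(mid B, -1, 0), (mid A, 0, 0)]
                  else [(mid A, 0, 0), (mid B, -1, 0)]))"

definition jones_link_pair :: "sd list \<Rightarrow> sd list \<Rightarrow> polygon" where
  "jones_link_pair I J =
     hat_tangle I \<union> joining_strands I J \<union> reversed_mirror (hat_tangle J)"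

definition jones_link :: "(real \<Rightarrow> real) \<Rightarrow> polygon" where
  "jones_link g =
     (case (THE (I, J). reduced_pair I J \<and> represents I J g) of (I, J) \<Rightarrow> jones_link_pair I J)"


section \<open>Grid diagrams\<close>

text \<open>
  The sets of positions (column from the left, row from the bottom) of the markings \<open>X\<close> and \<open>O\<close>.
\<close>

type_synonym grid = "(nat \<times> nat) set \<times> (nat \<times> nat) set"

definition grid_x :: "sd list \<Rightarrow> sd \<Rightarrow> nat" where
  "grid_x I A = mid_rank I A + 1"

definition positive_rank :: "sd list \<Rightarrow> sd \<Rightarrow> nat" where
  "positive_rank I A =
     card {B \<in> sd_set I. sd_positive B \<and> (len B < len A \<or> len B = len A \<and> mid B \<le> mid A)}"

definition grid_y :: "sd list \<Rightarrow> sd \<Rightarrow> nat" where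
  "grid_y I A = positive_rank I (if sd_positive A then A else sd_conjugate A)"

definition half_grid :: "sd list \<Rightarrow> grid" where
  "half_grid I =
     ({(grid_x I A, grid_y I A) | A. A \<in> sd_set I \<and> sd_positive A},
      insert (1, length I) {(grid_x I A, grid_y I A) | A. A \<in> sd_set I \<and> \<not> sd_positive A})"

text \<open>Upside-down flip of a grid with \<open>n\<close> rows, with \<open>X\<close> and \<open>O\<close> exchanged.\<close>

definition flip_half_grid :: "nat \<Rightarrow> grid \<Rightarrow> grid" where
  "flip_half_grid n = (\<lambda>(Xs, Os).
     ((\<lambda>(x, y). (x, n + 1 - y)) ` Os, (\<lambda>(x, y). (x, n + 1 - y)) ` Xs))"

text \<open>The first grid on top of the second one, which has \<open>n\<close> rows.\<close>

definition stack_grids :: "nat \<Rightarrow> grid \<Rightarrow> grid \<Rightarrow> grid" where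
  "stack_grids n = (\<lambda>(Xs, Os) (Xs', Os').
     ((\<lambda>(x, y). (x, y + n)) ` Xs \<union> Xs', (\<lambda>(x, y). (x, y + n)) ` Os \<union> Os'))"

definition pair_grid :: "sd list \<Rightarrow> sd list \<Rightarrow> grid" where
  "pair_grid I J =
     stack_grids (length J) (half_grid I) (flip_half_grid (length J) (half_grid J))"

text \<open>
  Horizontal segments lie at height \<open>z = 1\<close>, vertical ones at \<open>z = 0\<close>; they are connected at the
  markings by segments parallel to the \<open>z\<close>-axis.
\<close>

definition grid_point :: "nat \<Rightarrow> nat \<Rightarrow> real \<Rightarrow> point" where
  "grid_point x y z = (real x, real y, z)"

definition grid_link :: "grid \<Rightarrow> polygon" where
  "grid_link = (\<lambda>(Xs, Os).
     {(grid_point x y 1, grid_point x' y 1) | x x' y. (x, y) \<in> Xs \<and> (x', y) \<in> Os} \<union>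
     {(grid_point x y 0, grid_point x y' 0) | x y y'. (x, y) \<in> Os \<and> (x, y') \<in> Xs} \<union>
     {(grid_point x y 0, grid_point x y 1) | x y. (x, y) \<in> Xs} \<union>
     {(grid_point x y 1, grid_point x y 0) | x y. (x, y) \<in> Os})"

end

theory Submission
  imports Defs
begin

text \<open>
  The bridge from an interval to its conjugate in a row of the grid crosses over exactly one column, that
  of their parent. So the grid diagram and the diagram of Jones agree up to a deformation of
  three-space. This deformation is a composition of shears, each of which changes one coordinate
  by a map that is increasing in that coordinate; such a shear is isotopic to the identity by linear
  interpolation.

  The columns are first moved to the midpoints of the intervals, with the joining strands in
  between. In the upper half, each box-shaped bridge over the column of a parent becomes a wedge
  with apex above that column, while the plane \<open>z = 0\<close> of the columns is fixed, and the bridge of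
  the root is pushed down into this plane. The row of \<open>A\<close> is moved to height \<open>len A\<close>: rows of equal
  length lie over disjoint intervals, so the order of the rows over each point is preserved.
  Finally \<open>y \<mapsto> y * (1 + z)\<close> lifts the apex at height \<open>len A\<close> to the vertex of the parent at height
  \<open>2 * len A\<close>, which turns the wedges into the edges of the tree. The lower half is treated by
  conjugation with the reflection.

  The reduced pair of an element of the Thompson group is unique since its first partition consists
  of the maximal standard dyadic intervals on which the map is affine onto a standard dyadic
  interval.
\<close>

section \<open>Deformations of three-space\<close>

text \<open>Two obstacles shape the details. Links are finite sets of directed segments, but the
  deformation of the grid does not produce the segments of the tangle: a leg parallel to the z-axis
  becomes the lower half of a tree edge, half a row its upper half. Hence
  \<open>oriented_components\<close> is shown to be invariant under subdivision, and the polygons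
  are compared through common coarsenings. Points may also move nonlinearly along a segment, so
  images of segments are controlled as sets and direction is recovered from injectivity.

  Secondly, the grid gives distinct rows to nonconjugate intervals of equal length, while the tree
  puts their vertices at one height. No increasing function of \<open>y\<close> alone does this; a
  map depending on \<open>x\<close> comes from a general extension principle that prescribes each
  height only over its own bridge. Away from the prescribed places only its monotonicity is known,
  which suffices because columns are vertical.

  The two halves do not interfere: the deformation of the upper half fixes \<open>y \<le> 0\<close>,
  its mirror image fixes \<open>y \<ge> - 1\<close>, and the joining strands lie in the strip
  between.\<close>

definition deformation :: "(point \<Rightarrow> point) \<Rightarrow> bool" where
  "deformation f \<longleftrightarrow> (\<exists>h. ambient_isotopy h \<and> h 1 = f)"

lemma deformation_homeomorphism:
  assumes "deformation f"
  obtains k where "homeomorphism UNIV UNIV f k"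
proof -
  obtain h where h: "ambient_isotopy h" "h 1 = f" using assms unfolding deformation_def by blast
  have "\<exists>k. homeomorphism UNIV UNIV (h 1) k"
    using h(1) unfolding ambient_isotopy_def by (meson atLeastAtMost_iff order_refl zero_le_one)
  then show thesis using that h(2) by blast
qed

text \<open>Both isotopies run at the same time, as \<open>k t \<circ> h t\<close>, so that no
  reparametrization of time is needed.\<close>

lemma deformation_compose:
  assumes "deformation f" "deformation g"
  shows "deformation (g \<circ> f)"
proof -
  obtain h where h: "ambient_isotopy h" "h 1 = f" using assms unfolding deformation_def by blast
  obtain k where k: "ambient_isotopy k" "k 1 = g" using assms unfolding deformation_def by blast
  have ch: "continuous_on ({0..1} \<times> UNIV) (\<lambda>x. h (fst x) (snd x))"
    and ck: "continuous_on ({0..1} \<times> UNIV) (\<lambda>x. k (fst x) (snd x))"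
    using h k by (auto simp: ambient_isotopy_def case_prod_beta')
  have "continuous_on ({0..1} \<times> UNIV) (\<lambda>x. k (fst (fst x, h (fst x) (snd x))) (snd (fst x, h (fst x)
      (snd x))))"
    by (rule continuous_on_compose2[OF ck, of _ "\<lambda>x. (fst x, h (fst x) (snd x))"])
       (auto intro!: continuous_intros ch)
  then have 1: "continuous_on ({0..1} \<times> UNIV) (\<lambda>(t, p). (k t \<circ> h t) p)"
    by (simp add: case_prod_beta')
  have 2: "\<exists>l. homeomorphism UNIV UNIV (k t \<circ> h t) l" if "t \<in> {0..1}" for t
    using h(1) k(1) that unfolding ambient_isotopy_def
    by (meson homeomorphism_compose)
  have 3: "(k 0 \<circ> h 0) p = p" for p
    using h(1) k(1) unfolding ambient_isotopy_def by (metis comp_apply)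
  have "ambient_isotopy (\<lambda>t. k t \<circ> h t)"
    unfolding ambient_isotopy_def using 1 2 3 by blast
  then show ?thesis
    unfolding deformation_def using h(2) k(2) by (intro exI[of _ "\<lambda>t. k t \<circ> h t"]) auto
qed

text \<open>The map \<open>s\<close> itself, a reflection in the application, need not be isotopic
  to the identity: being an involution, it cancels at time \<open>0\<close>.\<close>

lemma deformation_conjugate:
  assumes "deformation f" and s: "continuous_on UNIV s" "\<And>p. s (s p) = p"
  shows "deformation (s \<circ> f \<circ> s)"
proof -
  obtain h where h: "ambient_isotopy h" "h 1 = f" using assms unfolding deformation_def by blast
  have hs: "homeomorphism UNIV UNIV s s"
    by (rule homeomorphismI) (use s in auto)
  have ch: "continuous_on ({0..1} \<times> UNIV) (\<lambda>x. h (fst x) (snd x))"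
    using h by (auto simp: ambient_isotopy_def case_prod_beta')
  have "continuous_on ({0..1} \<times> UNIV) (\<lambda>x. h (fst (fst x, s (snd x))) (snd (fst x, s (snd x))))"
    by (rule continuous_on_compose2[OF ch, of _ "\<lambda>x. (fst x, s (snd x))"])
       (auto intro!: continuous_intros continuous_on_compose2[OF s(1)])
  then have "continuous_on ({0..1} \<times> UNIV) (\<lambda>x. s (h (fst x) (s (snd x))))"
    by (auto intro!: continuous_on_compose2[OF s(1)])
  then have 1: "continuous_on ({0..1} \<times> UNIV) (\<lambda>(t, p). (s \<circ> h t \<circ> s) p)"
    by (simp add: case_prod_beta')
  have 2: "\<exists>l. homeomorphism UNIV UNIV (s \<circ> h t \<circ> s) l" if "t \<in> {0..1}" for t
    using h(1) hs that unfolding ambient_isotopy_def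
    by (meson homeomorphism_compose)
  have 3: "(s \<circ> h 0 \<circ> s) p = p" for p
    using h(1) s(2) unfolding ambient_isotopy_def by (metis comp_apply)
  have "ambient_isotopy (\<lambda>t. s \<circ> h t \<circ> s)"
    unfolding ambient_isotopy_def using 1 2 3 by blast
  then show ?thesis
    unfolding deformation_def using h(2) by (intro exI[of _ "\<lambda>t. s \<circ> h t \<circ> s"]) auto
qed

text \<open>Each line in the direction \<open>e\<close> is mapped to itself with slope at least
  \<open>m\<close>. This makes the map injective and, by the intermediate value theorem, surjective
  on the line; invariance of domain then gives the continuous inverse.\<close>

lemma deformation_shear:
  fixes u :: "point \<Rightarrow> real" and e :: point
  assumes cont: "continuous_on UNIV u" and "e \<noteq> 0" and "m > 0"
    and slope: "\<And>p s. s \<ge> 0 \<Longrightarrow> s + u (p + s *\<^sub>R e) - u p \<ge> m * s"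
  shows "deformation (\<lambda>p. p + u p *\<^sub>R e)"
proof -
  define h where "h = (\<lambda>t p. p + (t * u p) *\<^sub>R e)"
  \<comment> \<open>At time \<open>t\<close> the slope is a weighted mean of \<open>1\<close> and a
    slope of at least \<open>m\<close>, so \<open>min 1 m\<close> bounds it for all times at
    once.\<close>
  define m' where "m' = min 1 m"
  have m': "m' > 0" "m' \<le> 1" "m' \<le> m" using \<open>m > 0\<close> by (auto simp: m'_def)
  have slope': "s + t * (u (p + s *\<^sub>R e) - u p) \<ge> m' * s" if "s \<ge> 0" "t \<in> {0..1}" for s t p
  proof -
    have "s + t * (u (p + s *\<^sub>R e) - u p) = (1 - t) * s + t * (s + u (p + s *\<^sub>R e) - u p)"
      by (simp add: algebra_simps)
    also have "\<dots> \<ge> (1 - t) * (m' * s) + t * (m' * s)"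
    proof (rule add_mono)
      show "(1 - t) * (m' * s) \<le> (1 - t) * s"
        using that m' by (intro mult_left_mono) (auto simp: mult_left_le_one_le)
      have "m' * s \<le> m * s" using m' that by (intro mult_right_mono) auto
      then show "t * (m' * s) \<le> t * (s + u (p + s *\<^sub>R e) - u p)"
        using that slope[of s p] by (intro mult_left_mono) auto
    qed
    finally show ?thesis by (simp add: algebra_simps)
  qed
  have h_cont: "continuous_on ({0..1} \<times> UNIV) (\<lambda>(t, p). h t p)"
    unfolding h_def case_prod_beta'
    by (intro continuous_intros continuous_on_compose2[OF cont]) auto
  have homeo: "\<exists>k. homeomorphism UNIV UNIV (h t) k" if t: "t \<in> {0..1}" for t
  proof -
    have c: "continuous_on UNIV (h t)"
      unfolding h_def by (intro continuous_intros cont)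
    have inj: "inj (h t)"
    proof (rule injI)
      fix p q assume eq: "h t p = h t q"
      have aux: "s = 0" if "h t p = h t q" "q = p + s *\<^sub>R e" "s \<ge> 0" for p q s
      proof -
        have "(s + t * (u q - u p)) *\<^sub>R e = 0"
          using that by (simp add: h_def algebra_simps)
        then have "s + t * (u q - u p) = 0" using \<open>e \<noteq> 0\<close> by simp
        moreover have "s + t * (u q - u p) \<ge> m' * s" using slope'[of s t p] that t by simp
        ultimately have "m' * s \<le> 0" by simp
        then show "s = 0" using m' \<open>s \<ge> 0\<close> by (simp add: mult_le_0_iff)
      qed
      define s where "s = t * (u p - u q)"
      have q: "q = p + s *\<^sub>R e" using eq by (simp add: h_def s_def algebra_simps)
      show "p = q"
      proof (cases "s \<ge> 0")
        case True then show ?thesis using aux[OF eq q] q by simp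
      next
        case False
        have "p = q + (- s) *\<^sub>R e" using q by simp
        then have "- s = 0" using aux[OF eq[symmetric], of "- s"] False by simp
        then show ?thesis using False by simp
      qed
    qed
    have surj: "range (h t) = UNIV"
    proof -
      have "\<exists>p. h t p = q" for q
      proof -
        define f where "f = (\<lambda>s. s + t * u (q + s *\<^sub>R e))"
        have fc: "continuous_on A f" for A
          unfolding f_def by (intro continuous_intros continuous_on_compose2[OF cont]) auto
        \<comment> \<open>A zero \<open>s\<close> of \<open>f\<close> yields the preimage
          \<open>q + s *\<^sub>R e\<close> of \<open>q\<close>. By the slope bound \<open>f\<close>
          changes by at least \<open>m' * b = \<bar>f 0\<bar>\<close> on either side of
          \<open>0\<close>, so a zero lies in \<open>{- b..b}\<close>.\<close>
        define b where "b = \<bar>f 0\<bar> / m'"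
        have b: "b \<ge> 0" "m' * b = \<bar>f 0\<bar>" using m' by (auto simp: b_def)
        have "f b \<ge> f 0 + m' * b"
          using slope'[of b t q] t b by (simp add: f_def algebra_simps)
        moreover have "f (- b) \<le> f 0 - m' * b"
          using slope'[of b t "q + (- b) *\<^sub>R e"] t b by (simp add: f_def algebra_simps)
        ultimately have "f (- b) \<le> 0" "0 \<le> f b" using b by auto
        then obtain s where "f s = 0" using IVT'[of f "- b" 0 b] b fc by auto
        then have "h t (q + s *\<^sub>R e) = q"
          by (simp add: h_def f_def add.assoc scaleR_add_left[symmetric])
        then show ?thesis by blast
      qed
      then show ?thesis by (metis surj_def)
    qed
    obtain k where "homeomorphism UNIV (h t ` UNIV) (h t) k"
      using invariance_of_domain_homeomorphism[OF open_UNIV c] inj by auto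
    then show ?thesis using surj by auto
  qed
  have "ambient_isotopy h"
    unfolding ambient_isotopy_def using h_cont homeo by (auto simp: h_def)
  then show ?thesis
    unfolding deformation_def by (intro exI[of _ h]) (auto simp: h_def)
qed


section \<open>Subdivisions and images of oriented links\<close>

definition directed_part :: "point \<times> point \<Rightarrow> point \<times> point \<Rightarrow> bool" where
  "directed_part e f \<longleftrightarrow> closed_segment (fst e) (snd e) \<subseteq> closed_segment (fst f) (snd f) \<and>
     (\<exists>c>0. snd e - fst e = c *\<^sub>R (snd f - fst f))"

text \<open>The pieces may overlap: for the equality of \<open>oriented_components\<close> only
  covering, direction and finiteness matter.\<close>

definition subdivides :: "polygon \<Rightarrow> polygon \<Rightarrow> bool" where
  "subdivides E1 E \<longleftrightarrow> finite E1 \<and> (\<forall>e\<in>E1. \<exists>f\<in>E. directed_part e f) \<and>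
     (\<forall>f\<in>E. closed_segment (fst f) (snd f) \<subseteq>
        (\<Union>e\<in>{e \<in> E1. directed_part e f}. closed_segment (fst e) (snd e)))"

lemma subdividesI:
  assumes "finite E1" "\<And>e. e \<in> E1 \<Longrightarrow> \<exists>f\<in>E. directed_part e f"
    "\<And>f p. f \<in> E \<Longrightarrow> p \<in> closed_segment (fst f) (snd f) \<Longrightarrow>
       \<exists>e\<in>E1. directed_part e f \<and> p \<in> closed_segment (fst e) (snd e)"
  shows "subdivides E1 E"
proof -
  have "p \<in> (\<Union>e\<in>{e \<in> E1. directed_part e f}. closed_segment (fst e) (snd e))"
    if fp: "f \<in> E" "p \<in> closed_segment (fst f) (snd f)" for f p
  proof -
    obtain e where "e \<in> E1" "directed_part e f" "p \<in> closed_segment (fst e) (snd e)"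
      using assms(3)[OF fp] by (elim bexE conjE)
    then show ?thesis by (intro UN_I[of e] CollectI conjI)
  qed
  then show ?thesis
    unfolding subdivides_def using assms(1,2) by (intro conjI ballI subsetI)
qed

lemma subdivides_finite: "subdivides E1 E \<Longrightarrow> finite E1"
  unfolding subdivides_def by (elim conjE)

lemma subdivides_part: "subdivides E1 E \<Longrightarrow> e \<in> E1 \<Longrightarrow> \<exists>f\<in>E. directed_part e f"
  unfolding subdivides_def by (elim conjE) (erule bspec)

lemma subdivides_cover:
  assumes "subdivides E1 E" "f \<in> E" "p \<in> closed_segment (fst f) (snd f)"
  shows "\<exists>e\<in>E1. directed_part e f \<and> p \<in> closed_segment (fst e) (snd e)"
proof -
  have "p \<in> (\<Union>e\<in>{e \<in> E1. directed_part e f}. closed_segment (fst e) (snd e))"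
    using assms unfolding subdivides_def by (meson subsetD)
  then obtain e where "e \<in> {e \<in> E1. directed_part e f}" "p \<in> closed_segment (fst e) (snd e)"
    by (elim UN_E)
  then show ?thesis by (intro bexI[of _ e] conjI) (elim CollectE conjE, assumption)+
qed

lemma directed_part_refl: "directed_part e e"
  unfolding directed_part_def by (intro conjI subset_refl exI[of _ 1]) (rule zero_less_one, rule
      scaleR_one[symmetric])

lemma directed_part_trans:
  assumes "directed_part d e" "directed_part e f"
  shows "directed_part d f"
proof -
  obtain a where "a > 0" "snd d - fst d = a *\<^sub>R (snd e - fst e)"
    using assms unfolding directed_part_def by metis
  moreover obtain b where "b > 0" "snd e - fst e = b *\<^sub>R (snd f - fst f)"
    using assms unfolding directed_part_def by metis
  ultimately have "a * b > 0" "snd d - fst d = (a * b) *\<^sub>R (snd f - fst f)" by auto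
  then show ?thesis using assms unfolding directed_part_def by (meson order_trans)
qed

lemma subdivides_refl:
  assumes "finite E"
  shows "subdivides E E"
proof (rule subdividesI)
  show "\<exists>f\<in>E. directed_part e f" if "e \<in> E" for e
    using directed_part_refl that by (rule bexI)
  show "\<exists>e\<in>E. directed_part e f \<and> p \<in> closed_segment (fst e) (snd e)"
    if "f \<in> E" "p \<in> closed_segment (fst f) (snd f)" for f p
    using conjI[OF directed_part_refl that(2)] that(1) by (rule bexI)
qed (rule assms)

lemma subdivides_trans:
  assumes "subdivides E2 E1" "subdivides E1 E"
  shows "subdivides E2 E"
proof (rule subdividesI)
  show "finite E2" using assms(1) by (rule subdivides_finite)
  show "\<exists>f\<in>E. directed_part e f" if "e \<in> E2" for e
    using subdivides_part[OF assms(1) that] subdivides_part[OF assms(2)] directed_part_trans by meson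
  show "\<exists>e\<in>E2. directed_part e f \<and> p \<in> closed_segment (fst e) (snd e)"
    if "f \<in> E" "p \<in> closed_segment (fst f) (snd f)" for f p
    using subdivides_cover[OF assms(2) that] subdivides_cover[OF assms(1)] directed_part_trans by meson
qed

lemma subdivides_UN:
  assumes "finite S" "\<And>i. i \<in> S \<Longrightarrow> subdivides (E1 i) (E i)"
  shows "subdivides (\<Union>i\<in>S. E1 i) (\<Union>i\<in>S. E i)"
proof (rule subdividesI)
  show "finite (\<Union>i\<in>S. E1 i)" using assms subdivides_finite by blast
  show "\<exists>f\<in>(\<Union>i\<in>S. E i). directed_part e f" if e: "e \<in> (\<Union>i\<in>S. E1 i)" for e
  proof -
    obtain i where i: "i \<in> S" "e \<in> E1 i" using e by (rule UN_E)
    obtain f where f: "f \<in> E i" "directed_part e f"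
      using subdivides_part[OF assms(2)[OF i(1)] i(2)] by (rule bexE)
    show ?thesis using f(2) UN_I[OF i(1), of f E, OF f(1)] by (rule bexI)
  qed
  show "\<exists>e\<in>(\<Union>i\<in>S. E1 i). directed_part e f \<and> p \<in> closed_segment (fst e) (snd e)"
    if f: "f \<in> (\<Union>i\<in>S. E i)" and p: "p \<in> closed_segment (fst f) (snd f)" for f p
  proof -
    obtain i where i: "i \<in> S" "f \<in> E i" using f by (rule UN_E)
    obtain e where e: "e \<in> E1 i" "directed_part e f \<and> p \<in> closed_segment (fst e) (snd e)"
      using subdivides_cover[OF assms(2)[OF i(1)] i(2) p] by (rule bexE)
    show ?thesis using e(2) UN_I[OF i(1), of e E1, OF e(1)] by (rule bexI)
  qed
qed

lemma subdivides_Un: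
  assumes "subdivides E1 E" "subdivides F1 F"
  shows "subdivides (E1 \<union> F1) (E \<union> F)"
proof (rule subdividesI)
  show "finite (E1 \<union> F1)" using assms subdivides_finite by blast
  show "\<exists>f\<in>E \<union> F. directed_part e f" if "e \<in> E1 \<union> F1" for e
    using that subdivides_part[OF assms(1)] subdivides_part[OF assms(2)] by (metis UnE UnI1 UnI2)
  show "\<exists>e\<in>E1 \<union> F1. directed_part e f \<and> p \<in> closed_segment (fst e) (snd e)"
    if "f \<in> E \<union> F" "p \<in> closed_segment (fst f) (snd f)" for f p
    using that subdivides_cover[OF assms(1)] subdivides_cover[OF assms(2)] by (metis UnE UnI1 UnI2)
qed

text \<open>Common source of the reversal of orientation and of the reversed mirror image:
  \<open>r\<close> acts on directed segments and \<open>g\<close> on their points.\<close>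

lemma subdivides_map:
  assumes sub: "subdivides E1 E"
    and part: "\<And>e f. directed_part e f \<Longrightarrow> directed_part (r e) (r f)"
    and segment: "\<And>e. closed_segment (fst (r e)) (snd (r e)) = g ` closed_segment (fst e) (snd e)"
  shows "subdivides (r ` E1) (r ` E)"
proof (rule subdividesI)
  show "finite (r ` E1)"
    using subdivides_finite[OF sub] by (rule finite_imageI)
next
  fix e' assume "e' \<in> r ` E1"
  then obtain e where e: "e' = r e" "e \<in> E1" by (rule imageE)
  obtain f where f: "f \<in> E" "directed_part e f" using subdivides_part[OF sub e(2)] by (rule bexE)
  show "\<exists>f\<in>r ` E. directed_part e' f"
    unfolding e(1) using part[OF f(2)] imageI[OF f(1)] by (rule bexI)
next
  fix f' p assume "f' \<in> r ` E" and p: "p \<in> closed_segment (fst f') (snd f')"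
  then obtain f where f: "f' = r f" "f \<in> E" by (elim imageE)
  obtain q where q: "p = g q" "q \<in> closed_segment (fst f) (snd f)"
    using p unfolding f(1) segment by (rule imageE)
  obtain e where e: "e \<in> E1" "directed_part e f" "q \<in> closed_segment (fst e) (snd e)"
    using subdivides_cover[OF sub f(2) q(2)] by (elim bexE conjE)
  have "directed_part (r e) f' \<and> p \<in> closed_segment (fst (r e)) (snd (r e))"
    unfolding f(1) q(1) segment using part[OF e(2)] imageI[OF e(3)] by (rule conjI)
  then show "\<exists>e\<in>r ` E1. directed_part e f' \<and> p \<in> closed_segment (fst e) (snd e)"
    using imageI[OF e(1)] by (rule bexI)
qed

lemma directed_part_swap:
  assumes "directed_part e f"
  shows "directed_part (prod.swap e) (prod.swap f)"
proof -
  obtain c where c: "c > 0" "snd e - fst e = c *\<^sub>R (snd f - fst f)"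
    using assms unfolding directed_part_def by metis
  have "fst e - snd e = c *\<^sub>R (fst f - snd f)"
    using c(2) by (metis minus_diff_eq scaleR_minus_right)
  moreover have "closed_segment (snd e) (fst e) \<subseteq> closed_segment (snd f) (fst f)"
    using assms unfolding directed_part_def by (simp add: closed_segment_commute)
  ultimately show ?thesis
    unfolding directed_part_def fst_swap snd_swap using c(1) by blast
qed

lemma subdivides_swap:
  assumes "subdivides E1 E"
  shows "subdivides (prod.swap ` E1) (prod.swap ` E)"
  by (rule subdivides_map[OF assms directed_part_swap, where g = "\<lambda>p. p"])
     (simp_all add: closed_segment_commute)

lemma subdivides_split:
  assumes "P \<noteq> Q" "R = P + t *\<^sub>R (Q - P)" "0 < t" "t < 1"
  shows "subdivides {(P, R), (R, Q)} {(P, Q)}"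
proof -
  have R: "R \<in> closed_segment P Q"
    using assms by (auto simp: closed_segment_def algebra_simps intro!: exI[of _ t])
  have "R - P = t *\<^sub>R (Q - P)" "Q - R = (1 - t) *\<^sub>R (Q - P)"
    using assms by (auto simp: algebra_simps)
  then have "directed_part (P, R) (P, Q)" "directed_part (R, Q) (P, Q)"
    unfolding directed_part_def using assms R
    by (auto simp: subset_closed_segment intro: exI[of _ t] exI[of _ "1 - t"])
  moreover have "closed_segment P Q = closed_segment P R \<union> closed_segment R Q"
    using R by (simp add: Un_closed_segment)
  ultimately show ?thesis by (intro subdividesI) auto
qed

lemma subdivides_support:
  assumes "subdivides E1 E"
  shows "support E1 = support E"
proof (intro equalityI subsetI)
  fix p assume "p \<in> support E1"
  then obtain e where "e \<in> E1" "p \<in> closed_segment (fst e) (snd e)"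
    by (auto simp: support_def)
  then show "p \<in> support E"
    using subdivides_part[OF assms] unfolding directed_part_def support_def case_prod_beta'
    by (meson UN_I subsetD)
next
  fix p assume "p \<in> support E"
  then obtain f where "f \<in> E" "p \<in> closed_segment (fst f) (snd f)"
    by (auto simp: support_def)
  then show "p \<in> support E1"
    using subdivides_cover[OF assms] unfolding support_def case_prod_beta' by (meson UN_I)
qed

text \<open>A finite union of closed sets without interior points has no interior points, so some
  member of the cover contains an interval.\<close>

lemma finite_closed_cover_interval:
  fixes a b :: real
  assumes "finite F" "\<And>S. S \<in> F \<Longrightarrow> closed S" "{a..b} \<subseteq> \<Union>F" "a < b"
  shows "\<exists>S\<in>F. \<exists>c d. c < d \<and> {c..d} \<subseteq> S \<inter> {a..b}"
proof (rule ccontr)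
  assume contra: "\<not> ?thesis"
  have "interior (S \<inter> {a..b}) = {}" if "S \<in> F" for S
  proof (rule ccontr)
    assume "interior (S \<inter> {a..b}) \<noteq> {}"
    then obtain x e where "e > 0" "ball x e \<subseteq> S \<inter> {a..b}"
      by (meson all_not_in_conv mem_interior)
    moreover have "{x - e / 2..x + e / 2} \<subseteq> ball x e"
      using \<open>e > 0\<close> by (auto simp: ball_def dist_real_def)
    ultimately have "{x - e / 2..x + e / 2} \<subseteq> S \<inter> {a..b}" "x - e / 2 < x + e / 2"
      using \<open>e > 0\<close> by (blast, simp)
    then show False using contra that by blast
  qed
  with assms(1,2) have "interior (\<Union>S\<in>F. S \<inter> {a..b}) = {}"
  proof (induction F rule: finite_induct)
    case (insert S F)
    have "interior ((S \<inter> {a..b}) \<union> (\<Union>S\<in>F. S \<inter> {a..b})) = interior (S \<inter> {a..b})"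
      using insert by (intro interior_closed_Un_empty_interior) auto
    then show ?case using insert by simp
  qed auto
  moreover have "(\<Union>S\<in>F. S \<inter> {a..b}) = {a..b}" using assms(3) by blast
  ultimately have "interior {a..b} = {}" by metis
  then show False using \<open>a < b\<close> by simp
qed

text \<open>From \<open>E\<close> to \<open>E1\<close> this is immediate, since a stretch inside a
  piece is inside a segment of \<open>E\<close>. Conversely a stretch inside a long segment may
  cross many pieces; it moves monotonically along the segment, and one short stretch inside a single
  piece decides the direction.\<close>

lemma oriented_components_subdivides:
  assumes sub: "subdivides E1 E"
  shows "oriented_components E1 = oriented_components E"
proof -
  have supp: "support E1 = support E" by (rule subdivides_support[OF sub])
  have "\<gamma> \<in> oriented_components E1" if "\<gamma> \<in> oriented_components E" for \<gamma>
  proof -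
    have "(\<gamma> t - \<gamma> s) \<bullet> (Q - P) > 0"
      if "(P, Q) \<in> E1" "0 \<le> s" "s < t" "t \<le> 1" "\<gamma> ` {s..t} \<subseteq> closed_segment P Q" for P Q s t
    proof -
      obtain f where f: "f \<in> E" "directed_part (P, Q) f"
        using subdivides_part[OF sub \<open>(P, Q) \<in> E1\<close>] by blast
      then obtain c where c: "c > 0" "Q - P = c *\<^sub>R (snd f - fst f)"
        "closed_segment P Q \<subseteq> closed_segment (fst f) (snd f)"
        unfolding directed_part_def by auto
      have "(\<gamma> t - \<gamma> s) \<bullet> (snd f - fst f) > 0"
        using \<open>\<gamma> \<in> oriented_components E\<close> f(1) that c(3)
        unfolding oriented_components_def by (cases f) fastforce
      then show ?thesis using c by simp
    qed
    then show ?thesis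
      using that supp unfolding oriented_components_def by blast
  qed
  moreover have "\<gamma> \<in> oriented_components E" if "\<gamma> \<in> oriented_components E1" for \<gamma>
  proof -
    have simple: "simple_path \<gamma>" and fs: "pathfinish \<gamma> = pathstart \<gamma>"
      using that unfolding oriented_components_def by auto
    have mono1: "(\<gamma> t - \<gamma> s) \<bullet> (Q - P) > 0"
      if "(P, Q) \<in> E1" "0 \<le> s" "s < t" "t \<le> 1" "\<gamma> ` {s..t} \<subseteq> closed_segment P Q" for P Q s t
      using that \<open>\<gamma> \<in> oriented_components E1\<close> unfolding oriented_components_def by fast
    have "(\<gamma> t - \<gamma> s) \<bullet> (Q - P) > 0"
      if PQ: "(P, Q) \<in> E" and st: "0 \<le> s" "s < t" "t \<le> 1"
        and im: "\<gamma> ` {s..t} \<subseteq> closed_segment P Q" for P Q s t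
    proof -
      define f where "f = (\<lambda>x. \<gamma> x \<bullet> (Q - P))"
      have cont\<gamma>: "continuous_on {s..t} \<gamma>"
        using simple st unfolding simple_path_def path_def
        by (auto intro: continuous_on_subset)
      have contf: "continuous_on {s..t} f"
        unfolding f_def by (intro continuous_intros cont\<gamma>)
      \<comment> \<open>The right end is left out because \<open>\<gamma>\<close> is closed: for
        \<open>s = 0\<close> and \<open>t = 1\<close> the two ends coincide.\<close>
      have inj\<gamma>: "inj_on \<gamma> {s..<t}"
        using simple st unfolding simple_path_def loop_free_def inj_on_def by force
      \<comment> \<open>A point of the segment is determined by its projection to the direction
        \<open>Q - P\<close>.\<close>
      have inj: "inj_on f {s..<t}"
      proof (rule inj_onI)
        fix x y assume xy: "x \<in> {s..<t}" "y \<in> {s..<t}" and "f x = f y"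
        obtain a b where a: "\<gamma> x = P + a *\<^sub>R (Q - P)" and b: "\<gamma> y = P + b *\<^sub>R (Q - P)"
          using im xy by (auto simp: closed_segment_def image_subset_iff algebra_simps)
            (metis atLeastAtMost_iff less_imp_le add.commute)
        have "(\<gamma> x - \<gamma> y) \<bullet> (Q - P) = 0"
          using \<open>f x = f y\<close> by (simp add: f_def inner_diff_left)
        then have "(a - b) * ((Q - P) \<bullet> (Q - P)) = 0"
          by (simp add: a b inner_diff_left algebra_simps)
        then have "\<gamma> x = \<gamma> y" using a b by auto
        then show "x = y" using inj\<gamma> xy by (auto dest: inj_onD)
      qed
      have "continuous_on {s..<t} f"
        by (rule continuous_on_subset[OF contf]) auto
      with inj have mono: "strict_mono_on {s..<t} f \<or> strict_antimono_on {s..<t} f"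
        using injective_eq_monotone_map[of "{s..<t}" f] is_interval_co by blast
      define t' where "t' = (s + t) / 2"
      have t': "s < t'" "t' < t" using st by (auto simp: t'_def)
      define C where "C = (\<lambda>e. {x \<in> {s..t'}. \<gamma> x \<in> closed_segment (fst e) (snd e)})"
      have fin: "finite {e \<in> E1. directed_part e (P, Q)}"
        using subdivides_finite[OF sub] by simp
      have cont': "continuous_on {s..t'} \<gamma>"
        by (rule continuous_on_subset[OF cont\<gamma>]) (use t' in auto)
      have "closed (C e)" for e
      proof -
        have "C e = {s..t'} \<inter> \<gamma> -` closed_segment (fst e) (snd e)" by (auto simp: C_def)
        then show ?thesis using continuous_closed_preimage[OF cont'] by simp
      qed
      moreover have "{s..t'} \<subseteq> \<Union>(C ` {e \<in> E1. directed_part e (P, Q)})"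
      proof
        fix x assume x: "x \<in> {s..t'}"
        then have "\<gamma> x \<in> closed_segment P Q" using im t' by auto
        then obtain e where "e \<in> E1" "directed_part e (P, Q)" "\<gamma> x \<in> closed_segment (fst e) (snd e)"
          using subdivides_cover[OF sub PQ] by (metis fst_conv snd_conv)
        then show "x \<in> \<Union>(C ` {e \<in> E1. directed_part e (P, Q)})" using x unfolding C_def by blast
      qed
      \<comment> \<open>Finitely many closed preimages of pieces cover \<open>{s..t'}\<close>, so a
        whole interval \<open>{c..d}\<close> stays in one piece. There the condition on
        \<open>E1\<close> applies and excludes that \<open>f\<close> is decreasing.\<close>
      ultimately have "\<exists>S\<in>C ` {e \<in> E1. directed_part e (P, Q)}. \<exists>c d. c < d \<and> {c..d} \<subseteq> S \<inter> {s..t'}"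
        using fin t' by (intro finite_closed_cover_interval) blast+
      then obtain e c d where e: "e \<in> E1" "directed_part e (P, Q)" and cd: "c < d"
        "{c..d} \<subseteq> C e \<inter> {s..t'}" by blast
      have cds: "c \<in> {s..<t}" "d \<in> {s..<t}" using cd t' by auto
      have "(\<gamma> d - \<gamma> c) \<bullet> (snd e - fst e) > 0"
        using mono1[of "fst e" "snd e" c d] e(1) cd cds st by (auto simp: C_def)
      moreover obtain k where "k > 0" "snd e - fst e = k *\<^sub>R (Q - P)"
        using e(2) unfolding directed_part_def fst_conv snd_conv by metis
      ultimately have "f c < f d"
        by (simp add: f_def inner_diff_left zero_less_mult_iff)
      then have mono: "strict_mono_on {s..<t} f"
        using mono cds cd(1) unfolding monotone_on_def by force
      have "f s < f t'" using mono t' by (auto simp: strict_mono_on_def)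
      \<comment> \<open>The omitted right end is reached by continuity. The limit gives only
        \<open>\<le>\<close>; strictness comes from the first half of the interval.\<close>
      also have "f t' \<le> f t"
      proof (rule tendsto_lowerbound)
        show "(f \<longlongrightarrow> f t) (at t within {t'..<t})"
          using contf t'
          by (intro tendsto_within_subset[of f "nhds (f t)" t "{s..t}" "{t'..<t}"]) (auto simp:
              continuous_on_def)
        show "\<forall>\<^sub>F x in at t within {t'..<t}. f t' \<le> f x"
          unfolding eventually_at_filter
          using mono t' by (auto intro!: always_eventually simp: strict_mono_on_def le_less)
        show "at t within {t'..<t} \<noteq> bot"
          using t' islimpt_greaterThanLessThan2[of t' t]
          by (auto simp: trivial_limit_within intro: islimpt_subset)
      qed
      finally show ?thesis by (simp add: f_def inner_diff_left)
    qed
    then show ?thesis using that supp unfolding oriented_components_def by blast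
  qed
  ultimately show ?thesis by blast
qed


text \<open>Segments are required to go onto segments only as sets, because the shears used later
  may stretch a segment along itself in a nonlinear way.\<close>

definition carries :: "(point \<Rightarrow> point) \<Rightarrow> polygon \<Rightarrow> polygon \<Rightarrow> bool" where
  "carries f E E' \<longleftrightarrow> E' = map_prod f f ` E \<and>
     (\<forall>(P, Q)\<in>E. f ` closed_segment P Q = closed_segment (f P) (f Q))"

lemma carriesI:
  assumes "E' = map_prod f f ` E"
    "\<And>P Q. (P, Q) \<in> E \<Longrightarrow> f ` closed_segment P Q = closed_segment (f P) (f Q)"
  shows "carries f E E'"
  using assms unfolding carries_def by blast

lemma carries_segment:
  assumes "carries f E E'" "(P, Q) \<in> E"
  shows "f ` closed_segment P Q = closed_segment (f P) (f Q)"
  using assms unfolding carries_def by blast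

lemma carries_compose:
  assumes "carries f E E'" "carries g E' E''"
  shows "carries (g \<circ> f) E E''"
proof (rule carriesI)
  show "E'' = map_prod (g \<circ> f) (g \<circ> f) ` E"
    using assms unfolding carries_def by (simp add: image_comp map_prod.comp)
  fix P Q assume PQ: "(P, Q) \<in> E"
  then have "(f P, f Q) \<in> E'" using assms(1) unfolding carries_def by force
  then show "(g \<circ> f) ` closed_segment P Q = closed_segment ((g \<circ> f) P) ((g \<circ> f) Q)"
    using carries_segment[OF assms(1) PQ] carries_segment[OF assms(2)] by (metis comp_apply image_comp)
qed

lemma carries_Un:
  assumes "carries f E E'" "carries f F F'"
  shows "carries f (E \<union> F) (E' \<union> F')"
  using assms unfolding carries_def image_Un by blast

lemma carries_UN:
  assumes "\<And>i. i \<in> S \<Longrightarrow> carries f (E i) (E' i)"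
  shows "carries f (\<Union>i\<in>S. E i) (\<Union>i\<in>S. E' i)"
proof (rule carriesI)
  show "(\<Union>i\<in>S. E' i) = map_prod f f ` (\<Union>i\<in>S. E i)"
    using assms unfolding carries_def image_UN by (intro SUP_cong) auto
qed (use assms carries_segment in blast)

lemma carries_fixed:
  assumes "\<And>p. p \<in> support E \<Longrightarrow> f p = p"
  shows "carries f E E"
proof (rule carriesI)
  have fixed: "f p = p" if "(P, Q) \<in> E" "p \<in> closed_segment P Q" for P Q p
    using that by (intro assms) (auto simp: support_def)
  have "map_prod f f e = e" if "e \<in> E" for e
    using fixed[of "fst e" "snd e"] that by (cases e) simp
  then show "E = map_prod f f ` E" by force
  fix P Q assume PQ: "(P, Q) \<in> E"
  then have "f ` closed_segment P Q = (\<lambda>p. p) ` closed_segment P Q"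
    using fixed by (intro image_cong) auto
  then show "f ` closed_segment P Q = closed_segment (f P) (f Q)"
    using fixed[OF PQ] by simp
qed

lemma support_carries:
  assumes "carries f E E'"
  shows "f ` support E = support E'"
proof -
  have "support E' = (\<Union>(P, Q)\<in>E. closed_segment (f P) (f Q))"
    using assms unfolding support_def carries_def by force
  also have "\<dots> = (\<Union>(P, Q)\<in>E. f ` closed_segment P Q)"
    unfolding case_prod_beta'
    using carries_segment[OF assms] by (intro SUP_cong refl) (metis prod.collapse)
  also have "\<dots> = f ` support E" unfolding support_def by (auto simp: image_UN)
  finally show ?thesis by simp
qed

text \<open>Injectivity forces the parameter along the segment to be increasing.\<close>

lemma segment_image_increasing:
  fixes f :: "point \<Rightarrow> point"
  assumes cont: "continuous_on UNIV f" and inj: "inj f"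
    and im: "f ` closed_segment P Q = closed_segment (f P) (f Q)"
    and p: "p \<in> closed_segment P Q" and q: "q \<in> closed_segment P Q"
    and less: "(q - p) \<bullet> (Q - P) > 0"
  shows "(f q - f p) \<bullet> (f Q - f P) > 0"
proof -
  have "P \<noteq> Q" using less by auto
  then have "f P \<noteq> f Q" using inj by (simp add: inj_eq)
  define l where "l = (\<lambda>t. P + t *\<^sub>R (Q - P))"
  define g where "g = (\<lambda>t. (f (l t) - f P) \<bullet> (f Q - f P))"
  have l_mem: "l t \<in> closed_segment P Q" if "t \<in> {0..1}" for t
    using that unfolding l_def closed_segment_def by (auto intro!: exI[of _ t] simp: algebra_simps)
  have mem_l: "\<exists>t\<in>{0..1}. p = l t" if "p \<in> closed_segment P Q" for p
    using that unfolding l_def closed_segment_def by (auto simp: algebra_simps)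
  have "continuous_on {0..1} g"
    unfolding g_def l_def by (intro continuous_intros continuous_on_compose2[OF cont]) auto
  moreover have "inj_on g {0..1}"
  proof (rule inj_onI)
    fix s t assume st: "s \<in> {0..1}" "t \<in> {0..1}" and "g s = g t"
    have "f (l s) \<in> closed_segment (f P) (f Q)" "f (l t) \<in> closed_segment (f P) (f Q)"
      using l_mem st im by blast+
    then obtain a b where a: "f (l s) = f P + a *\<^sub>R (f Q - f P)" and b: "f (l t) = f P + b *\<^sub>R (f Q
        - f P)"
      unfolding closed_segment_def by (auto simp: algebra_simps)
    have "(a - b) * ((f Q - f P) \<bullet> (f Q - f P)) = 0"
      using \<open>g s = g t\<close> by (simp add: g_def a b algebra_simps)
    then have "f (l s) = f (l t)" using a b \<open>f P \<noteq> f Q\<close> by simp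
    then have "l s = l t" using inj by (simp add: inj_eq)
    then show "s = t" using \<open>P \<noteq> Q\<close> by (simp add: l_def)
  qed
  ultimately have "strict_mono_on {0..1} g \<or> strict_antimono_on {0..1} g"
    using injective_eq_monotone_map[of "{0..1}" g] is_interval_cc by blast
  moreover have "g 0 < g 1"
    using \<open>f P \<noteq> f Q\<close> by (simp add: g_def l_def)
  ultimately have mono: "strict_mono_on {0..1} g"
    unfolding monotone_on_def by (meson atLeastAtMost_iff less_asym order_refl zero_less_one zero_le_one)
  obtain s where s: "s \<in> {0..1}" "p = l s" using mem_l[OF p] by blast
  obtain t where t: "t \<in> {0..1}" "q = l t" using mem_l[OF q] by blast
  have "(t - s) * ((Q - P) \<bullet> (Q - P)) > 0"
    using less by (simp add: s t l_def algebra_simps)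
  then have "s < t" using \<open>P \<noteq> Q\<close> by (metis diff_gt_0_iff_gt inner_ge_zero not_less zero_less_mult_iff)
  then have "g s < g t" using mono s t by (auto simp: strict_mono_on_def)
  then show ?thesis by (simp add: g_def s t inner_diff_left)
qed

text \<open>By injectivity a stretch of \<open>f \<circ> \<gamma>\<close> inside the image of a
  segment comes from a stretch of \<open>\<gamma>\<close> inside the segment itself, and
  \<open>f\<close> preserves the order along it.\<close>

lemma oriented_components_carries:
  assumes c: "carries f E E'" and hom: "homeomorphism UNIV UNIV f k"
    and \<gamma>: "\<gamma> \<in> oriented_components E"
  shows "f \<circ> \<gamma> \<in> oriented_components E'"
proof -
  have cont: "continuous_on UNIV f" and inj: "inj f"
    using hom unfolding homeomorphism_def by (blast, metis inj_on_inverseI)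
  have "simple_path (f \<circ> \<gamma>)"
    using \<gamma> cont inj unfolding oriented_components_def
    by (auto intro!: simple_path_continuous_image intro: continuous_on_subset inj_on_subset)
  moreover have "pathfinish (f \<circ> \<gamma>) = pathstart (f \<circ> \<gamma>)"
    using \<gamma> unfolding oriented_components_def by (simp add: pathfinish_def pathstart_def)
  moreover have "path_image (f \<circ> \<gamma>) \<subseteq> support E'"
    using \<gamma> support_carries[OF c] unfolding oriented_components_def
    by (auto simp: path_image_def)
  moreover have "((f \<circ> \<gamma>) t - (f \<circ> \<gamma>) s) \<bullet> (Q' - P') > 0"
    if PQ': "(P', Q') \<in> E'" and st: "0 \<le> s" "s < t" "t \<le> 1"
      and im: "(f \<circ> \<gamma>) ` {s..t} \<subseteq> closed_segment P' Q'" for P' Q' s t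
  proof -
    obtain P Q where PQ: "(P, Q) \<in> E" "P' = f P" "Q' = f Q"
      using PQ' c unfolding carries_def by auto
    have seg: "f ` closed_segment P Q = closed_segment (f P) (f Q)"
      using carries_segment[OF c PQ(1)] .
    have "\<gamma> x \<in> closed_segment P Q" if "x \<in> {s..t}" for x
    proof -
      have "f (\<gamma> x) \<in> f ` closed_segment P Q" using im that PQ seg by auto
      then show ?thesis using inj by (simp add: inj_image_mem_iff)
    qed
    then have sub: "\<gamma> ` {s..t} \<subseteq> closed_segment P Q" by blast
    then have "(\<gamma> t - \<gamma> s) \<bullet> (Q - P) > 0"
      using \<gamma> PQ(1) st unfolding oriented_components_def by fast
    moreover have "\<gamma> s \<in> closed_segment P Q" "\<gamma> t \<in> closed_segment P Q"
      using sub st by auto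
    ultimately show ?thesis
      using segment_image_increasing[OF cont inj seg] PQ by simp
  qed
  ultimately show ?thesis unfolding oriented_components_def by blast
qed

lemma carries_inverse:
  assumes c: "carries f E E'" and hom: "homeomorphism UNIV UNIV f k"
  shows "carries k E' E"
proof -
  have kf: "k (f p) = p" for p using hom unfolding homeomorphism_def by blast
  show ?thesis
  proof (rule carriesI)
    have "map_prod k k ` E' = map_prod (k \<circ> f) (k \<circ> f) ` E"
      using c unfolding carries_def by (simp only: image_comp map_prod.comp)
    also have "k \<circ> f = id" using kf unfolding comp_def id_def by blast
    finally show "E = map_prod k k ` E'" by (simp only: prod.map_id0 image_id id_def prod.map_ident
        image_ident)
    fix P' Q' assume "(P', Q') \<in> E'"
    then have "(P', Q') \<in> map_prod f f ` E" using c unfolding carries_def by blast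
    then obtain P Q where PQ: "(P, Q) \<in> E" "P' = f P" "Q' = f Q" by (rule prod_fun_imageE) blast
    have "closed_segment P' Q' = f ` closed_segment P Q"
      using carries_segment[OF c PQ(1)] PQ by simp
    then have "k ` closed_segment P' Q' = (\<lambda>p. p) ` closed_segment P Q"
      by (simp only: image_image kf)
    then show "k ` closed_segment P' Q' = closed_segment (k P') (k Q')"
      by (simp only: image_ident PQ(2,3) kf)
  qed
qed

lemma carries_swap:
  assumes "carries f E E'"
  shows "carries f (prod.swap ` E) (prod.swap ` E')"
proof (rule carriesI)
  have "prod.swap (map_prod f f e) = map_prod f f (prod.swap e)" for e by (cases e) simp
  then show "prod.swap ` E' = map_prod f f ` prod.swap ` E"
    using assms unfolding carries_def by (simp only: image_image)
  fix P Q assume "(P, Q) \<in> prod.swap ` E"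
  then have "(Q, P) \<in> E" by (metis imageE swap_simp swap_swap)
  then show "f ` closed_segment P Q = closed_segment (f P) (f Q)"
    using carries_segment[OF assms, of Q P]
    by (simp add: closed_segment_commute[of P] closed_segment_commute[of "f P"])
qed

text \<open>The polygons \<open>E\<close> and \<open>E'\<close> are working subdivisions of the
  links \<open>F\<close> and \<open>F'\<close> of interest. Isotopy sees a polygon only through its
  support and its parametrizations, so the subdivisions can be exchanged for the originals.\<close>

lemma isotopic_carries:
  assumes d: "deformation f" and c: "carries f E E'"
    and E: "support E = support F" "oriented_components E = oriented_components F"
    and E': "support E' = support F'" "oriented_components E' = oriented_components F'"
  shows "isotopic F F'"
proof -
  obtain h where h: "ambient_isotopy h" "h 1 = f" using d unfolding deformation_def by blast
  obtain k where k: "homeomorphism UNIV UNIV f k" by (rule deformation_homeomorphism[OF d])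
  have kf: "k (f p) = p" for p using k unfolding homeomorphism_def by blast
  have "\<gamma> \<in> oriented_components E \<longleftrightarrow> f \<circ> \<gamma> \<in> oriented_components E'" for \<gamma>
  proof
    show "f \<circ> \<gamma> \<in> oriented_components E'" if "\<gamma> \<in> oriented_components E"
      using oriented_components_carries[OF c k that] .
    assume "f \<circ> \<gamma> \<in> oriented_components E'"
    then have "k \<circ> (f \<circ> \<gamma>) \<in> oriented_components E"
      using oriented_components_carries[OF carries_inverse[OF c k]] k homeomorphism_symD by blast
    moreover have "k \<circ> (f \<circ> \<gamma>) = \<gamma>" unfolding comp_def kf ..
    ultimately show "\<gamma> \<in> oriented_components E" by simp
  qed
  then show ?thesis
    unfolding isotopic_def using h(1) support_carries[OF c]
    unfolding h(2)[symmetric] E E' by (intro exI[of _ h] conjI allI)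
qed

text \<open>It is enough that no point leaves the target segment: the image is connected and
  contains both ends, so nothing in between can be missed.\<close>

lemma segment_image:
  fixes f :: "point \<Rightarrow> point"
  assumes cont: "continuous_on (closed_segment P Q) f"
    and sub: "\<And>p. p \<in> closed_segment P Q \<Longrightarrow> f p \<in> closed_segment (f P) (f Q)"
  shows "f ` closed_segment P Q = closed_segment (f P) (f Q)"
proof
  show "f ` closed_segment P Q \<subseteq> closed_segment (f P) (f Q)" using sub by blast
  define g where "g = (\<lambda>p. (f p - f P) \<bullet> (f Q - f P))"
  have "connected (g ` closed_segment P Q)"
    unfolding g_def by (intro connected_continuous_image continuous_intros cont connected_segment)
  moreover have "0 \<in> g ` closed_segment P Q" "(f Q - f P) \<bullet> (f Q - f P) \<in> g ` closed_segment P Q"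
    unfolding g_def by (rule image_eqI[of _ _ P]; simp) (rule image_eqI[of _ _ Q]; simp)
  ultimately have Icc: "{0..(f Q - f P) \<bullet> (f Q - f P)} \<subseteq> g ` closed_segment P Q"
    by (rule connected_contains_Icc)
  show "closed_segment (f P) (f Q) \<subseteq> f ` closed_segment P Q"
  proof
    fix y assume "y \<in> closed_segment (f P) (f Q)"
    then obtain b where b: "y = f P + b *\<^sub>R (f Q - f P)" "0 \<le> b" "b \<le> 1"
      unfolding closed_segment_def by (auto simp: algebra_simps)
    have "b * ((f Q - f P) \<bullet> (f Q - f P)) \<in> {0..(f Q - f P) \<bullet> (f Q - f P)}"
      using b by (simp add: mult_left_le_one_le)
    then obtain p where p: "p \<in> closed_segment P Q" "g p = b * ((f Q - f P) \<bullet> (f Q - f P))"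
      using Icc by (metis imageE subsetD)
    obtain a where a: "f p = f P + a *\<^sub>R (f Q - f P)"
      using sub[OF p(1)] unfolding closed_segment_def by (auto simp: algebra_simps)
    have "(a - b) * ((f Q - f P) \<bullet> (f Q - f P)) = 0"
      using p(2) by (simp add: g_def a algebra_simps)
    then have "f p = y" using a b by auto
    then show "y \<in> f ` closed_segment P Q" using p(1) by blast
  qed
qed


section \<open>The reflection relating the two halves of the link\<close>

lemma flip_point_flip_point [simp]: "flip_point (flip_point p) = p"
  by (cases p) (simp add: flip_point_def)

lemma flip_point_convex:
  assumes "a + b = 1"
  shows "flip_point (a *\<^sub>R P + b *\<^sub>R Q) = a *\<^sub>R flip_point P + b *\<^sub>R flip_point Q"
proof -
  have "b = 1 - a" using assms by simp
  then show ?thesis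
    by (cases P; cases Q) (simp add: flip_point_def algebra_simps)
qed

lemma flip_point_segment: "closed_segment (flip_point P) (flip_point Q) = flip_point `
    closed_segment P Q"
proof
  show "closed_segment (flip_point P) (flip_point Q) \<subseteq> flip_point ` closed_segment P Q"
  proof
    fix p assume "p \<in> closed_segment (flip_point P) (flip_point Q)"
    then obtain u where u: "0 \<le> u" "u \<le> 1" "p = (1 - u) *\<^sub>R flip_point P + u *\<^sub>R flip_point Q"
      unfolding closed_segment_def by blast
    have "p = flip_point ((1 - u) *\<^sub>R P + u *\<^sub>R Q)"
      unfolding u(3) by (rule flip_point_convex[symmetric]) simp
    moreover have "(1 - u) *\<^sub>R P + u *\<^sub>R Q \<in> closed_segment P Q"
      unfolding closed_segment_def using u by blast
    ultimately show "p \<in> flip_point ` closed_segment P Q" by (rule image_eqI)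
  qed
  show "flip_point ` closed_segment P Q \<subseteq> closed_segment (flip_point P) (flip_point Q)"
  proof
    fix p assume "p \<in> flip_point ` closed_segment P Q"
    then obtain u where u: "0 \<le> u" "u \<le> 1" "p = flip_point ((1 - u) *\<^sub>R P + u *\<^sub>R Q)"
      unfolding closed_segment_def by blast
    have "p = (1 - u) *\<^sub>R flip_point P + u *\<^sub>R flip_point Q"
      unfolding u(3) by (rule flip_point_convex) simp
    then show "p \<in> closed_segment (flip_point P) (flip_point Q)"
      unfolding closed_segment_def using u by blast
  qed
qed

text \<open>The linear part \<open>L\<close> of the affine reflection, with exactly the two
  properties needed to transport directions.\<close>

lemma flip_point_diff:
  "\<exists>L. (\<forall>P Q. flip_point P - flip_point Q = L (P - Q)) \<and> (\<forall>c v. L (c *\<^sub>R v) = c *\<^sub>R L v)"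
  by (intro exI[of _ "\<lambda>(x, y, z). (x, - y, z)"]) (auto simp: flip_point_def)

lemma directed_part_flip:
  assumes "directed_part e f"
  shows "directed_part (flip_point (snd e), flip_point (fst e)) (flip_point (snd f), flip_point (fst f))"
proof -
  obtain L where L: "\<And>P Q. flip_point P - flip_point Q = L (P - Q)" "\<And>c v. L (c *\<^sub>R v) = c *\<^sub>R L v"
    using flip_point_diff by meson
  obtain c where c: "c > 0" "snd e - fst e = c *\<^sub>R (snd f - fst f)"
    using assms unfolding directed_part_def by metis
  have "fst e - snd e = c *\<^sub>R (fst f - snd f)"
    using c(2) by (metis minus_diff_eq scaleR_minus_right)
  then have "flip_point (fst e) - flip_point (snd e) = c *\<^sub>R (flip_point (fst f) - flip_point (snd f))"
    by (simp add: L)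
  moreover have "closed_segment (flip_point (snd e)) (flip_point (fst e))
      \<subseteq> closed_segment (flip_point (snd f)) (flip_point (fst f))"
    using assms unfolding directed_part_def flip_point_segment
    by (simp add: closed_segment_commute image_mono)
  ultimately show ?thesis unfolding directed_part_def fst_conv snd_conv using c(1) by blast
qed

lemma reversed_mirror_eq: "reversed_mirror E = (\<lambda>e. (flip_point (snd e), flip_point (fst e))) ` E"
  unfolding reversed_mirror_def by (simp add: case_prod_beta')

lemma subdivides_reversed_mirror:
  assumes "subdivides E1 E"
  shows "subdivides (reversed_mirror E1) (reversed_mirror E)"
  unfolding reversed_mirror_eq
proof (rule subdivides_map[OF assms, where g = flip_point])
  show "directed_part (flip_point (snd e), flip_point (fst e)) (flip_point (snd f), flip_point (fst f))"
    if "directed_part e f" for e f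
    using that by (rule directed_part_flip)
qed (simp only: fst_conv snd_conv flip_point_segment closed_segment_commute)

text \<open>This transfers the treatment of the upper half to the lower one.\<close>

lemma carries_reversed_mirror:
  assumes "carries f E E'"
  shows "carries (flip_point \<circ> f \<circ> flip_point) (reversed_mirror E) (reversed_mirror E')"
proof (rule carriesI)
  have "reversed_mirror E' = (\<lambda>e. (flip_point (f (snd e)), flip_point (f (fst e)))) ` E"
    using assms unfolding carries_def reversed_mirror_eq by (simp add: image_image)
  then show "reversed_mirror E' =
      map_prod (flip_point \<circ> f \<circ> flip_point) (flip_point \<circ> f \<circ> flip_point) ` reversed_mirror E"
    unfolding reversed_mirror_eq by (simp add: image_image)
next
  fix P Q assume "(P, Q) \<in> reversed_mirror E"
  then obtain A B where AB: "(A, B) \<in> E" "P = flip_point B" "Q = flip_point A"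
    unfolding reversed_mirror_eq by (elim imageE) (metis prod.collapse prod.inject)
  have "closed_segment P Q = flip_point ` closed_segment A B"
    by (simp add: AB flip_point_segment closed_segment_commute)
  then have "(flip_point \<circ> f \<circ> flip_point) ` closed_segment P Q = flip_point ` f ` closed_segment A B"
    by (simp add: image_image)
  also have "\<dots> = closed_segment (flip_point (f B)) (flip_point (f A))"
    by (simp add: carries_segment[OF assms AB(1)] flip_point_segment closed_segment_commute)
  finally show "(flip_point \<circ> f \<circ> flip_point) ` closed_segment P Q =
      closed_segment ((flip_point \<circ> f \<circ> flip_point) P) ((flip_point \<circ> f \<circ> flip_point) Q)"
    using AB by simp
qed

lemma continuous_flip_point: "continuous_on A flip_point"
  unfolding flip_point_def case_prod_beta' by (intro continuous_intros)

section \<open>Shears along the coordinate axes\<close>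

lemma deformation_shear_x:
  fixes f :: "real \<Rightarrow> real \<Rightarrow> real \<Rightarrow> real"
  assumes "continuous_on UNIV (\<lambda>(x, y, z). f x y z)" "m > 0"
    "\<And>x y z s. s \<ge> 0 \<Longrightarrow> f (x + s) y z \<ge> f x y z + m * s"
  shows "deformation (\<lambda>(x, y, z). (f x y z, y, z))"
proof -
  define u where "u = (\<lambda>p. (case p of (x, y, z) \<Rightarrow> f x y z) - fst p)"
  have "deformation (\<lambda>p. p + u p *\<^sub>R (1, 0, 0))"
  proof (rule deformation_shear)
    show "continuous_on UNIV u" unfolding u_def by (intro continuous_intros assms)
    show "m * s \<le> s + u (p + s *\<^sub>R (1, 0, 0)) - u p" if "0 \<le> s" for p s
      using assms(3)[OF that] by (cases p) (simp add: u_def algebra_simps)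
  qed (simp_all add: assms zero_prod_def)
  moreover have "(\<lambda>p. p + u p *\<^sub>R (1, 0, 0)) = (\<lambda>(x, y, z). (f x y z, y, z))"
    by (auto simp: u_def fun_eq_iff)
  ultimately show ?thesis by simp
qed

lemma deformation_shear_y:
  fixes f :: "real \<Rightarrow> real \<Rightarrow> real \<Rightarrow> real"
  assumes "continuous_on UNIV (\<lambda>(x, y, z). f x y z)" "m > 0"
    "\<And>x y z s. s \<ge> 0 \<Longrightarrow> f x (y + s) z \<ge> f x y z + m * s"
  shows "deformation (\<lambda>(x, y, z). (x, f x y z, z))"
proof -
  define u where "u = (\<lambda>p. (case p of (x, y, z) \<Rightarrow> f x y z) - fst (snd p))"
  have "deformation (\<lambda>p. p + u p *\<^sub>R (0, 1, 0))"
  proof (rule deformation_shear)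
    show "continuous_on UNIV u" unfolding u_def by (intro continuous_intros assms)
    show "m * s \<le> s + u (p + s *\<^sub>R (0, 1, 0)) - u p" if "0 \<le> s" for p s
      using assms(3)[OF that] by (cases p) (simp add: u_def algebra_simps)
  qed (simp_all add: assms zero_prod_def)
  moreover have "(\<lambda>p. p + u p *\<^sub>R (0, 1, 0)) = (\<lambda>(x, y, z). (x, f x y z, z))"
    by (auto simp: u_def fun_eq_iff)
  ultimately show ?thesis by simp
qed

lemma deformation_shear_z:
  fixes f :: "real \<Rightarrow> real \<Rightarrow> real \<Rightarrow> real"
  assumes "continuous_on UNIV (\<lambda>(x, y, z). f x y z)" "m > 0"
    "\<And>x y z s. s \<ge> 0 \<Longrightarrow> f x y (z + s) \<ge> f x y z + m * s"
  shows "deformation (\<lambda>(x, y, z). (x, y, f x y z))"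
proof -
  define u where "u = (\<lambda>p. (case p of (x, y, z) \<Rightarrow> f x y z) - snd (snd p))"
  have "deformation (\<lambda>p. p + u p *\<^sub>R (0, 0, 1))"
  proof (rule deformation_shear)
    show "continuous_on UNIV u" unfolding u_def by (intro continuous_intros assms)
    show "m * s \<le> s + u (p + s *\<^sub>R (0, 0, 1)) - u p" if "0 \<le> s" for p s
      using assms(3)[OF that] by (cases p) (simp add: u_def algebra_simps)
  qed (simp_all add: assms zero_prod_def)
  moreover have "(\<lambda>p. p + u p *\<^sub>R (0, 0, 1)) = (\<lambda>(x, y, z). (x, y, f x y z))"
    by (auto simp: u_def fun_eq_iff)
  ultimately show ?thesis by simp
qed

section \<open>Standard dyadic intervals\<close>

lemma len_eq: "len A = 1 / 2 ^ fst A"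
  by (simp add: len_def lo_def hi_def add_divide_distrib)

lemma len_pos: "len A > 0"
  by (simp add: len_eq)

lemma hi_eq: "hi A = lo A + len A"
  by (simp add: len_def)

lemma mid_eq: "mid A = lo A + len A / 2"
  by (simp add: mid_def hi_eq)

lemma len_eq_iff: "len A = len B \<longleftrightarrow> fst A = fst B"
  by (simp add: len_eq)

lemma len_less_iff: "len A < len B \<longleftrightarrow> fst B < fst A"
  by (simp add: len_eq divide_simps)

lemma sd_eqI:
  assumes "lo A = lo B" "fst A = fst B"
  shows "A = B"
  using assms by (simp add: lo_def prod_eq_iff)

lemma sd_eqI':
  assumes "lo A = lo B" "hi A = hi B"
  shows "A = B"
proof (rule sd_eqI)
  have "len A = len B" using assms by (simp add: len_def)
  then show "fst A = fst B" by (simp add: len_eq_iff)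
qed (rule assms)

text \<open>At the scale of the shorter interval \<open>B\<close> all ends are integers divided by
  \<open>2 ^ fst B\<close>, and a strict inequality between integers sharpens by one. Hence
  overlapping intervals are nested.\<close>

lemma sd_nested:
  assumes "fst A \<le> fst B" "lo A < hi B" "lo B < hi A"
  shows "lo A \<le> lo B" "hi B \<le> hi A"
proof -
  define d where "d = fst B - fst A"
  have p: "(2::real) ^ fst B = 2 ^ fst A * 2 ^ d"
    using assms(1) by (simp add: d_def flip: power_add)
  have "real (snd A * 2 ^ d) < real (snd B + 1)"
    using assms(2) by (simp add: lo_def hi_def p divide_simps mult_ac)
  then have 1: "snd A * 2 ^ d \<le> snd B"
    unfolding of_nat_less_iff by simp
  have "real (snd B) < real ((snd A + 1) * 2 ^ d)"
    using assms(3) by (simp add: lo_def hi_def p divide_simps mult_ac) (simp add: algebra_simps)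
  then have 2: "snd B + 1 \<le> (snd A + 1) * 2 ^ d"
    unfolding of_nat_less_iff by simp
  have "real (snd A * 2 ^ d) \<le> real (snd B)" using 1 by (rule of_nat_mono)
  then show "lo A \<le> lo B" by (simp add: lo_def p divide_simps mult_ac)
  have "real (snd B + 1) \<le> real ((snd A + 1) * 2 ^ d)" using 2 by (rule of_nat_mono)
  then show "hi B \<le> hi A" by (simp add: hi_def p divide_simps mult_ac) (simp add: algebra_simps)
qed

text \<open>The interval \<open>B\<close> is not longer than a half of \<open>A\<close>, so if it
  meets the interior of the left half it is contained in it.\<close>

lemma sd_nested_half:
  assumes "fst A < fst B" "lo A < hi B" "lo B < hi A"
  shows "hi B \<le> mid A \<or> mid A \<le> lo B"
proof (cases "lo B < mid A")
  case True
  have eq: "lo (Suc (fst A), 2 * snd A) = lo A" "hi (Suc (fst A), 2 * snd A) = mid A"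
    by (simp_all add: lo_def hi_def mid_def field_simps)
  have "hi B \<le> hi (Suc (fst A), 2 * snd A)"
    using assms True by (intro sd_nested(2)) (simp_all add: eq)
  then show ?thesis by (simp add: eq)
qed simp

text \<open>A midpoint is the left end of the right half; facts about ends thus apply to
  midpoints.\<close>

lemma mid_eq_lo: "mid A = lo (Suc (fst A), 2 * snd A + 1)"
  by (simp add: lo_def hi_def mid_def field_simps)

text \<open>A midpoint is an odd integer over a power of \<open>2\<close>, which determines both.
  For different depths, clearing denominators would equate an even and an odd number.\<close>

lemma mid_inj:
  assumes "mid A = mid B"
  shows "A = B"
proof -
  have aux: "fst B \<le> fst A" if "mid A = mid B" for A B
  proof (rule ccontr)
    assume "\<not> fst B \<le> fst A"
    define d where "d = fst B - fst A - 1"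
    have "fst B = fst A + Suc d" using \<open>\<not> fst B \<le> fst A\<close> by (simp add: d_def)
    then have p: "(2::real) ^ fst B = 2 ^ fst A * 2 ^ Suc d" by (simp add: power_add)
    have "real ((2 * snd A + 1) * 2 ^ Suc d) = real (2 * snd B + 1)"
    proof -
      define a :: real where "a = 2 ^ fst A"
      have "a \<noteq> 0" by (simp add: a_def)
      have "(2 * real (snd A) + 1) / (2 * a) = (2 * real (snd B) + 1) / (2 * (a * 2 ^ Suc d))"
        using that unfolding mid_eq_lo lo_def fst_conv snd_conv power_Suc[of _ "fst A"] power_Suc[of
            _ "fst B"] p
        by (simp add: a_def add.commute)
      then have "a * ((2 * real (snd A) + 1) * 2 ^ Suc d) = a * (2 * real (snd B) + 1)"
        using \<open>a \<noteq> 0\<close> by (simp add: field_simps)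
      then have "(2 * real (snd A) + 1) * 2 ^ Suc d = 2 * real (snd B) + 1"
        using \<open>a \<noteq> 0\<close> by (simp only: mult_cancel_left) simp
      then show ?thesis unfolding of_nat_mult of_nat_add of_nat_power of_nat_numeral of_nat_1 .
    qed
    then have "(2 * snd A + 1) * 2 ^ Suc d = 2 * snd B + 1" unfolding of_nat_eq_iff .
    moreover have "even ((2 * snd A + 1) * 2 ^ Suc d)" by simp
    moreover have "odd (2 * snd B + 1)" by simp
    ultimately show False by simp
  qed
  have "fst A = fst B" using aux[of A B] aux[of B A] assms by simp
  then show ?thesis using assms len_eq_iff[of A B] by (intro sd_eqI) (simp_all add: mid_eq)
qed

text \<open>Cancel factors \<open>2\<close> until the numerator is odd, say
  \<open>2 * k' + 1\<close> over \<open>2 ^ Suc m\<close>; this is the midpoint of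
  \<open>(m, k')\<close>.\<close>

lemma sd_of_mid:
  assumes "0 < k" "k < 2 ^ m"
  shows "\<exists>A. is_sd A \<and> mid A = real k / 2 ^ m"
  using assms
proof (induction m arbitrary: k)
  case (Suc m)
  show ?case
  proof (cases "even k")
    case True
    then obtain k' where k': "k = 2 * k'" by blast
    then show ?thesis using Suc.IH[of k'] Suc.prems by simp
  next
    case False
    then obtain k' where "k = 2 * k' + 1" using oddE by blast
    then have "is_sd (m, k')" "mid (m, k') = real k / 2 ^ Suc m"
      using Suc.prems by (simp_all add: is_sd_def mid_eq_lo lo_def)
    then show ?thesis by blast
  qed
qed simp

lemma lo_range: "is_sd A \<Longrightarrow> 0 \<le> lo A \<and> lo A < 1"
proof -
  assume "is_sd A"
  then have "real (snd A) < real (2 ^ fst A)"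
    unfolding is_sd_def of_nat_less_iff .
  then show ?thesis by (simp add: lo_def divide_simps)
qed

lemma hi_range: "is_sd A \<Longrightarrow> 0 < hi A \<and> hi A \<le> 1"
proof -
  assume "is_sd A"
  then have "real (snd A + 1) \<le> real (2 ^ fst A)"
    unfolding is_sd_def by (intro of_nat_mono) simp
  then show ?thesis by (simp add: hi_def divide_simps)
qed

abbreviation sd_root :: sd where
  "sd_root \<equiv> (0, 0)"

lemma is_sd_fst_0: "is_sd A \<Longrightarrow> fst A = 0 \<longleftrightarrow> A = sd_root"
  by (auto simp: is_sd_def prod_eq_iff)

lemma is_sd_root [simp]: "is_sd sd_root"
  by (simp add: is_sd_def)

lemma sd_root_simps [simp]: "lo sd_root = 0" "hi sd_root = 1" "len sd_root = 1" "mid sd_root = 1 / 2"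
  by (simp_all add: lo_def hi_def len_def mid_def)

lemma is_sd_parent: "is_sd A \<Longrightarrow> is_sd (sd_parent A)"
  unfolding is_sd_def sd_parent_def by (cases "fst A") auto

lemma is_sd_conjugate: "is_sd A \<Longrightarrow> fst A > 0 \<Longrightarrow> is_sd (sd_conjugate A)"
  unfolding is_sd_def sd_conjugate_def by (cases "fst A") (auto elim!: evenE)

lemma len_parent: "fst A > 0 \<Longrightarrow> len (sd_parent A) = 2 * len A"
  by (cases "fst A") (auto simp: len_eq sd_parent_def)

lemma parent_even:
  assumes "fst A > 0" "even (snd A)"
  shows "lo (sd_parent A) = lo A" "mid (sd_parent A) = hi A" "lo (sd_conjugate A) = hi A"
    "hi (sd_conjugate A) = hi (sd_parent A)"
proof -
  obtain m k where "A = (Suc m, 2 * k)"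
    using assms by (metis evenE gr0_implies_Suc prod.collapse)
  then show "lo (sd_parent A) = lo A" "mid (sd_parent A) = hi A" "lo (sd_conjugate A) = hi A"
    "hi (sd_conjugate A) = hi (sd_parent A)"
    by (simp_all add: lo_def hi_def mid_def sd_parent_def sd_conjugate_def field_simps)
qed

lemma parent_odd:
  assumes "fst A > 0" "odd (snd A)"
  shows "hi (sd_parent A) = hi A" "mid (sd_parent A) = lo A" "hi (sd_conjugate A) = lo A"
    "lo (sd_conjugate A) = lo (sd_parent A)"
proof -
  obtain m k where "A = (Suc m, 2 * k + 1)"
    using assms by (metis oddE gr0_implies_Suc prod.collapse)
  then show "hi (sd_parent A) = hi A" "mid (sd_parent A) = lo A" "hi (sd_conjugate A) = lo A"
    "lo (sd_conjugate A) = lo (sd_parent A)"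
    by (simp_all add: lo_def hi_def mid_def sd_parent_def sd_conjugate_def field_simps)
qed

lemma fst_conjugate [simp]: "fst (sd_conjugate A) = fst A"
  by (simp add: sd_conjugate_def)

lemma len_conjugate [simp]: "len (sd_conjugate A) = len A"
  by (simp add: len_eq)

lemma conjugate_conjugate [simp]: "sd_conjugate (sd_conjugate A) = A"
  by (cases A) (auto simp: sd_conjugate_def)

lemma parent_conjugate [simp]: "sd_parent (sd_conjugate A) = sd_parent A"
  by (cases A) (auto simp: sd_conjugate_def sd_parent_def elim!: evenE oddE)

lemma mid_conjugate: "fst A > 0 \<Longrightarrow> mid (sd_conjugate A) = 2 * mid (sd_parent A) - mid A"
  using parent_even[of A] parent_odd[of A]
  by (cases "even (snd A)") (auto simp: mid_eq hi_eq)

lemma mid_parent: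
  assumes "fst A > 0"
  shows "mid A = mid (sd_parent A) + (if even (snd A) then - 1 else 1) * (len (sd_parent A) / 4)"
  using assms parent_even[of A] parent_odd[of A] len_parent[of A]
  by (auto simp: mid_eq hi_eq)

lemma sd_positive_conjugate: "fst A > 0 \<Longrightarrow> sd_positive (sd_conjugate A) \<longleftrightarrow> \<not> sd_positive A"
proof -
  assume "fst A > 0"
  then obtain m k where "A = (Suc m, k)" by (metis gr0_implies_Suc prod.collapse)
  then show ?thesis by (cases "even k") (auto simp: sd_conjugate_def elim!: evenE oddE)
qed

text \<open>Passing \<open>d\<close> times to the left half never changes the sign.\<close>

lemma sd_positive_power: "sd_positive (m + d, k * 2 ^ d) = sd_positive (m, k)"
proof (induction d)
  case (Suc d)
  have "k * 2 ^ Suc d div 2 = k * 2 ^ d" "even (k * 2 ^ Suc d)" by simp_all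
  then show ?case using Suc by simp
qed simp

text \<open>Of two intervals with the same left end, the shorter one arises from the longer by
  repeatedly taking left halves.\<close>

lemma sd_positive_lo:
  assumes "lo A = lo B"
  shows "sd_positive A = sd_positive B"
proof -
  have aux: "sd_positive B = sd_positive A" if "lo A = lo B" "fst A \<le> fst B" for A B
  proof -
    define d where "d = fst B - fst A"
    have d: "fst B = fst A + d" using that by (simp add: d_def)
    have "real (snd B) = real (snd A * 2 ^ d)"
      using that(1) by (simp add: lo_def d power_add field_simps)
    then have "snd B = snd A * 2 ^ d" unfolding of_nat_eq_iff .
    then have "B = (fst A + d, snd A * 2 ^ d)" using d by (simp add: prod_eq_iff)
    then show ?thesis using sd_positive_power[of "fst A" d "snd A"] by simp
  qed
  show ?thesis using aux[of A B] aux[of B A] assms by (cases "fst A \<le> fst B") auto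
qed

text \<open>The interval \<open>B\<close> starts where the right half of \<open>A\<close> starts, so
  it has the sign of that half.\<close>

lemma sd_positive_mid_lo: "mid A = lo B \<Longrightarrow> sd_positive B \<longleftrightarrow> \<not> sd_positive A"
  using sd_positive_lo[of "(Suc (fst A), 2 * snd A + 1)" B] by (simp add: mid_eq_lo)

lemma sd_mid_separated:
  assumes "fst A = fst B" "A \<noteq> B"
  shows "\<bar>mid A - mid B\<bar> \<ge> len A"
proof -
  have "snd A \<noteq> snd B" using assms by (simp add: prod_eq_iff)
  then have "\<bar>real (snd A) - real (snd B)\<bar> \<ge> 1" by linarith
  then have "\<bar>(real (snd A) - real (snd B)) / 2 ^ fst A\<bar> \<ge> 1 / 2 ^ fst A"
    by (simp add: divide_right_mono)
  moreover have "mid A - mid B = (real (snd A) - real (snd B)) / 2 ^ fst A"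
    using assms(1) by (simp add: mid_def lo_def hi_def field_simps)
  ultimately show ?thesis by (simp add: len_eq)
qed

section \<open>The tree of a standard dyadic partition\<close>

locale dyadic_partition =
  fixes I :: "sd list"
  assumes partition: "sd_partition I"
begin

abbreviation "n \<equiv> length I"

lemma n_pos: "n > 0"
  using partition by (simp add: sd_partition_def)

lemma leaf_sd: "i < n \<Longrightarrow> is_sd (I ! i)"
  using partition by (simp add: sd_partition_def)

lemma lo_first: "lo (I ! 0) = 0"
  using partition hd_conv_nth[of I] unfolding sd_partition_def by metis

lemma hi_last: "hi (I ! (n - 1)) = 1"
  using partition last_conv_nth[of I] unfolding sd_partition_def by metis

lemma hi_leaf: "Suc i < n \<Longrightarrow> hi (I ! i) = lo (I ! Suc i)"
  using partition by (simp add: sd_partition_def)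

lemma hi_le_lo_leaf: "i < j \<Longrightarrow> j < n \<Longrightarrow> hi (I ! i) \<le> lo (I ! j)"
proof (induction j)
  case (Suc j)
  show ?case
  proof (cases "i = j")
    case True then show ?thesis using hi_leaf Suc by simp
  next
    case False
    then have "hi (I ! i) \<le> lo (I ! j)" using Suc by simp
    also have "\<dots> \<le> hi (I ! j)" using len_pos[of "I ! j"] by (simp add: hi_eq)
    also have "\<dots> = lo (I ! Suc j)" using hi_leaf Suc by simp
    finally show ?thesis .
  qed
qed simp

lemma lo_leaf_less: "i < j \<Longrightarrow> j < n \<Longrightarrow> lo (I ! i) < lo (I ! j)"
  using hi_le_lo_leaf[of i j] len_pos[of "I ! i"] by (simp add: hi_eq)

lemma lo_leaf_less_iff: "i < n \<Longrightarrow> j < n \<Longrightarrow> lo (I ! i) < lo (I ! j) \<longleftrightarrow> i < j"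
  by (metis lo_leaf_less not_less_iff_gr_or_eq)

lemma lo_leaf_le_iff: "i < n \<Longrightarrow> j < n \<Longrightarrow> lo (I ! i) \<le> lo (I ! j) \<longleftrightarrow> i \<le> j"
  by (metis lo_leaf_less_iff not_le)

lemma leaf_cover:
  assumes "0 \<le> x" "x < 1"
  shows "\<exists>i<n. lo (I ! i) \<le> x \<and> x < hi (I ! i)"
proof -
  have fin: "finite {i. i < n \<and> lo (I ! i) \<le> x}" by simp
  moreover have "0 \<in> {i. i < n \<and> lo (I ! i) \<le> x}" using assms n_pos lo_first by simp
  ultimately have "Max {i. i < n \<and> lo (I ! i) \<le> x} \<in> {i. i < n \<and> lo (I ! i) \<le> x}"
    by (metis Max_in empty_iff)
  then obtain i where i: "i = Max {i. i < n \<and> lo (I ! i) \<le> x}" "i < n" "lo (I ! i) \<le> x" by blast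
  have "x < hi (I ! i)"
  proof (cases "Suc i < n")
    case True
    have "Suc i \<notin> {i. i < n \<and> lo (I ! i) \<le> x}"
      using Max_ge[OF fin, of "Suc i"] i(1) Suc_n_not_le_n by metis
    then show ?thesis using True hi_leaf by simp
  next
    case False
    then have "i = n - 1" using i(2) by simp
    then show ?thesis using hi_last assms by simp
  qed
  then show ?thesis using i by blast
qed

text \<open>The variant with leaves closed on the right is needed for right ends of
  intervals.\<close>

lemma leaf_cover':
  assumes "0 < x" "x \<le> 1"
  shows "\<exists>i<n. lo (I ! i) < x \<and> x \<le> hi (I ! i)"
proof (cases "x = 1")
  case True
  have "lo (I ! (n - 1)) < 1" using lo_range leaf_sd n_pos by simp
  then show ?thesis using hi_last n_pos True by (intro exI[of _ "n - 1"]) simp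
next
  case False
  then obtain i where i: "i < n" "lo (I ! i) \<le> x" "x < hi (I ! i)"
    using leaf_cover[of x] assms by auto
  show ?thesis
  proof (cases "lo (I ! i) = x")
    case True
    then obtain j where j: "i = Suc j" using assms lo_first by (cases i) auto
    then have "hi (I ! j) = x" using hi_leaf i True by simp
    then show ?thesis using i(1) j len_pos[of "I ! j"] by (intro exI[of _ j]) (simp add: hi_eq)
  next
    case False then show ?thesis using i by (intro exI[of _ i]) simp
  qed
qed

lemma breakpoint_not_inside:
  assumes "x \<in> lo ` set I" "i < n"
  shows "\<not> (lo (I ! i) < x \<and> x < hi (I ! i))"
proof
  obtain j where j: "j < n" "x = lo (I ! j)" using assms(1) by (auto simp: in_set_conv_nth)
  assume "lo (I ! i) < x \<and> x < hi (I ! i)"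
  then have "i < j" "x < hi (I ! i)" using j assms lo_leaf_less_iff by auto
  then show False using hi_le_lo_leaf[of i j] j by simp
qed

lemma hi_breakpoint: "x < 1 \<Longrightarrow> x \<in> hi ` set I \<Longrightarrow> x \<in> lo ` set I"
proof -
  assume "x < 1" "x \<in> hi ` set I"
  then obtain i where i: "i < n" "x = hi (I ! i)" by (auto simp: in_set_conv_nth)
  then have "Suc i < n" using \<open>x < 1\<close> hi_last by (metis Suc_lessI diff_Suc_1 less_irrefl)
  then show ?thesis using i hi_leaf by (metis image_eqI nth_mem)
qed

lemma lo_breakpoint: "x > 0 \<Longrightarrow> x \<in> lo ` set I \<Longrightarrow> x \<in> hi ` set I"
proof -
  assume "x > 0" "x \<in> lo ` set I"
  then obtain i where i: "i < n" "x = lo (I ! i)" by (auto simp: in_set_conv_nth)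
  then obtain j where "i = Suc j" using \<open>x > 0\<close> lo_first by (cases i) auto
  then show ?thesis using i hi_leaf[of j] by (metis Suc_lessD image_eqI nth_mem)
qed

text \<open>If an end of \<open>A\<close> were not a breakpoint, the leaf around it would overlap
  \<open>A\<close> without being contained in it. By nesting this leaf would then contain
  \<open>A\<close>, and with it the breakpoint \<open>x\<close> in its interior.\<close>

lemma sd_set_of_inside:
  assumes "is_sd A" "x \<in> lo ` set I" "lo A < x" "x < hi A"
  shows "A \<in> sd_set I"
proof -
  have "lo A \<in> lo ` set I"
  proof -
    obtain i where i: "i < n" "lo (I ! i) \<le> lo A" "lo A < hi (I ! i)"
      using leaf_cover lo_range[OF assms(1)] by blast
    have "lo (I ! i) = lo A"
    proof (rule ccontr)
      assume "lo (I ! i) \<noteq> lo A"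
      then have less: "lo (I ! i) < lo A" using i by simp
      have ov: "lo (I ! i) < hi A" using less assms by simp
      have "\<not> fst A \<le> fst (I ! i)" using sd_nested(1)[of A "I ! i"] less ov i by auto
      then have "hi A \<le> hi (I ! i)" using sd_nested(2)[of "I ! i" A] ov i by simp
      then show False using breakpoint_not_inside[OF assms(2) i(1)] less assms by simp
    qed
    then show ?thesis using i by (metis image_eqI nth_mem)
  qed
  moreover have "hi A \<in> hi ` set I"
  proof -
    obtain i where i: "i < n" "lo (I ! i) < hi A" "hi A \<le> hi (I ! i)"
      using leaf_cover' hi_range[OF assms(1)] by blast
    have "hi (I ! i) = hi A"
    proof (rule ccontr)
      assume "hi (I ! i) \<noteq> hi A"
      then have less: "hi A < hi (I ! i)" using i by simp
      have ov: "lo A < hi (I ! i)" using less assms by simp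
      have "\<not> fst A \<le> fst (I ! i)" using sd_nested(2)[of A "I ! i"] less ov i by auto
      then have "lo (I ! i) \<le> lo A" using sd_nested(1)[of "I ! i" A] ov i by simp
      then show False using breakpoint_not_inside[OF assms(2) i(1)] less assms by simp
    qed
    then show ?thesis using i by (metis image_eqI nth_mem)
  qed
  ultimately show ?thesis using assms(1) by (simp add: sd_set_def)
qed

lemma leaf_in_sd_set: "i < n \<Longrightarrow> I ! i \<in> sd_set I"
  using leaf_sd by (simp add: sd_set_def)

text \<open>If the midpoint is no breakpoint, the leaf around it is not shorter than
  \<open>A\<close>, because shorter intervals do not straddle a midpoint. So the leaf contains
  \<open>A\<close>, and since the ends of \<open>A\<close> are breakpoints the two are
  equal.\<close>

lemma sd_set_cases:
  assumes "A \<in> sd_set I"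
  shows "A \<in> set I \<or> mid A \<in> lo ` set I"
proof (rule disjCI)
  assume nb: "mid A \<notin> lo ` set I"
  have A: "is_sd A" "lo A \<in> lo ` set I" "hi A \<in> hi ` set I" using assms by (auto simp: sd_set_def)
  have mid: "lo A < mid A" "mid A < hi A" using len_pos[of A] by (auto simp: mid_eq hi_eq)
  then obtain i where i: "i < n" "lo (I ! i) \<le> mid A" "mid A < hi (I ! i)"
    using leaf_cover[of "mid A"] lo_range[OF A(1)] hi_range[OF A(1)] by force
  have less: "lo (I ! i) < mid A" using i nb by (metis image_eqI le_less nth_mem)
  have ov: "lo (I ! i) < hi A" "lo A < hi (I ! i)" using less mid i by auto
  have le: "fst (I ! i) \<le> fst A"
    using sd_nested_half[of A "I ! i"] ov less i by (meson not_le)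
  have sub: "lo (I ! i) \<le> lo A" "hi A \<le> hi (I ! i)" using sd_nested[OF le] ov by auto
  have 1: "lo A = lo (I ! i)"
    using breakpoint_not_inside[OF A(2) i(1)] sub mid i by auto
  have "hi A = hi (I ! i)"
  proof (rule ccontr)
    assume "hi A \<noteq> hi (I ! i)"
    then have l: "hi A < hi (I ! i)" using sub by simp
    then have "hi A < 1" using hi_range[OF leaf_sd[OF i(1)]] by simp
    then have "hi A \<in> lo ` set I" using hi_breakpoint A by simp
    then show False using breakpoint_not_inside[OF _ i(1)] l ov by simp
  qed
  then have "A = I ! i" using 1 sd_eqI' by blast
  then show "A \<in> set I" using i by simp
qed

lemma node_in_sd_set: "is_sd A \<Longrightarrow> mid A \<in> lo ` set I \<Longrightarrow> A \<in> sd_set I"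
  using sd_set_of_inside[of A "mid A"] len_pos[of A] by (simp add: mid_eq hi_eq)

lemma is_sd_sd_set: "A \<in> sd_set I \<Longrightarrow> is_sd A"
  by (simp add: sd_set_def)

lemma root_in_sd_set: "sd_root \<in> sd_set I"
proof -
  have "0 \<in> lo ` set I" using lo_first n_pos by (metis image_eqI nth_mem)
  moreover have "1 \<in> hi ` set I"
    using hi_last n_pos by (metis One_nat_def diff_less image_eqI nth_mem zero_less_one)
  ultimately show ?thesis by (simp add: sd_set_def)
qed

text \<open>The midpoint of the parent is an end of \<open>A\<close>. If it is the right end, it is
  also the left end of some leaf, because it lies below \<open>1\<close>.\<close>

lemma mid_parent_breakpoint:
  assumes "A \<in> sd_set I" "fst A > 0"
  shows "mid (sd_parent A) \<in> lo ` set I"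
proof (cases "even (snd A)")
  case True
  have "hi A < 1"
  proof -
    have "mid (sd_parent A) < hi (sd_parent A)" using len_pos by (simp add: mid_eq hi_eq)
    moreover have "hi (sd_parent A) \<le> 1"
      using assms hi_range is_sd_parent by (simp add: sd_set_def)
    ultimately show ?thesis using parent_even(2)[OF assms(2) True] by simp
  qed
  then show ?thesis using parent_even(2)[OF assms(2) True] hi_breakpoint assms(1)
    by (simp add: sd_set_def)
next
  case False
  then show ?thesis using parent_odd(2)[OF assms(2)] assms(1) by (simp add: sd_set_def)
qed

lemma parent_in_sd_set: "A \<in> sd_set I \<Longrightarrow> fst A > 0 \<Longrightarrow> sd_parent A \<in> sd_set I"
  using node_in_sd_set mid_parent_breakpoint is_sd_parent is_sd_sd_set by blast

lemma conjugate_in_sd_set: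
  assumes "A \<in> sd_set I" "fst A > 0"
  shows "sd_conjugate A \<in> sd_set I"
proof -
  have P: "lo (sd_parent A) \<in> lo ` set I" "hi (sd_parent A) \<in> hi ` set I"
    using parent_in_sd_set[OF assms] by (auto simp: sd_set_def)
  have sd: "is_sd (sd_conjugate A)" using is_sd_conjugate assms by (simp add: sd_set_def)
  have m: "mid (sd_parent A) \<in> lo ` set I" by (rule mid_parent_breakpoint[OF assms])
  have m': "mid (sd_parent A) \<in> hi ` set I"
  proof (rule lo_breakpoint[OF _ m])
    have "0 \<le> lo (sd_parent A)" using is_sd_parent assms lo_range by (simp add: sd_set_def)
    then show "0 < mid (sd_parent A)" using len_pos[of "sd_parent A"] by (simp add: mid_eq)
  qed
  show ?thesis
  proof (cases "even (snd A)")
    case True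
    then show ?thesis using parent_even[OF assms(2) True] P sd m by (simp add: sd_set_def)
  next
    case False
    then show ?thesis using parent_odd[OF assms(2) False] P sd m' by (simp add: sd_set_def)
  qed
qed

section \<open>Enumeration of the inner vertices of the tree by the interior breakpoints\<close>

lemma ex_node:
  assumes "0 < i" "i < n"
  shows "\<exists>A. is_sd A \<and> mid A = lo (I ! i)"
proof -
  have "lo (I ! 0) < lo (I ! i)" using lo_leaf_less assms by simp
  then have "0 < snd (I ! i)" using lo_first by (auto simp: lo_def intro: gr0I)
  then show ?thesis using sd_of_mid leaf_sd[OF assms(2)] by (simp add: is_sd_def lo_def)
qed

definition node :: "nat \<Rightarrow> sd" where
  "node i = (SOME A. is_sd A \<and> mid A = lo (I ! i))"

lemma node: "0 < i \<Longrightarrow> i < n \<Longrightarrow> is_sd (node i) \<and> mid (node i) = lo (I ! i)"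
  unfolding node_def by (rule someI_ex[OF ex_node])

text \<open>There are \<open>n\<close> leaves and \<open>n - 1\<close> inner nodes, one for each
  interior breakpoint. Index \<open>0\<close> is left out since the breakpoint \<open>0\<close> is
  no midpoint.\<close>

lemma sd_set_eq: "sd_set I = (!) I ` {..<n} \<union> node ` {1..<n}"
proof (intro equalityI subsetI)
  fix A assume A: "A \<in> sd_set I"
  show "A \<in> (!) I ` {..<n} \<union> node ` {1..<n}"
  proof (cases "A \<in> set I")
    case True then show ?thesis by (auto simp: in_set_conv_nth)
  next
    case False
    then have "mid A \<in> lo ` set I" using sd_set_cases A by blast
    then obtain i where i: "i < n" "mid A = lo (I ! i)" by (auto simp: in_set_conv_nth)
    have "0 < mid A"
      using lo_range[OF is_sd_sd_set[OF A]] len_pos[of A] by (simp add: mid_eq)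
    then have "i > 0" using i lo_first by (cases i) auto
    then have "A = node i" using node[of i] i mid_inj by simp
    then show ?thesis using i \<open>i > 0\<close> by simp
  qed
next
  fix A assume "A \<in> (!) I ` {..<n} \<union> node ` {1..<n}"
  then show "A \<in> sd_set I"
  proof
    assume "A \<in> node ` {1..<n}"
    then obtain i where i: "0 < i" "i < n" "A = node i" by (auto simp: Suc_le_eq)
    then have "mid A \<in> lo ` set I" using node[OF i(1,2)] by (metis image_eqI nth_mem)
    then show ?thesis using i node node_in_sd_set by blast
  qed (use leaf_in_sd_set in auto)
qed

lemma finite_sd_set: "finite (sd_set I)"
  by (simp add: sd_set_eq)

lemma mid_leaf: "i < n \<Longrightarrow> lo (I ! i) < mid (I ! i) \<and> mid (I ! i) < hi (I ! i)"
  using len_pos[of "I ! i"] by (simp add: mid_eq hi_eq)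

lemma mid_leaf_le_iff: "i < n \<Longrightarrow> j < n \<Longrightarrow> mid (I ! i) \<le> mid (I ! j) \<longleftrightarrow> i \<le> j"
  using mid_leaf[of i] mid_leaf[of j] hi_le_lo_leaf[of i j] hi_le_lo_leaf[of j i]
  by (cases i j rule: linorder_cases) auto

lemma lo_le_mid_leaf_iff: "i < n \<Longrightarrow> j < n \<Longrightarrow> lo (I ! i) \<le> mid (I ! j) \<longleftrightarrow> i \<le> j"
  using mid_leaf[of i] mid_leaf[of j] hi_le_lo_leaf[of i j] hi_le_lo_leaf[of j i]
  by (cases i j rule: linorder_cases) auto

lemma leaf_inj: "inj_on ((!) I) {..<n}"
proof (rule inj_onI)
  fix i j assume ij: "i \<in> {..<n}" "j \<in> {..<n}" and "I ! i = I ! j"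
  then have "lo (I ! i) = lo (I ! j)" by simp
  then show "i = j" using ij lo_leaf_less_iff[of i j] lo_leaf_less_iff[of j i]
    by (cases i j rule: linorder_cases) auto
qed

lemma node_inj: "inj_on node {1..<n}"
proof (rule inj_onI)
  fix i j assume ij: "i \<in> {1..<n}" "j \<in> {1..<n}" and eq: "node i = node j"
  then have "lo (I ! i) = lo (I ! j)" using node[of i] node[of j] by simp
  then show "i = j" using ij lo_leaf_less_iff[of i j] lo_leaf_less_iff[of j i]
    by (cases i j rule: linorder_cases) auto
qed

lemma leaf_neq_node: "i < n \<Longrightarrow> 0 < j \<Longrightarrow> j < n \<Longrightarrow> I ! i \<noteq> node j"
  using mid_leaf[of i] breakpoint_not_inside[of "lo (I ! j)" i] node[of j] by auto

lemma card_rank: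
  assumes X: "X \<subseteq> {..<n}" "Y \<subseteq> {1..<n}"
  shows "card ((!) I ` X \<union> node ` Y) = card X + card Y"
proof -
  have fin: "finite X" "finite Y" using X finite_subset by blast+
  have "card ((!) I ` X \<union> node ` Y) = card ((!) I ` X) + card (node ` Y)"
  proof (rule card_Un_disjoint)
    show "(!) I ` X \<inter> node ` Y = {}"
    proof (rule equals0I)
      fix A assume "A \<in> (!) I ` X \<inter> node ` Y"
      then obtain i j where "i \<in> X" "j \<in> Y" "I ! i = node j" by blast
      moreover from this have "i < n" "0 < j" "j < n" using X by auto
      ultimately show False using leaf_neq_node by blast
    qed
  qed (use fin in auto)
  then show ?thesis
    using X inj_on_subset[OF leaf_inj X(1)] inj_on_subset[OF node_inj X(2)] by (simp add: card_image)
qed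

lemma card_mid_le:
  "card {B \<in> sd_set I. mid B \<le> v} =
     card {i. i < n \<and> mid (I ! i) \<le> v} + card {i. 0 < i \<and> i < n \<and> lo (I ! i) \<le> v}"
proof -
  have 1: "{B \<in> (!) I ` {..<n}. mid B \<le> v} = (!) I ` {i. i < n \<and> mid (I ! i) \<le> v}"
    by auto
  have "{B \<in> node ` {1..<n}. mid B \<le> v} = node ` {i \<in> {1..<n}. mid (node i) \<le> v}"
    by auto
  also have "{i \<in> {1..<n}. mid (node i) \<le> v} = {i. 0 < i \<and> i < n \<and> lo (I ! i) \<le> v}"
    using node by (auto simp: Suc_le_eq)
  finally have 2: "{B \<in> node ` {1..<n}. mid B \<le> v} = node ` {i. 0 < i \<and> i < n \<and> lo (I ! i) \<le> v}" .
  have "{B \<in> sd_set I. mid B \<le> v} =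
      {B \<in> (!) I ` {..<n}. mid B \<le> v} \<union> {B \<in> node ` {1..<n}. mid B \<le> v}"
    unfolding sd_set_eq by blast
  then show ?thesis unfolding 1 2 by (simp, subst card_rank) (auto simp: subset_eq)
qed

text \<open>Leaves and inner nodes alternate from left to right: up to leaf \<open>i\<close> there
  are the leaves \<open>0..i\<close> and the nodes \<open>1..i\<close>.\<close>

lemma mid_rank_leaf:
  assumes "i < n"
  shows "mid_rank I (I ! i) = 2 * i + 1"
proof -
  have "{j. j < n \<and> mid (I ! j) \<le> mid (I ! i)} = {..i}"
    using assms mid_leaf_le_iff by auto
  moreover have "{j. 0 < j \<and> j < n \<and> lo (I ! j) \<le> mid (I ! i)} = {1..i}"
    using assms lo_le_mid_leaf_iff by auto
  ultimately show ?thesis by (simp add: mid_rank_def card_mid_le)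
qed

lemma mid_rank_node:
  assumes "0 < i" "i < n"
  shows "mid_rank I (node i) = 2 * i"
proof -
  have "mid (I ! j) \<le> lo (I ! i) \<longleftrightarrow> j < i" if "j < n" for j
  proof (cases "j < i")
    case True
    then show ?thesis using mid_leaf[OF that] hi_le_lo_leaf[of j i] assms by simp
  next
    case False
    then have "lo (I ! i) \<le> lo (I ! j)" using lo_leaf_le_iff assms that by simp
    then show ?thesis using mid_leaf[OF that] False by simp
  qed
  then have "{j. j < n \<and> mid (I ! j) \<le> lo (I ! i)} = {..<i}"
    using assms by auto
  moreover have "{j. 0 < j \<and> j < n \<and> lo (I ! j) \<le> lo (I ! i)} = {1..i}"
    using assms lo_leaf_le_iff by auto
  ultimately show ?thesis using node[OF assms] by (simp add: mid_rank_def card_mid_le)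
qed

lemma mid_rank_less_iff:
  assumes "A \<in> sd_set I" "B \<in> sd_set I"
  shows "mid_rank I A < mid_rank I B \<longleftrightarrow> mid A < mid B"
proof -
  have "mid_rank I A < mid_rank I B" if "mid A < mid B" "A \<in> sd_set I" "B \<in> sd_set I" for A B
    unfolding mid_rank_def
  proof (rule psubset_card_mono)
    have "B \<notin> {C \<in> sd_set I. mid C \<le> mid A}" "B \<in> {C \<in> sd_set I. mid C \<le> mid B}"
      using that by auto
    moreover have "{C \<in> sd_set I. mid C \<le> mid A} \<subseteq> {C \<in> sd_set I. mid C \<le> mid B}"
      using that by auto
    ultimately show "{C \<in> sd_set I. mid C \<le> mid A} \<subset> {C \<in> sd_set I. mid C \<le> mid B}"
      by blast
  qed (use finite_sd_set in simp)
  from this[of A B] this[of B A] show ?thesis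
    using assms mid_inj[of A B] by (cases "mid A" "mid B" rule: linorder_cases) auto
qed

lemma mid_rank_inj: "A \<in> sd_set I \<Longrightarrow> B \<in> sd_set I \<Longrightarrow> mid_rank I A = mid_rank I B \<Longrightarrow> A = B"
  using mid_rank_less_iff[of A B] mid_rank_less_iff[of B A] mid_inj[of A B]
  by (cases "mid A" "mid B" rule: linorder_cases) auto

text \<open>The range depends only on \<open>n\<close>, which is what allows the columns of two
  partitions of equal size to be matched.\<close>

lemma mid_rank_range: "mid_rank I ` sd_set I = {1..2 * n - 1}"
proof (intro equalityI subsetI)
  fix r assume "r \<in> mid_rank I ` sd_set I"
  then show "r \<in> {1..2 * n - 1}"
  proof (elim imageE)
    fix A assume r: "r = mid_rank I A" and "A \<in> sd_set I"
    then consider i where "i < n" "A = I ! i" | i where "0 < i" "i < n" "A = node i"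
      by (auto simp: sd_set_eq Suc_le_eq)
    then show "r \<in> {1..2 * n - 1}" by cases (use r mid_rank_leaf mid_rank_node in auto)
  qed
next
  fix r assume r: "r \<in> {1..2 * n - 1}"
  show "r \<in> mid_rank I ` sd_set I"
  proof (cases "even r")
    case True
    then obtain i where "r = 2 * i" by blast
    then have "0 < i" "i < n" using r by auto
    then show ?thesis using mid_rank_node[of i] \<open>r = 2 * i\<close>
      by (intro image_eqI[of _ _ "node i"]) (simp_all add: sd_set_eq)
  next
    case False
    then obtain i where "r = 2 * i + 1" by (rule oddE)
    then have "i < n" using r by auto
    then show ?thesis using mid_rank_leaf[of i] \<open>r = 2 * i + 1\<close>
      by (intro image_eqI[of _ _ "I ! i"]) (simp_all add: sd_set_eq)
  qed
qed

lemma grid_x_ge_2: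
  assumes "A \<in> sd_set I"
  shows "grid_x I A \<ge> 2"
proof -
  have "mid_rank I A \<in> {1..2 * n - 1}"
    using assms unfolding mid_rank_range[symmetric] by (rule imageI)
  then show ?thesis by (simp add: grid_x_def)
qed

text \<open>Rank \<open>2 * i + 1\<close> belongs to leaf \<open>i\<close> and rank
  \<open>2 * i\<close> to node \<open>i\<close>, whose midpoint is the left end of leaf
  \<open>i\<close> and whose sign is therefore the opposite one. So the signs of the leaves
  determine the sign in every column.\<close>

lemma sd_positive_rank:
  assumes "A \<in> sd_set I"
  shows "sd_positive A \<longleftrightarrow> (if even (mid_rank I A) then \<not> sd_positive (I ! (mid_rank I A div 2))
    else sd_positive (I ! (mid_rank I A div 2)))"
  using assms unfolding sd_set_eq
proof
  assume "A \<in> (!) I ` {..<n}"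
  then show ?thesis using mid_rank_leaf by auto
next
  assume "A \<in> node ` {1..<n}"
  then obtain i where i: "0 < i" "i < n" "A = node i" by (auto simp: Suc_le_eq)
  then show ?thesis using mid_rank_node[of i] sd_positive_mid_lo[of "node i" "I ! i"] node[of i] by simp
qed

text \<open>For each \<open>i > 0\<close> exactly one of leaf \<open>i\<close> and node
  \<open>i\<close> is positive, and leaf \<open>0\<close> is positive as well.\<close>

lemma card_positive: "card {A \<in> sd_set I. sd_positive A} = n"
proof -
  define X where "X = {i. i < n \<and> sd_positive (I ! i)}"
  \<comment> \<open>The first leaf has the left end \<open>0\<close> of the root interval, hence its
    sign.\<close>
  have "sd_positive (I ! 0)" using sd_positive_lo[of "I ! 0" sd_root] lo_first by simp
  then have 0: "0 \<in> X" using n_pos by (simp add: X_def)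
  have "{A \<in> sd_set I. sd_positive A} = (!) I ` X \<union> node ` ({..<n} - X)"
  proof -
    have nd: "sd_positive (node i) \<longleftrightarrow> i \<notin> X" if "0 < i" "i < n" for i
      using that node[OF that] sd_positive_mid_lo[of "node i" "I ! i"] by (simp add: X_def)
    have "0 \<notin> {..<n} - X" using 0 by simp
    then have "{..<n} - X = {i \<in> {1..<n}. i \<notin> X}" by (auto simp: Suc_le_eq intro: gr0I)
    then have img: "node ` ({..<n} - X) = {A \<in> node ` {1..<n}. sd_positive A}" using nd by force
    have "(!) I ` X = {A \<in> (!) I ` {..<n}. sd_positive A}" by (auto simp: X_def)
    then show ?thesis unfolding img sd_set_eq by blast
  qed
  moreover have "{..<n} - X \<subseteq> {1..<n}" using 0 by (auto simp: Suc_le_eq intro: gr0I)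
  ultimately have "card {A \<in> sd_set I. sd_positive A} = card X + card ({..<n} - X)"
    using card_rank[of X "{..<n} - X"] by (simp add: X_def subset_eq)
  also have "\<dots> = card {..<n}"
    by (metis (no_types, lifting) X_def card_Diff_subset card_mono finite_lessThan finite_subset
        le_add_diff_inverse lessThan_iff mem_Collect_eq subsetI)
  finally show ?thesis by simp
qed

end

section \<open>The order of the rows\<close>

lemma same_parent:
  assumes "fst A > 0" "fst A = fst B" "sd_parent A = sd_parent B"
  shows "B = A \<or> B = sd_conjugate A"
proof -
  have eq: "snd A div 2 = snd B div 2" using assms by (simp add: sd_parent_def)
  then have "snd B = snd A \<or> snd B = (if even (snd A) then snd A + 1 else snd A - 1)"
    by presburger
  then show ?thesis using assms by (auto simp: prod_eq_iff sd_conjugate_def)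
qed

definition row_rep :: "sd \<Rightarrow> sd" where
  "row_rep A = (if sd_positive A then A else sd_conjugate A)"

lemma grid_y_eq: "grid_y I A = positive_rank I (row_rep A)"
  by (simp add: grid_y_def row_rep_def)

lemma fst_row_rep [simp]: "fst (row_rep A) = fst A"
  by (simp add: row_rep_def)

lemma len_row_rep [simp]: "len (row_rep A) = len A"
  by (simp add: len_eq)

lemma sd_positive_root [simp]: "sd_positive sd_root"
  by simp

context dyadic_partition
begin

lemma fst_pos_iff: "A \<in> sd_set I \<Longrightarrow> fst A > 0 \<longleftrightarrow> A \<noteq> sd_root"
  using is_sd_fst_0 is_sd_sd_set by (metis neq0_conv)

lemma row_rep_in: "A \<in> sd_set I \<Longrightarrow> row_rep A \<in> sd_set I \<and> sd_positive (row_rep A)"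
proof -
  assume A: "A \<in> sd_set I"
  show ?thesis
  proof (cases "sd_positive A")
    case True then show ?thesis using A by (simp add: row_rep_def)
  next
    case False
    then have "A \<noteq> sd_root" by auto
    then have "fst A > 0" using fst_pos_iff A by blast
    then show ?thesis using False A conjugate_in_sd_set sd_positive_conjugate by (simp add: row_rep_def)
  qed
qed

lemma positive_rank_less:
  assumes "A \<in> sd_set I" "sd_positive A" "B \<in> sd_set I" "sd_positive B"
    and less: "len A < len B \<or> len A = len B \<and> mid A < mid B"
  shows "positive_rank I A < positive_rank I B"
  unfolding positive_rank_def
proof (rule psubset_card_mono)
  let ?R = "\<lambda>A. {B \<in> sd_set I. sd_positive B \<and> (len B < len A \<or> len B = len A \<and> mid B \<le> mid A)}"
  show "finite (?R B)" using finite_sd_set by simp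
  have "B \<notin> ?R A" "B \<in> ?R B" using assms by auto
  moreover have "?R A \<subseteq> ?R B" using less by auto
  ultimately show "?R A \<subset> ?R B" by blast
qed

lemma positive_rank_ge_1: "A \<in> sd_set I \<Longrightarrow> sd_positive A \<Longrightarrow> positive_rank I A \<ge> 1"
proof -
  assume A: "A \<in> sd_set I" "sd_positive A"
  have "A \<in> {B \<in> sd_set I. sd_positive B \<and> (len B < len A \<or> len B = len A \<and> mid B \<le> mid A)}"
    using A by simp
  moreover have "finite {B \<in> sd_set I. sd_positive B \<and> (len B < len A \<or> len B = len A \<and> mid B \<le> mid A)}"
    using finite_sd_set by simp
  ultimately have "positive_rank I A > 0" unfolding positive_rank_def card_gt_0_iff by blast
  then show ?thesis by simp
qed

lemma len_less_root: "A \<in> sd_set I \<Longrightarrow> A \<noteq> sd_root \<Longrightarrow> len A < 1"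
  using fst_pos_iff[of A] by (simp add: len_eq)

lemma positive_rank_root: "positive_rank I sd_root = n"
proof -
  have "{B \<in> sd_set I. sd_positive B \<and> (len B < len sd_root \<or> len B = len sd_root \<and> mid B \<le> mid sd_root)}
      = {B \<in> sd_set I. sd_positive B}"
  proof (intro equalityI subsetI)
    fix B assume B: "B \<in> {B \<in> sd_set I. sd_positive B}"
    then have "len B < len sd_root \<or> len B = len sd_root \<and> mid B \<le> mid sd_root"
      using len_less_root[of B] by (cases "B = sd_root") simp_all
    then show "B \<in> {B \<in> sd_set I. sd_positive B \<and>
        (len B < len sd_root \<or> len B = len sd_root \<and> mid B \<le> mid sd_root)}"
      using B by blast
  qed blast
  then show ?thesis using card_positive by (simp add: positive_rank_def)
qed

lemma grid_y_root: "grid_y I sd_root = n"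
  by (simp add: grid_y_def positive_rank_root)

lemma grid_y_ge_1: "A \<in> sd_set I \<Longrightarrow> grid_y I A \<ge> 1"
  using positive_rank_ge_1 row_rep_in by (simp add: grid_y_eq)

lemma grid_y_less_n: "A \<in> sd_set I \<Longrightarrow> A \<noteq> sd_root \<Longrightarrow> grid_y I A < n"
proof -
  assume A: "A \<in> sd_set I" "A \<noteq> sd_root"
  have "positive_rank I (row_rep A) < positive_rank I sd_root"
    using A row_rep_in root_in_sd_set len_less_root by (intro positive_rank_less) auto
  then show ?thesis by (simp add: grid_y_eq positive_rank_root)
qed

lemma grid_y_le_n: "A \<in> sd_set I \<Longrightarrow> grid_y I A \<le> n"
  using grid_y_less_n grid_y_root by (cases "A = sd_root") (auto simp: less_imp_le)

lemma grid_y_conjugate: "fst A > 0 \<Longrightarrow> grid_y I (sd_conjugate A) = grid_y I A"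
  using sd_positive_conjugate by (simp add: grid_y_def)

text \<open>Length and then midpoint order the positive intervals totally, since midpoints are
  distinct; so a row determines its positive interval.\<close>

lemma grid_y_eqD:
  assumes "A \<in> sd_set I" "B \<in> sd_set I" "grid_y I A = grid_y I B"
  shows "B = A \<or> B = sd_conjugate A"
proof -
  have "row_rep A = row_rep B"
  proof (rule ccontr)
    assume "row_rep A \<noteq> row_rep B"
    then have "mid (row_rep A) \<noteq> mid (row_rep B)" using mid_inj by blast
    then have "(len (row_rep A) < len (row_rep B) \<or> len (row_rep A) = len (row_rep B) \<and> mid (row_rep
        A) < mid (row_rep B)) \<or>
      (len (row_rep B) < len (row_rep A) \<or> len (row_rep B) = len (row_rep A) \<and> mid (row_rep B) < mid
          (row_rep A))"
      by linarith
    then show False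
      using assms positive_rank_less[of "row_rep A" "row_rep B"] positive_rank_less[of "row_rep B"
          "row_rep A"]
        row_rep_in by (metis grid_y_eq less_irrefl)
  qed
  then show ?thesis by (metis conjugate_conjugate row_rep_def)
qed

text \<open>This isolates the only delicate case for the heights: different rows with the same
  target height have different parents, so their bridges lie over disjoint intervals.\<close>

lemma grid_y_less_cases:
  assumes A: "A \<in> sd_set I" and B: "B \<in> sd_set I" and less: "grid_y I B < grid_y I A"
  shows "len B < len A \<or> len B = len A \<and> sd_parent A \<noteq> sd_parent B"
proof (rule ccontr)
  assume contra: "\<not> ?thesis"
  show False
  proof (cases "len B = len A")
    case False
    then have "len (row_rep A) < len (row_rep B)" using contra by simp
    then have "grid_y I A < grid_y I B"
      unfolding grid_y_eq using positive_rank_less row_rep_in A B by blast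
    then show False using less by simp
  next
    case True
    then have p: "sd_parent A = sd_parent B" "fst A = fst B" using contra by (auto simp: len_eq_iff)
    show False
    proof (cases "fst A > 0")
      case True
      then have "B = A \<or> B = sd_conjugate A" using same_parent p by blast
      then show False using less grid_y_conjugate[OF True] by auto
    next
      case False
      then have "\<not> fst A > 0" "\<not> fst B > 0" using p by simp_all
      then have "A = sd_root" "B = sd_root" using fst_pos_iff[OF A] fst_pos_iff[OF B] by metis+
      then show False using less by simp
    qed
  qed
qed

end

section \<open>Uniqueness of the reduced pair\<close>

definition affine_on_sd :: "(real \<Rightarrow> real) \<Rightarrow> sd \<Rightarrow> sd \<Rightarrow> bool" where
  "affine_on_sd g A B \<longleftrightarrow> is_sd A \<and> is_sd B \<and>
     (\<forall>x\<in>{lo A..hi A}. g x = lo B + len B / len A * (x - lo A))"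

text \<open>An affine map between standard dyadic intervals preserves relative position: the piece
  number \<open>r\<close> among the \<open>2 ^ d\<close> pieces of \<open>A\<close> goes to the
  piece number \<open>r\<close> of \<open>B\<close>.\<close>

lemma affine_on_sd_sub:
  assumes g: "affine_on_sd g A B" and P: "is_sd P" "lo A \<le> lo P" "hi P \<le> hi A"
  shows "\<exists>P'. is_sd P' \<and> lo P' = g (lo P) \<and> hi P' = g (hi P)"
proof -
  have "len P \<le> len A" using P by (simp add: hi_eq)
  then have "fst A \<le> fst P" by (meson len_less_iff not_le)
  define d where "d = fst P - fst A"
  have d: "fst P = fst A + d" using \<open>fst A \<le> fst P\<close> by (simp add: d_def)
  have p: "(2::real) ^ fst P = 2 ^ fst A * 2 ^ d" by (simp add: d power_add)
  have "real (snd A * 2 ^ d) \<le> real (snd P)" using P(2) by (simp add: lo_def p divide_simps mult_ac)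
  then have "snd A * 2 ^ d \<le> snd P" unfolding of_nat_le_iff .
  then obtain r where r: "snd P = snd A * 2 ^ d + r" by (metis le_Suc_ex)
  have "(real (snd P) + 1) \<le> (real (snd A) + 1) * 2 ^ d"
    using P(3) by (simp add: hi_def p divide_simps mult_ac)
  then have "real (r + 1) \<le> real (2 ^ d)" by (simp add: r algebra_simps)
  then have r2: "r + 1 \<le> 2 ^ d" unfolding of_nat_le_iff .
  define P' where "P' = (fst B + d, snd B * 2 ^ d + r)"
  have "snd B + 1 \<le> 2 ^ fst B" using g by (simp add: affine_on_sd_def is_sd_def)
  then have "(snd B + 1) * 2 ^ d \<le> 2 ^ fst B * 2 ^ d" by (rule mult_right_mono) simp
  then have "is_sd P'" using r2 by (simp add: is_sd_def P'_def power_add algebra_simps)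
  moreover have "lo P' = lo B + len B / len A * (lo P - lo A)" "hi P' = lo B + len B / len A * (hi P
      - lo A)"
    by (simp_all add: P'_def lo_def hi_def len_eq p r power_add field_simps)
  moreover have "lo P \<in> {lo A..hi A}" "hi P \<in> {lo A..hi A}"
    using P len_pos[of P] by (auto simp: hi_eq)
  ultimately show ?thesis using g unfolding affine_on_sd_def by metis
qed

lemma represents_affine:
  assumes "represents I J g" "i < length I"
  shows "affine_on_sd g (I ! i) (J ! i)"
proof -
  have "is_sd (I ! i)" "is_sd (J ! i)"
    using assms unfolding represents_def sd_pair_def sd_partition_def by auto
  then show ?thesis using assms unfolding represents_def affine_on_sd_def by blast
qed

lemma affine_on_sd_ends:
  assumes "affine_on_sd g A B"
  shows "g (lo A) = lo B" "g (hi A) = hi B"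
  using assms len_pos[of A] unfolding affine_on_sd_def by (auto simp: hi_eq)

text \<open>
  Otherwise a deepest leaf inside \<open>A\<close> and its sibling, which is then also a leaf, could be merged.
\<close>

lemma reduced_pair_leaf_maximal:
  assumes red: "reduced_pair I J" and rep: "represents I J g"
    and A: "affine_on_sd g A B" and i: "i < length I"
    and sub: "lo A \<le> lo (I ! i)" "hi (I ! i) \<le> hi A"
  shows "I ! i = A"
proof (rule ccontr)
  assume neq: "I ! i \<noteq> A"
  interpret dyadic_partition I
    using red by unfold_locales (simp add: reduced_pair_def sd_pair_def)
  have sdA: "is_sd A" using A by (simp add: affine_on_sd_def)
  have inside: "lo A \<le> lo C \<and> hi C \<le> hi A"
    if "fst A \<le> fst C" "lo C < hi A" "lo A < hi C" for C
    using sd_nested[of A C] that by simp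
  have "fst A < fst (I ! i)"
  proof (rule ccontr)
    assume "\<not> fst A < fst (I ! i)"
    then have "lo (I ! i) \<le> lo A" "hi A \<le> hi (I ! i)"
      using sd_nested[of "I ! i" A] sub len_pos[of "I ! i"] by (auto simp: hi_eq)
    then show False using sub neq sd_eqI'[of "I ! i" A] by simp
  qed
  define K where "K = {j. j < n \<and> lo A \<le> lo (I ! j) \<and> hi (I ! j) \<le> hi A}"
  have K: "finite K" "i \<in> K" using i sub by (simp_all add: K_def)
  have "Max ((\<lambda>k. fst (I ! k)) ` K) \<in> (\<lambda>k. fst (I ! k)) ` K" using K by (intro Max_in) auto
  then obtain j where j: "j \<in> K" "Max ((\<lambda>k. fst (I ! k)) ` K) = fst (I ! j)" by (elim imageE)
  have j_max: "fst (I ! k) \<le> fst (I ! j)" if "k \<in> K" for k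
    unfolding j(2)[symmetric] using K(1) that by (intro Max_ge) auto
  define C where "C = I ! j"
  have C: "j < n" "lo A \<le> lo C" "hi C \<le> hi A" "fst A < fst C"
    using j(1) less_le_trans[OF \<open>fst A < fst (I ! i)\<close> j_max[OF K(2)]] by (simp_all add: K_def C_def)
  have CS: "C \<in> sd_set I" using C leaf_in_sd_set by (simp add: C_def)
  have pos: "fst C > 0" using C by simp
  define P where "P = sd_parent C"
  have P_sd: "is_sd P" using is_sd_parent is_sd_sd_set CS by (simp add: P_def)
  have fstP: "fst P + 1 = fst C" using pos by (simp add: P_def sd_parent_def)
  have PC: "lo P \<le> lo C" "hi C \<le> hi P"
    using parent_even[OF pos] parent_odd[OF pos] len_parent[OF pos] len_pos[of C]
    unfolding P_def by (cases "even (snd C)"; simp add: hi_eq)+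
  have PA: "lo A \<le> lo P \<and> hi P \<le> hi A"
    using C fstP PC len_pos[of C] by (intro inside) (auto simp: hi_eq)
  have conj_P: "lo P \<le> lo (sd_conjugate C)" "hi (sd_conjugate C) \<le> hi P"
    using parent_even[OF pos] parent_odd[OF pos] len_parent[OF pos] len_pos[of C]
    unfolding P_def by (cases "even (snd C)"; simp add: hi_eq)+
  \<comment> \<open>If the sibling were subdivided, the leaf starting at its midpoint would be
    inside \<open>A\<close> and deeper than \<open>C\<close>, against the choice of
    \<open>C\<close>.\<close>
  have "sd_conjugate C \<in> set I"
  proof (rule ccontr)
    assume "sd_conjugate C \<notin> set I"
    then have "mid (sd_conjugate C) \<in> lo ` set I"
      using sd_set_cases conjugate_in_sd_set[OF CS pos] by blast
    then obtain k where k: "k < n" "lo (I ! k) = mid (sd_conjugate C)" by (auto simp: in_set_conv_nth)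
    have lo_mid: "lo (sd_conjugate C) < mid (sd_conjugate C)" "mid (sd_conjugate C) < hi
        (sd_conjugate C)"
      using len_pos[of "sd_conjugate C"] by (auto simp: mid_eq hi_eq)
    have ov: "lo (I ! k) < hi (sd_conjugate C)" "lo (sd_conjugate C) < hi (I ! k)"
      using k lo_mid len_pos[of "I ! k"] by (auto simp: hi_eq)
    have deeper: "fst C < fst (I ! k)"
      using sd_nested(1)[of "I ! k" "sd_conjugate C"] ov k lo_mid by (cases "fst C < fst (I ! k)") auto
    then have "hi (I ! k) \<le> hi (sd_conjugate C)"
      using sd_nested(2)[of "sd_conjugate C" "I ! k"] ov by simp
    then have "k \<in> K" using k lo_mid conj_P PA by (simp add: K_def)
    then show False using j_max[of k] deeper by (simp add: C_def)
  qed
  then obtain k where k: "k < n" "I ! k = sd_conjugate C" by (auto simp: in_set_conv_nth)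
  have adj: "b = Suc a" if "a < n" "b < n" "hi (I ! a) = lo (I ! b)" for a b
  proof -
    have "lo (I ! a) < lo (I ! b)" using that len_pos[of "I ! a"] by (simp add: hi_eq)
    then have ab: "a < b" using lo_leaf_less_iff that by simp
    then have "lo (I ! Suc a) = lo (I ! b)" using hi_leaf[of a] that by simp
    then show ?thesis using lo_leaf_less[of "Suc a" b] ab that by (cases "Suc a < b") auto
  qed
  obtain a where a: "Suc a < n" "lo (I ! a) = lo P" "hi (I ! Suc a) = hi P"
  proof (cases "even (snd C)")
    case True
    then have "k = Suc j" using adj[of j k] C k parent_even[OF pos True] by (simp add: C_def)
    then show ?thesis using that[of j] k parent_even[OF pos True] by (simp add: C_def P_def)
  next
    case False
    then have "j = Suc k" using adj[of k j] C k parent_odd[OF pos False] by (simp add: C_def)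
    then show ?thesis using that[of k] C k parent_odd[OF pos False] by (simp add: C_def P_def)
  qed
  have "mergeable I a" using a P_sd unfolding mergeable_def by metis
  \<comment> \<open>Since \<open>P\<close> lies in \<open>A\<close>, the map \<open>g\<close> sends
    its ends to those of a standard dyadic interval; they are the outer ends of the leaves
    \<open>a\<close> and \<open>Suc a\<close> of \<open>J\<close>.\<close>
  moreover have "mergeable J a"
  proof -
    obtain P' where P': "is_sd P'" "lo P' = g (lo P)" "hi P' = g (hi P)"
      using affine_on_sd_sub[OF A P_sd] PA by blast
    moreover have "g (lo P) = lo (J ! a)" "g (hi P) = hi (J ! Suc a)"
      using affine_on_sd_ends[OF represents_affine[OF rep]] a by (metis Suc_lessD)+
    ultimately show ?thesis unfolding mergeable_def by metis
  qed
  ultimately show False using red a(1) by (auto simp: reduced_pair_def)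
qed

text \<open>The leaves are compared from left to right. Two leaves with the same left end are
  nested, and the one contained in the other equals it by maximality. If one list were longer, it
  would have a leaf starting at \<open>1\<close>.\<close>

lemma reduced_pair_unique:
  assumes red: "reduced_pair I J" and rep: "represents I J g"
    and red': "reduced_pair I' J'" and rep': "represents I' J' g"
  shows "I' = I \<and> J' = J"
proof -
  interpret P: dyadic_partition I
    using red by unfold_locales (simp add: reduced_pair_def sd_pair_def)
  interpret P': dyadic_partition I'
    using red' by unfold_locales (simp add: reduced_pair_def sd_pair_def)
  have eq: "I ! i = I' ! i" if "i < length I" "i < length I'" for i
    using that
  proof (induction i rule: less_induct)
    case (less i)
    have lo: "lo (I ! i) = lo (I' ! i)"
    proof (cases i)
      case 0 then show ?thesis using P.lo_first P'.lo_first by simp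
    next
      case (Suc k)
      then have "I ! k = I' ! k" using less by simp
      then show ?thesis using P.hi_leaf[of k] P'.hi_leaf[of k] less Suc by simp
    qed
    have hi: "lo (I ! i) < hi (I ! i)" "lo (I' ! i) < hi (I' ! i)"
      using len_pos[of "I ! i"] len_pos[of "I' ! i"] by (simp_all add: hi_eq)
    show ?case
    proof (cases "hi (I ! i) \<le> hi (I' ! i)")
      case True
      then show ?thesis
        using reduced_pair_leaf_maximal[OF red rep represents_affine[OF rep' less.prems(2)]
            less.prems(1)] lo by simp
    next
      case False
      then show ?thesis
        using reduced_pair_leaf_maximal[OF red' rep' represents_affine[OF rep less.prems(1)]
            less.prems(2)] lo by simp
    qed
  qed
  have len: "length I = length I'"
  proof (rule linorder_cases[of "length I" "length I'"])
    assume l: "length I < length I'"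
    have "hi (I' ! (length I - 1)) = 1" using eq[of "length I - 1"] P.hi_last P.n_pos l by simp
    then have "lo (I' ! length I) = 1" using P'.hi_leaf[of "length I - 1"] P.n_pos l by simp
    then show ?thesis using lo_range[OF P'.leaf_sd[OF l]] by simp
  next
    assume l: "length I' < length I"
    have "hi (I ! (length I' - 1)) = 1" using eq[of "length I' - 1"] P'.hi_last P'.n_pos l by simp
    then have "lo (I ! length I') = 1" using P.hi_leaf[of "length I' - 1"] P'.n_pos l by simp
    then show ?thesis using lo_range[OF P.leaf_sd[OF l]] by simp
  qed
  have I: "I' = I" using eq len by (intro nth_equalityI) auto
  have lenJ: "length J = length I" "length J' = length I"
    using red red' I by (simp_all add: reduced_pair_def sd_pair_def)
  have "J' ! i = J ! i" if "i < length I" for i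
    using affine_on_sd_ends[OF represents_affine[OF rep that]]
      affine_on_sd_ends[OF represents_affine[OF rep', of i]] that I by (intro sd_eqI') auto
  then have "J' = J" using lenJ by (intro nth_equalityI) auto
  then show ?thesis using I by simp
qed

lemma jones_link_eq:
  assumes "reduced_pair I J" "represents I J g"
  shows "jones_link g = jones_link_pair I J"
proof -
  have "(THE (I, J). reduced_pair I J \<and> represents I J g) = (I, J)"
  proof (rule the_equality)
    show "case (I, J) of (I, J) \<Rightarrow> reduced_pair I J \<and> represents I J g" using assms by simp
    fix p assume p: "case p of (I, J) \<Rightarrow> reduced_pair I J \<and> represents I J g"
    obtain I' J' where IJ: "p = (I', J')" by (cases p)
    show "p = (I, J)" using reduced_pair_unique[OF assms, of I' J'] p unfolding IJ by simp
  qed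
  then show ?thesis by (simp add: jones_link_def)
qed

section \<open>Monotone extension\<close>

lemma continuous_on_Min_image:
  fixes f :: "'i \<Rightarrow> 'a::topological_space \<Rightarrow> real"
  assumes "finite N" "N \<noteq> {}" "\<And>i. i \<in> N \<Longrightarrow> continuous_on A (f i)"
  shows "continuous_on A (\<lambda>p. Min ((\<lambda>i. f i p) ` N))"
  using assms
proof (induction N rule: finite_ne_induct)
  case (insert i N)
  have "Min ((\<lambda>i. f i p) ` insert i N) = min (f i p) (Min ((\<lambda>i. f i p) ` N))" for p
    using insert by simp
  then show ?case using insert by (auto intro!: continuous_intros)
qed simp

text \<open>
  A function prescribed on the sets \<open>{(x, r i) | x. D i x = 0}\<close> is extended, strictly increasing in
  the second variable, by an infimal convolution with the asymmetric norm
  \<open>(x, y) \<mapsto> k * \<bar>x\<bar> + max (k * y) (y / k)\<close> for large \<open>k\<close>; here \<open>D i\<close> plays the role of the distance to the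
  \<open>i\<close>-th set.
\<close>

lemma monotone_extension:
  fixes r v :: "'i \<Rightarrow> real" and D :: "'i \<Rightarrow> real \<Rightarrow> real"
  assumes N: "finite N" "N \<noteq> {}"
    and cont: "\<And>i. i \<in> N \<Longrightarrow> continuous_on UNIV (D i)" and nonneg: "\<And>i x. i \<in> N \<Longrightarrow> D i x \<ge> 0"
    and order: "\<And>i j. i \<in> N \<Longrightarrow> j \<in> N \<Longrightarrow> r j \<le> r i \<Longrightarrow>
      r j = r i \<and> v j \<le> v i \<or> r j < r i \<and> v j < v i \<or> (\<exists>\<delta>>0. \<forall>x. D j x = 0 \<longrightarrow> D i x \<ge> \<delta>)"
  obtains F :: "real \<Rightarrow> real \<Rightarrow> real" and m :: real where
    "m > 0" "continuous_on UNIV (\<lambda>(x, y). F x y)"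
    "\<And>x y s. s \<ge> 0 \<Longrightarrow> F x (y + s) \<ge> F x y + m * s"
    "\<And>i x. i \<in> N \<Longrightarrow> D i x = 0 \<Longrightarrow> F x (r i) = v i"
proof -
  \<comment> \<open>For \<open>k \<ge> 1\<close> the last term rises with slope \<open>k\<close>
    above \<open>r i\<close> and falls off with slope \<open>1 / k\<close> below. So each
    \<open>f k i\<close> takes the value \<open>v i\<close> on its own set and has slope at least
    \<open>1 / k\<close> in \<open>y\<close>.\<close>
  define f where "f = (\<lambda>k i x y. v i + k * D i x + max (k * (y - r i)) ((y - r i) / k))"
  have f_ge: "v i + k * (y - r i) \<le> f k i x y" "v i + (y - r i) / k \<le> f k i x y"
    "v i + k * D i x + (y - r i) / k \<le> f k i x y"
    if "i \<in> N" "k \<ge> 1" for i k x y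
  proof -
    have "0 \<le> k * D i x" using nonneg[OF that(1)] that(2) by simp
    then show "v i + k * (y - r i) \<le> f k i x y" "v i + (y - r i) / k \<le> f k i x y"
      "v i + k * D i x + (y - r i) / k \<le> f k i x y"
      by (auto simp: f_def intro: order_trans[OF max.cobounded1] order_trans[OF max.cobounded2] add_mono)
  qed
  \<comment> \<open>The minimum keeps the value \<open>v j\<close> on the \<open>j\<close>-th set
    provided that no other \<open>f k i\<close> is smaller there. If \<open>r i\<close> is below
    \<open>r j\<close>, the steep side ensures this for large \<open>k\<close>. Otherwise it follows
    from the order of the values, with the gentle slope when the rows differ, or from
    \<open>k * D i x\<close> when the sets are apart.\<close>
  have ex: "\<exists>k0. \<forall>k\<ge>k0. k \<ge> 1 \<longrightarrow> (\<forall>x. D j x = 0 \<longrightarrow> v j \<le> f k i x (r j))" if ij: "i \<in> N" "j \<in> N" for i j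
  proof (cases "r j \<le> r i")
    case False
    define k0 where "k0 = (v j - v i) / (r j - r i)"
    have "v j \<le> f k i x (r j)" if "k \<ge> k0" "k \<ge> 1" for k x
    proof -
      have "v j - v i = k0 * (r j - r i)" using False by (simp add: k0_def)
      also have "\<dots> \<le> k * (r j - r i)" using that False by (intro mult_right_mono) auto
      finally have "v j \<le> v i + k * (r j - r i)" by simp
      also have "\<dots> \<le> f k i x (r j)" using f_ge(1)[OF ij(1)] that by simp
      finally show ?thesis .
    qed
    then show ?thesis by blast
  next
    case True
    from order[OF ij True] consider "r j = r i" "v j \<le> v i" | "r j < r i" "v j < v i"
      | \<delta> where "\<delta> > 0" "\<And>x. D j x = 0 \<Longrightarrow> D i x \<ge> \<delta>" by blast
    then show ?thesis
    proof cases
      case 1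
      have "v j \<le> f k i x (r j)" if "k \<ge> 1" for k x
        using 1 f_ge(1)[OF ij(1) that, of "r j" x] by simp
      then show ?thesis by blast
    next
      case 2
      define k0 where "k0 = (r i - r j) / (v i - v j)"
      have "v j \<le> f k i x (r j)" if "k \<ge> k0" "k \<ge> 1" for k x
      proof -
        have "r i - r j \<le> k * (v i - v j)" using 2 that by (simp add: k0_def field_simps)
        then have "(r i - r j) / k \<le> v i - v j" using that by (simp add: field_simps)
        then have "v j \<le> v i + (r j - r i) / k" by (simp add: diff_divide_distrib)
        also have "\<dots> \<le> f k i x (r j)" using f_ge(2)[OF ij(1)] that by simp
        finally show ?thesis .
      qed
      then show ?thesis by blast
    next
      case 3
      define k0 where "k0 = (v j - v i + (r i - r j)) / \<delta>"
      have "v j \<le> f k i x (r j)" if k: "k \<ge> k0" "k \<ge> 1" and x: "D j x = 0" for k x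
      proof -
        have "v j - v i + (r i - r j) \<le> k * \<delta>" using 3 k by (simp add: k0_def field_simps)
        also have "\<dots> \<le> k * D i x" using 3(2)[OF x] k by (intro mult_left_mono) auto
        finally have "v j \<le> v i + k * D i x - (r i - r j)" by simp
        also have "(r i - r j) / k \<le> r i - r j"
          using True k by (simp add: divide_le_eq mult_le_cancel_left1)
        then have "v i + k * D i x - (r i - r j) \<le> v i + k * D i x + (r j - r i) / k"
          by (simp add: diff_divide_distrib)
        also have "\<dots> \<le> f k i x (r j)" using f_ge(3)[OF ij(1)] k by simp
        finally show ?thesis .
      qed
      then show ?thesis by blast
    qed
  qed
  have "eventually (\<lambda>k. \<forall>i\<in>N. \<forall>j\<in>N. k \<ge> 1 \<longrightarrow> (\<forall>x. D j x = 0 \<longrightarrow> v j \<le> f k i x (r j))) at_top"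
    using N(1) ex by (intro eventually_ball_finite ballI) (auto simp: eventually_at_top_linorder)
  moreover have "eventually (\<lambda>k::real. k \<ge> 1) at_top" by (rule eventually_ge_at_top)
  ultimately have "eventually (\<lambda>k. k \<ge> 1 \<and> (\<forall>i\<in>N. \<forall>j\<in>N. \<forall>x. D j x = 0 \<longrightarrow> v j \<le> f k i x (r j))) at_top"
    by eventually_elim blast
  then obtain k where k: "k \<ge> 1" "\<And>i j x. i \<in> N \<Longrightarrow> j \<in> N \<Longrightarrow> D j x = 0 \<Longrightarrow> v j \<le> f k i x (r j)"
    by (force simp: eventually_at_top_linorder)
  define F where "F = (\<lambda>x y. Min ((\<lambda>i. f k i x y) ` N))"
  show thesis
  proof (rule that[of "1 / k" F])
    show "1 / k > 0" using k by simp
    have "continuous_on UNIV (\<lambda>p. f k i (fst p) (snd p))" if "i \<in> N" for i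
      unfolding f_def by (intro continuous_intros continuous_on_compose2[OF cont[OF that]]) (use k
          in auto)
    then show "continuous_on UNIV (\<lambda>(x, y). F x y)"
      unfolding F_def case_prod_beta' using N by (intro continuous_on_Min_image)
    have slope: "f k i x (y + s) \<ge> f k i x y + s / k" if "s \<ge> 0" for i x y s
    proof -
      have "s / k \<le> s" using k(1) that by (simp add: divide_le_eq mult_le_cancel_left1)
      also have "s \<le> k * s" using k(1) that by (simp add: mult_le_cancel_right1)
      finally have le: "s / k \<le> k * s" .
      have eq: "k * (y + s - r i) = k * (y - r i) + k * s" "(y + s - r i) / k = (y - r i) / k + s / k"
        by (simp_all add: algebra_simps add_divide_distrib diff_divide_distrib)
      show ?thesis unfolding f_def eq using le by (simp add: max_def)
    qed
    show "F x (y + s) \<ge> F x y + 1 / k * s" if "s \<ge> 0" for x y s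
      unfolding F_def
    proof (rule Min.boundedI)
      fix a assume "a \<in> (\<lambda>i. f k i x (y + s)) ` N"
      then obtain i where i: "i \<in> N" "a = f k i x (y + s)" by blast
      have "Min ((\<lambda>i. f k i x y) ` N) \<le> f k i x y" using N i by (intro Min_le) auto
      then show "Min ((\<lambda>i. f k i x y) ` N) + 1 / k * s \<le> a" using slope[OF that, of i x y] i by simp
    qed (use N in auto)
    show "F x (r i) = v i" if "i \<in> N" "D i x = 0" for i x
      unfolding F_def
    proof (rule Min_eqI)
      show "v i \<in> (\<lambda>j. f k j x (r i)) ` N"
        using that by (intro image_eqI[of _ _ i]) (auto simp: f_def)
    qed (use N k that in auto)
  qed
qed

text \<open>With \<open>D = 0\<close> the values are prescribed for all \<open>x\<close>, and the
  restriction of the extension to \<open>x = 0\<close> is the required function.\<close>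

lemma monotone_interpolation:
  fixes r v :: "'i \<Rightarrow> real"
  assumes "finite N" "N \<noteq> {}" "\<And>i j. i \<in> N \<Longrightarrow> j \<in> N \<Longrightarrow> i \<noteq> j \<Longrightarrow> r j \<le> r i \<Longrightarrow> r j < r i \<and> v j < v i"
  obtains \<phi> :: "real \<Rightarrow> real" and m :: real where
    "m > 0" "continuous_on UNIV \<phi>" "\<And>x s. s \<ge> 0 \<Longrightarrow> \<phi> (x + s) \<ge> \<phi> x + m * s"
    "\<And>i. i \<in> N \<Longrightarrow> \<phi> (r i) = v i"
proof (rule monotone_extension[of N "\<lambda>_ _. 0" r v])
  show "r j = r i \<and> v j \<le> v i \<or> r j < r i \<and> v j < v i \<or> (\<exists>\<delta>>0. \<forall>x. (0::real) = 0 \<longrightarrow> 0 \<ge> \<delta>)"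
    if "i \<in> N" "j \<in> N" "r j \<le> r i" for i j
    using assms(3)[of i j] that by (cases "i = j") auto
  fix F :: "real \<Rightarrow> real \<Rightarrow> real" and m :: real
  assume F: "m > 0" "continuous_on UNIV (\<lambda>(x, y). F x y)" "\<And>x y s. s \<ge> 0 \<Longrightarrow> F x (y + s) \<ge> F x y + m * s"
    "\<And>i x. i \<in> N \<Longrightarrow> (0::real) = 0 \<Longrightarrow> F x (r i) = v i"
  have "continuous_on UNIV (\<lambda>y. case (0, y) of (x, y) \<Rightarrow> F x y)"
    by (rule continuous_on_compose2[OF F(2)]) (auto intro!: continuous_intros)
  then show thesis using that[of m "F 0"] F by simp
qed (use assms in auto)

text \<open>Turns data attached to the rows, such as the centre and the width of a bridge, into
  continuous functions of the height.\<close>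

lemma nat_interpolation:
  fixes f :: "nat \<Rightarrow> real"
  obtains g where "continuous_on UNIV g" "\<And>k. k \<le> N \<Longrightarrow> g (real k) = f k"
proof
  \<comment> \<open>A sum of tent functions, each of which vanishes at all integers except its
    own.\<close>
  define g where "g = (\<lambda>y. \<Sum>i\<le>N. f i * max 0 (1 - \<bar>y - real i\<bar>))"
  show "continuous_on UNIV g" unfolding g_def by (intro continuous_intros)
  show "g (real k) = f k" if "k \<le> N" for k
  proof -
    have "f i * max 0 (1 - \<bar>real k - real i\<bar>) = (if i = k then f i else 0)" for i
    proof (cases "i = k")
      case False
      then have "\<bar>real k - real i\<bar> \<ge> 1" by linarith
      then show ?thesis using False by simp
    qed simp
    then show ?thesis using that by (simp add: g_def)
  qed
qed

section \<open>Turning box-shaped bridges into wedges\<close>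

text \<open>For \<open>r \<ge> 0\<close> this truncates \<open>s\<close> to \<open>{- r..r}\<close>.
  It grows at most as fast as \<open>s\<close>, so subtracting at most half of it leaves slope at
  least \<open>1 / 2\<close>.\<close>

definition clamp_abs :: "real \<Rightarrow> real \<Rightarrow> real" where
  "clamp_abs r s = max (- r) (min r s)"

lemma clamp_abs_slope: "s \<ge> 0 \<Longrightarrow> clamp_abs r (a + s) \<le> clamp_abs r a + s"
  by (auto simp: clamp_abs_def max_def min_def)

text \<open>
  The box over \<open>{c - w..c + w}\<close> of height \<open>1\<close> is mapped to the wedge with apex \<open>(c, 1)\<close>. Nothing moves in the
  plane \<open>z = 0\<close>, so the strands that pass below the bridge are not affected.
\<close>

lemma wedge_deformation:
  fixes c w v :: "real \<Rightarrow> real"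
  assumes "continuous_on UNIV c" "continuous_on UNIV w" "continuous_on UNIV v"
  obtains W where "deformation W"
    "\<And>x y. W (x, y, 0) = (x, y, 0)" "\<And>x y z. y \<le> 0 \<Longrightarrow> W (x, y, z) = (x, y, z)"
    "\<And>y z \<sigma>. y \<ge> 1 \<Longrightarrow> w y > 0 \<Longrightarrow> v y = 1 / w y \<Longrightarrow> \<bar>\<sigma>\<bar> = 1 \<Longrightarrow> 0 \<le> z \<Longrightarrow> z \<le> 1 \<Longrightarrow>
       W (c y + \<sigma> * w y, y, z) = (c y + \<sigma> * w y * (1 - z / 2), y, z / 2)"
    "\<And>y t. y \<ge> 1 \<Longrightarrow> w y > 0 \<Longrightarrow> v y = 1 / w y \<Longrightarrow> \<bar>t\<bar> \<le> 1 \<Longrightarrow>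
       W (c y + w y * t, y, 1) = (c y + w y * (t / 2), y, 1 - \<bar>t\<bar> / 2)"
proof -
  \<comment> \<open>The factor is \<open>1 / 2\<close> at all heights \<open>y \<ge> 1\<close>,
    where the rows are, and \<open>0\<close> for \<open>y \<le> 0\<close>, so that the lower half of
    the link is not moved.\<close>
  define k :: "real \<Rightarrow> real" where "k = (\<lambda>y. max 0 (min 1 y) / 2)"
  have k: "0 \<le> k y" "k y \<le> 1 / 2" for y by (auto simp: k_def)
  have k0: "k y = 0" if "y \<le> 0" for y using that by (simp add: k_def)
  have k1: "k y = 1 / 2" if "y \<ge> 1" for y using that by (simp add: k_def)
  have kc: "continuous_on UNIV k" unfolding k_def by (intro continuous_intros) simp
  have slope: "(a + s) - k y * clamp_abs r (b + s) \<ge> a - k y * clamp_abs r b + 1 / 2 * s"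
    if "s \<ge> 0" for a b r s y
  proof -
    have "k y * clamp_abs r (b + s) \<le> k y * (clamp_abs r b + s)"
      using k clamp_abs_slope[OF that] by (intro mult_left_mono) auto
    moreover have "k y * s \<le> 1 / 2 * s" using k that by (intro mult_right_mono) auto
    ultimately show ?thesis by (simp add: algebra_simps)
  qed
  \<comment> \<open>Points are drawn towards the centre \<open>c y\<close>: a leg at distance
    \<open>w\<close> is tilted to distance \<open>w * (1 - z / 2)\<close>, and the top
    \<open>z = 1\<close> is contracted by the factor \<open>2\<close>.\<close>
  define X where "X = (\<lambda>(x, y, z). (x - k y * clamp_abs (\<bar>w y\<bar> * \<bar>z\<bar>) (x - c y), y, z :: real))"
  \<comment> \<open>With \<open>v = 1 / w\<close> the clamp has no effect on the tilted legs, as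
    \<open>2 - z \<ge> z\<close>, and their heights are halved. On the contracted top at
    \<open>c + w * (t / 2)\<close> it cuts off at \<open>\<bar>t\<bar>\<close>, leaving the roof
    \<open>1 - \<bar>t\<bar> / 2\<close>.\<close>
  define Z where "Z = (\<lambda>(x, y, z). (x :: real, y, z - k y * clamp_abs (2 * \<bar>v y\<bar> * \<bar>x - c y\<bar>) z))"
  note cs = continuous_on_compose2[OF kc] continuous_on_compose2[OF assms(1)]
    continuous_on_compose2[OF assms(2)] continuous_on_compose2[OF assms(3)]
  have dX: "deformation X" unfolding X_def
  proof (rule deformation_shear_x)
    show "continuous_on UNIV (\<lambda>(x, y, z). x - k y * clamp_abs (\<bar>w y\<bar> * \<bar>z\<bar>) (x - c y))"
      unfolding case_prod_beta' clamp_abs_def by (intro continuous_intros cs) auto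
    show "x - k y * clamp_abs (\<bar>w y\<bar> * \<bar>z\<bar>) (x - c y) + 1 / 2 * s
        \<le> x + s - k y * clamp_abs (\<bar>w y\<bar> * \<bar>z\<bar>) (x + s - c y)" if "s \<ge> 0" for x y z s
      using slope[OF that, of x y _ "x - c y"] by (simp add: algebra_simps)
  qed simp
  have dZ: "deformation Z" unfolding Z_def
  proof (rule deformation_shear_z)
    show "continuous_on UNIV (\<lambda>(x, y, z). z - k y * clamp_abs (2 * \<bar>v y\<bar> * \<bar>x - c y\<bar>) z)"
      unfolding case_prod_beta' clamp_abs_def by (intro continuous_intros cs) auto
    show "z - k y * clamp_abs (2 * \<bar>v y\<bar> * \<bar>x - c y\<bar>) z + 1 / 2 * s
        \<le> z + s - k y * clamp_abs (2 * \<bar>v y\<bar> * \<bar>x - c y\<bar>) (z + s)" if "s \<ge> 0" for x y z s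
      using slope[OF that, of z y _ z] by simp
  qed simp
  show thesis
  proof (rule that[of "Z \<circ> X"])
    show "deformation (Z \<circ> X)" by (rule deformation_compose[OF dX dZ])
    show "(Z \<circ> X) (x, y, 0) = (x, y, 0)" for x y
      by (simp add: X_def Z_def clamp_abs_def)
    show "(Z \<circ> X) (x, y, z) = (x, y, z)" if "y \<le> 0" for x y z
      by (simp add: X_def Z_def k0[OF that])
    show "(Z \<circ> X) (c y + \<sigma> * w y, y, z) = (c y + \<sigma> * w y * (1 - z / 2), y, z / 2)"
      if y: "y \<ge> 1" "w y > 0" "v y = 1 / w y" "\<bar>\<sigma>\<bar> = 1" "0 \<le> z" "z \<le> 1" for y z \<sigma>
    proof -
      have wz: "0 \<le> w y * z" "w y * z \<le> w y" using y by (auto simp: mult_left_le)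
      have "\<sigma> = 1 \<or> \<sigma> = - 1" using y(4) by (simp add: abs_if split: if_splits)
      moreover have "clamp_abs q u = q \<and> clamp_abs q (- u) = - q" if "0 \<le> q" "q \<le> u" for q u
        using that by (auto simp: clamp_abs_def)
      ultimately have "clamp_abs (w y * z) (\<sigma> * w y) = \<sigma> * (w y * z)"
        using wz by auto
      then have "clamp_abs (\<bar>w y\<bar> * \<bar>z\<bar>) (\<sigma> * w y) = \<sigma> * w y * z"
        using y(2,5) by (simp add: mult_ac)
      then have 1: "X (c y + \<sigma> * w y, y, z) = (c y + \<sigma> * w y * (1 - z / 2), y, z)"
        by (simp add: X_def k1[OF y(1)] algebra_simps)
      have "\<bar>\<sigma> * w y * (1 - z / 2)\<bar> = w y * (1 - z / 2)"
        using y by (simp add: abs_mult)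
      moreover have "\<bar>v y\<bar> = 1 / w y" using y by simp
      ultimately have "2 * \<bar>v y\<bar> * \<bar>c y + \<sigma> * w y * (1 - z / 2) - c y\<bar> = 2 * (1 / w y) * (w y * (1 -
          z / 2))"
        by simp
      also have "\<dots> = 2 - z" using y(2) by simp
      finally have "2 * \<bar>v y\<bar> * \<bar>c y + \<sigma> * w y * (1 - z / 2) - c y\<bar> = 2 - z" .
      then have "clamp_abs (2 * \<bar>v y\<bar> * \<bar>c y + \<sigma> * w y * (1 - z / 2) - c y\<bar>) z = z"
        using y by (simp add: clamp_abs_def)
      then have "Z (c y + \<sigma> * w y * (1 - z / 2), y, z) = (c y + \<sigma> * w y * (1 - z / 2), y, z / 2)"
        by (simp add: Z_def k1[OF y(1)])
      then show ?thesis using 1 by simp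
    qed
    show "(Z \<circ> X) (c y + w y * t, y, 1) = (c y + w y * (t / 2), y, 1 - \<bar>t\<bar> / 2)"
      if y: "y \<ge> 1" "w y > 0" "v y = 1 / w y" "\<bar>t\<bar> \<le> 1" for y t
    proof -
      have "\<bar>w y * t\<bar> \<le> w y" using y by (simp add: abs_mult mult_left_le)
      then have "clamp_abs (\<bar>w y\<bar> * \<bar>1\<bar>) (w y * t) = w y * t"
        using y by (auto simp: clamp_abs_def)
      then have 1: "X (c y + w y * t, y, 1) = (c y + w y * (t / 2), y, 1)"
        by (simp add: X_def k1[OF y(1)])
      have "\<bar>w y * (t / 2)\<bar> = w y * (\<bar>t\<bar> / 2)" using y by (simp add: abs_mult)
      moreover have "\<bar>v y\<bar> = 1 / w y" using y by simp
      ultimately have "2 * \<bar>v y\<bar> * \<bar>c y + w y * (t / 2) - c y\<bar> = 2 * (1 / w y) * (w y * (\<bar>t\<bar> / 2))"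
        by simp
      also have "\<dots> = \<bar>t\<bar>" using y(2) by simp
      finally have "2 * \<bar>v y\<bar> * \<bar>c y + w y * (t / 2) - c y\<bar> = \<bar>t\<bar>" .
      then have "clamp_abs (2 * \<bar>v y\<bar> * \<bar>c y + w y * (t / 2) - c y\<bar>) 1 = \<bar>t\<bar>"
        using y by (simp add: clamp_abs_def)
      then have "Z (c y + w y * (t / 2), y, 1) = (c y + w y * (t / 2), y, 1 - \<bar>t\<bar> / 2)"
        by (simp add: Z_def k1[OF y(1)])
      then show ?thesis using 1 by simp
    qed
  qed
qed

section \<open>From the half grid to the tangle\<close>

lemma closed_segment_triple:
  "p \<in> closed_segment (x, y, z) (x', y', z') \<longleftrightarrow>
     (\<exists>u. 0 \<le> u \<and> u \<le> 1 \<and> p = (x + u * (x' - x), y + u * (y' - y), z + u * (z' - z :: real)))"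
  for x y x' y' :: real
proof -
  have "(1 - u) *\<^sub>R (x, y, z) + u *\<^sub>R (x', y', z') = (x + u * (x' - x), y + u * (y' - y), z + u *
      (z' - z))"
    for u by (simp add: algebra_simps)
  then show ?thesis by (auto simp: closed_segment_def)
qed

text \<open>The sign of an interval decides the direction of its arc; as a parameter it lets both
  signs be treated by one formula.\<close>

definition dseg :: "bool \<Rightarrow> point \<Rightarrow> point \<Rightarrow> point \<times> point" where
  "dseg b P Q = (if b then (P, Q) else (Q, P))"

lemma carries_dseg:
  assumes cont: "continuous_on UNIV f" and "f P = P'" "f Q = Q'"
    and sub: "\<And>p. p \<in> closed_segment P Q \<Longrightarrow> f p \<in> closed_segment P' Q'"
  shows "carries f {dseg b P Q} {dseg b P' Q'}"
proof -
  have seg: "f ` closed_segment P Q = closed_segment (f P) (f Q)"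
    using assms by (intro segment_image continuous_on_subset[OF cont]) auto
  then have "f ` closed_segment Q P = closed_segment (f Q) (f P)"
    by (simp add: closed_segment_commute)
  then show ?thesis using seg assms(2,3) by (intro carriesI) (auto simp: dseg_def split: if_splits)
qed

lemma subdivides_dseg:
  assumes "P \<noteq> Q" "R = P + t *\<^sub>R (Q - P)" "0 < t" "t < 1"
  shows "subdivides {dseg b P R, dseg b R Q} {dseg b P Q}"
proof (cases b)
  case True then show ?thesis using subdivides_split[OF assms] by (simp add: dseg_def)
next
  case False
  have "R = Q + (1 - t) *\<^sub>R (P - Q)" using assms(2) by (simp add: algebra_simps)
  then have "subdivides {(Q, R), (R, P)} {(Q, P)}"
    using assms(1,3,4) subdivides_split[of Q P R "1 - t"] by simp
  then show ?thesis using False by (simp add: dseg_def insert_commute)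
qed

text \<open>
  The upper half of the link, with the columns at \<open>X A\<close> and the additional one at \<open>x0\<close>, the rows at \<open>Y A\<close>
  and the bottom line at \<open>b\<close>. The row of a pair of conjugate intervals is divided at the column of their parent.
\<close>

definition half_link :: "sd list \<Rightarrow> (sd \<Rightarrow> real) \<Rightarrow> real \<Rightarrow> (sd \<Rightarrow> real) \<Rightarrow> real \<Rightarrow> polygon" where
  "half_link I X x0 Y b =
     (\<Union>A\<in>sd_set I.
        {dseg (sd_positive A) (X A, b, 0) (X A, Y A, 0)} \<union>
        {dseg (sd_positive A) (X A, Y A, 0) (X A, Y A, 1)} \<union>
        {dseg (sd_positive A) (X A, Y A, 1) (if A = sd_root then x0 else X (sd_parent A), Y A, 1)}) \<union>
     {dseg True (x0, Y sd_root, 1) (x0, Y sd_root, 0)} \<union> {dseg True (x0, Y sd_root, 0) (x0, b, 0)}"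

context dyadic_partition
begin

abbreviation row :: "sd \<Rightarrow> real" where
  "row A \<equiv> real (grid_y I A)"

lemma row_bounds: "A \<in> sd_set I \<Longrightarrow> 1 \<le> row A" "A \<in> sd_set I \<Longrightarrow> row A \<le> real n"
  "A \<in> sd_set I \<Longrightarrow> A \<noteq> sd_root \<Longrightarrow> row A \<le> real n - 1"
  using grid_y_ge_1[of A] grid_y_le_n[of A] grid_y_less_n[of A] by (auto simp: Suc_le_eq)

lemma row_root: "row sd_root = real n"
  by (simp add: grid_y_root)

text \<open>An instance of \<open>monotone_extension\<close>: each nonroot row gets the height
  \<open>len A\<close> only over its own bridge, while the bottom line and the root row get
  \<open>0\<close> and \<open>2\<close> for all \<open>x\<close>.\<close>

lemma row_map:
  obtains F :: "real \<Rightarrow> real \<Rightarrow> real" and m :: real where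
    "m > 0" "continuous_on UNIV (\<lambda>(x, y). F x y)"
    "\<And>x y s. s \<ge> 0 \<Longrightarrow> F x (y + s) \<ge> F x y + m * s"
    "\<And>x. F x 0 = 0" "\<And>x. F x (real n) = 2"
    "\<And>A x. A \<in> sd_set I \<Longrightarrow> A \<noteq> sd_root \<Longrightarrow> \<bar>x - mid (sd_parent A)\<bar> \<le> len (sd_parent A) / 4 \<Longrightarrow>
       F x (row A) = len A"
proof -
  \<comment> \<open>\<open>None\<close> stands for the bottom line.\<close>
  define N where "N = insert None (Some ` sd_set I)"
  define r where "r = (\<lambda>a. case a of None \<Rightarrow> 0 | Some A \<Rightarrow> row A)"
  define v where "v = (\<lambda>a. case a of None \<Rightarrow> 0 | Some A \<Rightarrow> if A = sd_root then 2 else len A)"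
  \<comment> \<open>A bridge is centred at the midpoint of the parent and reaches to the midpoints
    of its two halves, a quarter of the parent's length away on either side.\<close>
  define D where "D = (\<lambda>a x. case a of None \<Rightarrow> 0 | Some A \<Rightarrow>
    if A = sd_root then 0 else max 0 (\<bar>x - mid (sd_parent A)\<bar> - len (sd_parent A) / 4))"
  have order: "r j = r i \<and> v j \<le> v i \<or> r j < r i \<and> v j < v i \<or> (\<exists>\<delta>>0. \<forall>x. D j x = 0 \<longrightarrow> D i x \<ge> \<delta>)"
    if i: "i \<in> N" and j: "j \<in> N" and le: "r j \<le> r i" for i j
  proof (cases j)
    case None
    show ?thesis
    proof (cases i)
      case None then show ?thesis using \<open>j = None\<close> by simp
    next
      case (Some A)
      then have "A \<in> sd_set I" using i by (auto simp: N_def)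
      then show ?thesis using row_bounds(1)[of A] len_pos[of A] Some \<open>j = None\<close> by (simp add: r_def
          v_def)
    qed
  next
    case (Some B)
    then have B: "B \<in> sd_set I" using j by (auto simp: N_def)
    then have "row B \<ge> 1" using row_bounds(1) by blast
    then have "i \<noteq> None" using le Some by (cases i) (simp_all add: r_def)
    then obtain A where iA: "i = Some A" by (cases i) simp_all
    then have A: "A \<in> sd_set I" using i by (auto simp: N_def)
    show ?thesis
    proof (cases "A = sd_root")
      case True
      then show ?thesis
        using row_bounds(3)[OF B] row_root len_less_root[OF B] iA Some
        by (cases "B = sd_root") (simp_all add: r_def v_def)
    next
      case False
      have "B \<noteq> sd_root"
      proof
        assume "B = sd_root"
        then show False using row_bounds(3)[OF A False] row_root le iA Some by (simp add: r_def)
      qed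
      have posA: "fst A > 0" using fst_pos_iff[OF A] False by blast
      have posB: "fst B > 0" using fst_pos_iff[OF B] \<open>B \<noteq> sd_root\<close> by blast
      show ?thesis
      proof (cases "grid_y I B = grid_y I A")
        case True
        then have "A = B \<or> A = sd_conjugate B" using grid_y_eqD[OF B A] by simp
        then have "len A = len B" by auto
        then show ?thesis using True iA Some False \<open>B \<noteq> sd_root\<close> by (simp add: r_def v_def)
      next
        case neq: False
        then have less: "grid_y I B < grid_y I A" using le iA Some by (simp add: r_def)
        then consider "len B < len A" | "len B = len A" "sd_parent A \<noteq> sd_parent B"
          using grid_y_less_cases[OF A B] by blast
        then show ?thesis
        proof cases
          case 1
          then show ?thesis using less iA Some False \<open>B \<noteq> sd_root\<close> by (simp add: r_def v_def)
        next
          case 2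
          let ?P = "sd_parent A" and ?Q = "sd_parent B"
          have lens: "len ?P = len ?Q" using 2 len_parent posA posB by simp
          then have sep: "\<bar>mid ?P - mid ?Q\<bar> \<ge> len ?P"
            using 2 by (intro sd_mid_separated) (simp_all add: len_eq_iff)
          \<comment> \<open>Midpoints of different parents of equal length are at least that length
            apart; the two bridges use up a quarter each, so half of the length remains as
            \<open>\<delta>\<close>.\<close>
          have "D i x \<ge> len ?P / 2" if "D j x = 0" for x
          proof -
            have "\<bar>x - mid ?Q\<bar> \<le> len ?P / 4"
              using that Some \<open>B \<noteq> sd_root\<close> lens by (simp add: D_def max_def split: if_splits)
            then have "\<bar>x - mid ?P\<bar> - len ?P / 4 \<ge> len ?P / 2" using sep by linarith
            moreover have "D i x \<ge> \<bar>x - mid ?P\<bar> - len ?P / 4" using iA False by (simp add: D_def)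
            ultimately show ?thesis by linarith
          qed
          then show ?thesis using len_pos[of ?P] by (intro disjI2 exI[of _ "len ?P / 2"]) simp
        qed
      qed
    qed
  qed
  have cont: "continuous_on UNIV (D i)" for i
  proof (cases i)
    case (Some A)
    show ?thesis unfolding D_def Some by (cases "A = sd_root") (simp_all add: continuous_intros)
  qed (simp add: D_def)
  have N: "finite N" "N \<noteq> {}" using finite_sd_set by (auto simp: N_def)
  have nonneg: "D i x \<ge> 0" for i x by (cases i) (auto simp: D_def)
  show thesis
  proof (rule monotone_extension[OF N cont nonneg order])
  fix F :: "real \<Rightarrow> real \<Rightarrow> real" and m :: real
  assume F: "m > 0" "continuous_on UNIV (\<lambda>(x, y). F x y)"
    "\<And>x y s. s \<ge> 0 \<Longrightarrow> F x (y + s) \<ge> F x y + m * s"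
    "\<And>i x. i \<in> N \<Longrightarrow> D i x = 0 \<Longrightarrow> F x (r i) = v i"
  show thesis
  proof (rule that[OF F(1-3)])
    show "F x 0 = 0" for x using F(4)[of None x] by (simp add: N_def r_def v_def D_def)
    show "F x (real n) = 2" for x
      using F(4)[of "Some sd_root" x] root_in_sd_set by (simp add: N_def r_def v_def D_def grid_y_root)
    show "F x (row A) = len A"
      if "A \<in> sd_set I" "A \<noteq> sd_root" "\<bar>x - mid (sd_parent A)\<bar> \<le> len (sd_parent A) / 4" for A x
      using F(4)[of "Some A" x] that by (simp add: N_def r_def v_def D_def)
  qed
  qed
qed

text \<open>An instance of \<open>wedge_deformation\<close> with the centre and half-width of each
  row's bridge interpolated in \<open>y\<close>. The bridge of the root joins the additional column
  at \<open>- 1\<close> to the column at \<open>1 / 2\<close>, hence its centre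
  \<open>- 1 / 4\<close> and half-width \<open>3 / 4\<close>.\<close>

lemma bridge_wedge:
  obtains W where "deformation W"
    "\<And>x y. W (x, y, 0) = (x, y, 0)" "\<And>x y z. y \<le> 0 \<Longrightarrow> W (x, y, z) = (x, y, z)"
    "\<And>A z. A \<in> sd_set I \<Longrightarrow> A \<noteq> sd_root \<Longrightarrow> 0 \<le> z \<Longrightarrow> z \<le> 1 \<Longrightarrow>
       W (mid A, row A, z) = (mid A + (mid (sd_parent A) - mid A) * (z / 2), row A, z / 2)"
    "\<And>A t. A \<in> sd_set I \<Longrightarrow> A \<noteq> sd_root \<Longrightarrow> 0 \<le> t \<Longrightarrow> t \<le> 1 \<Longrightarrow>
       W (mid A + (mid (sd_parent A) - mid A) * t, row A, 1) =
         (mid A + (mid (sd_parent A) - mid A) * ((1 + t) / 2), row A, (1 + t) / 2)"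
    "\<And>z. 0 \<le> z \<Longrightarrow> z \<le> 1 \<Longrightarrow> W (1 / 2, real n, z) = (1 / 2 - 3 / 8 * z, real n, z / 2)"
    "\<And>z. 0 \<le> z \<Longrightarrow> z \<le> 1 \<Longrightarrow> W (- 1, real n, z) = (- 1 + 3 / 8 * z, real n, z / 2)"
    "\<And>t. \<bar>t\<bar> \<le> 1 \<Longrightarrow> W (- 1 / 4 + 3 / 4 * t, real n, 1) = (- 1 / 4 + 3 / 8 * t, real n, 1 - \<bar>t\<bar> / 2)"
proof -
  \<comment> \<open>A row contains two conjugate intervals, but they have the same parent, so the
    choice does not matter.\<close>
  define P where "P = (\<lambda>k. sd_parent (SOME A. A \<in> sd_set I \<and> grid_y I A = k))"
  have P: "P (grid_y I A) = sd_parent A" if "A \<in> sd_set I" for A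
  proof -
    let ?B = "SOME B. B \<in> sd_set I \<and> grid_y I B = grid_y I A"
    have "?B \<in> sd_set I \<and> grid_y I ?B = grid_y I A"
      using that by (intro someI_ex[of "\<lambda>B. B \<in> sd_set I \<and> grid_y I B = grid_y I A"]) blast
    then have "?B = A \<or> ?B = sd_conjugate A" using grid_y_eqD[of A ?B] that by metis
    then show ?thesis unfolding P_def by (metis parent_conjugate)
  qed
  obtain c where c: "continuous_on UNIV c"
    "\<And>k. k \<le> n \<Longrightarrow> c (real k) = (if k = n then - 1 / 4 else mid (P k))"
    by (rule nat_interpolation[of n "\<lambda>k. if k = n then - 1 / 4 else mid (P k)"]) blast
  obtain w where w: "continuous_on UNIV w"
    "\<And>k. k \<le> n \<Longrightarrow> w (real k) = (if k = n then 3 / 4 else len (P k) / 4)"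
    by (rule nat_interpolation[of n "\<lambda>k. if k = n then 3 / 4 else len (P k) / 4"]) blast
  show thesis
  \<comment> \<open>The function \<open>w\<close> is controlled only at the rows and could vanish
    elsewhere, so its reciprocal is interpolated separately.\<close>
  proof (rule nat_interpolation[of n "\<lambda>k. 1 / w (real k)"])
  fix v assume v: "continuous_on UNIV v" "\<And>k. k \<le> n \<Longrightarrow> v (real k) = 1 / w (real k)"
  show thesis
  proof (rule wedge_deformation[OF c(1) w(1) v(1)])
  fix W assume W: "deformation W"
    "\<And>x y. W (x, y, 0) = (x, y, 0)" "\<And>x y z. y \<le> 0 \<Longrightarrow> W (x, y, z) = (x, y, z)"
    "\<And>y z \<sigma>. y \<ge> 1 \<Longrightarrow> w y > 0 \<Longrightarrow> v y = 1 / w y \<Longrightarrow> \<bar>\<sigma>\<bar> = 1 \<Longrightarrow> 0 \<le> z \<Longrightarrow> z \<le> 1 \<Longrightarrow>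
       W (c y + \<sigma> * w y, y, z) = (c y + \<sigma> * w y * (1 - z / 2), y, z / 2)"
    "\<And>y t. y \<ge> 1 \<Longrightarrow> w y > 0 \<Longrightarrow> v y = 1 / w y \<Longrightarrow> \<bar>t\<bar> \<le> 1 \<Longrightarrow>
       W (c y + w y * t, y, 1) = (c y + w y * (t / 2), y, 1 - \<bar>t\<bar> / 2)"
  have n1: "real n \<ge> 1" using row_bounds(1)[OF root_in_sd_set] row_root by simp
  have cn: "c (real n) = - 1 / 4" "w (real n) = 3 / 4" "v (real n) = 1 / w (real n)"
    using c(2)[of n] w(2)[of n] v(2)[of n] by simp_all
  show thesis
  proof (rule that[OF W(1-3)])
    fix A assume A: "A \<in> sd_set I" "A \<noteq> sd_root"
    define \<sigma> :: real where "\<sigma> = (if even (snd A) then - 1 else 1)"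
    have \<sigma>: "\<bar>\<sigma>\<bar> = 1" by (simp add: \<sigma>_def)
    have pos: "fst A > 0" using fst_pos_iff A by blast
    have le: "grid_y I A \<le> n" "grid_y I A \<noteq> n" using grid_y_less_n[OF A] by auto
    have cw: "c (row A) = mid (sd_parent A)" "w (row A) = len (sd_parent A) / 4" "v (row A) = 1 / w
        (row A)"
      using c(2)[OF le(1)] w(2)[OF le(1)] v(2)[OF le(1)] le(2) P[OF A(1)] by simp_all
    have wpos: "w (row A) > 0" unfolding cw(2) using len_pos[of "sd_parent A"] by simp
    have midA: "mid A = c (row A) + \<sigma> * w (row A)"
      using mid_parent[OF pos] by (simp add: cw \<sigma>_def)
    have diff: "mid (sd_parent A) - mid A = - \<sigma> * w (row A)" using midA cw by simp
    show "W (mid A, row A, z) = (mid A + (mid (sd_parent A) - mid A) * (z / 2), row A, z / 2)"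
      if "0 \<le> z" "z \<le> 1" for z
      using W(4)[OF row_bounds(1)[OF A(1)] wpos cw(3) \<sigma> that]
      unfolding midA[symmetric] unfolding diff by (simp add: midA algebra_simps)
    show "W (mid A + (mid (sd_parent A) - mid A) * t, row A, 1) =
         (mid A + (mid (sd_parent A) - mid A) * ((1 + t) / 2), row A, (1 + t) / 2)"
      if "0 \<le> t" "t \<le> 1" for t
    proof -
      \<comment> \<open>Here \<open>t\<close> runs from the leg to the centre, whereas
        \<open>wedge_deformation\<close> measures from the centre outwards.\<close>
      have "\<bar>\<sigma> * (1 - t)\<bar> = 1 - t" using \<sigma> that by (simp add: abs_mult)
      moreover have "mid A + (mid (sd_parent A) - mid A) * t = c (row A) + w (row A) * (\<sigma> * (1 - t))"
        unfolding diff by (simp add: midA algebra_simps)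
      moreover have "mid A + (mid (sd_parent A) - mid A) * ((1 + t) / 2) = c (row A) + w (row A) *
          (\<sigma> * (1 - t) / 2)"
        unfolding diff by (simp add: midA field_simps)
      moreover have "1 - (1 - t) / 2 = (1 + t) / 2" by (simp add: field_simps)
      ultimately show ?thesis
        using W(5)[OF row_bounds(1)[OF A(1)] wpos cw(3), of "\<sigma> * (1 - t)"] that by simp
    qed
  next
    show "W (1 / 2, real n, z) = (1 / 2 - 3 / 8 * z, real n, z / 2)" if "0 \<le> z" "z \<le> 1" for z
    proof -
      have "- 1 / 4 + 1 * (3 / 4) * (1 - z / 2) = 1 / 2 - 3 / 8 * z" by (simp add: field_simps)
      then show ?thesis using W(4)[OF n1 _ cn(3), of 1 z] that by (simp add: cn(1,2))
    qed
    show "W (- 1, real n, z) = (- 1 + 3 / 8 * z, real n, z / 2)" if "0 \<le> z" "z \<le> 1" for z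
    proof -
      have "- 1 / 4 + (- 1) * (3 / 4) * (1 - z / 2) = - 1 + 3 / 8 * z" by (simp add: field_simps)
      then show ?thesis using W(4)[OF n1 _ cn(3), of "- 1" z] that by (simp add: cn(1,2))
    qed
    show "W (- 1 / 4 + 3 / 4 * t, real n, 1) = (- 1 / 4 + 3 / 8 * t, real n, 1 - \<bar>t\<bar> / 2)" if "\<bar>t\<bar> \<le>
        1" for t
      using W(5)[OF n1 _ cn(3), of t] that by (simp add: cn(1,2))
  qed
qed
  qed
qed

text \<open>On columns the map \<open>F\<close> is known only up to monotonicity, so the statement
  gives mere bounds for the new height there; legs and half rows have explicit images.\<close>

lemma half_deformation:
  obtains H where "deformation H" "\<And>x y z. y \<le> 0 \<Longrightarrow> H (x, y, z) = (x, y, z)"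
    "\<And>A y. A \<in> sd_set I \<Longrightarrow> 0 \<le> y \<Longrightarrow> y \<le> row A \<Longrightarrow>
       \<exists>y'. 0 \<le> y' \<and> y' \<le> (if A = sd_root then 2 else len A) \<and> H (mid A, y, 0) = (mid A, y', 0)"
    "\<And>y. 0 \<le> y \<Longrightarrow> y \<le> real n \<Longrightarrow> \<exists>y'. 0 \<le> y' \<and> y' \<le> 2 \<and> H (- 1, y, 0) = (- 1, y', 0)"
    "\<And>A z. A \<in> sd_set I \<Longrightarrow> A \<noteq> sd_root \<Longrightarrow> 0 \<le> z \<Longrightarrow> z \<le> 1 \<Longrightarrow>
       H (mid A, row A, z) = (mid A + (mid (sd_parent A) - mid A) * (z / 2), len A * (1 + z / 2), z / 2)"
    "\<And>A t. A \<in> sd_set I \<Longrightarrow> A \<noteq> sd_root \<Longrightarrow> 0 \<le> t \<Longrightarrow> t \<le> 1 \<Longrightarrow>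
       H (mid A + (mid (sd_parent A) - mid A) * t, row A, 1) =
         (mid A + (mid (sd_parent A) - mid A) * ((1 + t) / 2), len A * (1 + (1 + t) / 2), (1 + t) / 2)"
    "\<And>z. 0 \<le> z \<Longrightarrow> z \<le> 1 \<Longrightarrow> H (1 / 2, real n, z) = (1 / 2 - 3 / 8 * z, 2, 0)"
    "\<And>z. 0 \<le> z \<Longrightarrow> z \<le> 1 \<Longrightarrow> H (- 1, real n, z) = (- 1 + 3 / 8 * z, 2, 0)"
    "\<And>t. \<bar>t\<bar> \<le> 1 \<Longrightarrow> H (- 1 / 4 + 3 / 4 * t, real n, 1) = (- 1 / 4 + 3 / 8 * t, 2, 0)"
proof -
  show thesis
  proof (rule bridge_wedge)
  fix W assume W: "deformation W"
    "\<And>x y. W (x, y, 0) = (x, y, 0)" "\<And>x y z. y \<le> 0 \<Longrightarrow> W (x, y, z) = (x, y, z)"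
    "\<And>A z. A \<in> sd_set I \<Longrightarrow> A \<noteq> sd_root \<Longrightarrow> 0 \<le> z \<Longrightarrow> z \<le> 1 \<Longrightarrow>
       W (mid A, row A, z) = (mid A + (mid (sd_parent A) - mid A) * (z / 2), row A, z / 2)"
    "\<And>A t. A \<in> sd_set I \<Longrightarrow> A \<noteq> sd_root \<Longrightarrow> 0 \<le> t \<Longrightarrow> t \<le> 1 \<Longrightarrow>
       W (mid A + (mid (sd_parent A) - mid A) * t, row A, 1) =
         (mid A + (mid (sd_parent A) - mid A) * ((1 + t) / 2), row A, (1 + t) / 2)"
    "\<And>z. 0 \<le> z \<Longrightarrow> z \<le> 1 \<Longrightarrow> W (1 / 2, real n, z) = (1 / 2 - 3 / 8 * z, real n, z / 2)"
    "\<And>z. 0 \<le> z \<Longrightarrow> z \<le> 1 \<Longrightarrow> W (- 1, real n, z) = (- 1 + 3 / 8 * z, real n, z / 2)"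
    "\<And>t. \<bar>t\<bar> \<le> 1 \<Longrightarrow> W (- 1 / 4 + 3 / 4 * t, real n, 1) = (- 1 / 4 + 3 / 8 * t, real n, 1 - \<bar>t\<bar> / 2)"
  show thesis
  proof (rule row_map)
  fix F :: "real \<Rightarrow> real \<Rightarrow> real" and m :: real
  assume F: "m > 0" "continuous_on UNIV (\<lambda>(x, y). F x y)"
    "\<And>x y s. s \<ge> 0 \<Longrightarrow> F x (y + s) \<ge> F x y + m * s"
    "\<And>x. F x 0 = 0" "\<And>x. F x (real n) = 2"
    "\<And>A x. A \<in> sd_set I \<Longrightarrow> A \<noteq> sd_root \<Longrightarrow> \<bar>x - mid (sd_parent A)\<bar> \<le> len (sd_parent A) / 4 \<Longrightarrow>
       F x (row A) = len A"
  have F_mono: "F x y \<le> F x y'" if "y \<le> y'" for x y y'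
  proof -
    have "0 \<le> m * (y' - y)" using F(1) that by (intro mult_nonneg_nonneg) auto
    then show ?thesis using F(3)[of "y' - y" x y] that by simp
  qed
  \<comment> \<open>After \<open>W\<close> the bridge of the root lies at
    \<open>z = 1 - \<bar>x + 1 / 4\<bar> * (4 / 3)\<close>, both on its legs and on its roof. This
    is subtracted in the top row; the second factor is \<open>0\<close> for
    \<open>y \<le> n - 1\<close>, where the other rows lie.\<close>
  define G where "G = (\<lambda>(x, y, z). (x :: real, y :: real,
    z - max 0 (1 - \<bar>x + 1 / 4\<bar> * (4 / 3)) * max 0 (min 1 (y - (real n - 1)))))"
  define R where "R = (\<lambda>(x, y, z). (x, F x (max y 0) + min y 0, z :: real))"
  \<comment> \<open>The shear \<open>y * (1 + z)\<close>, truncated so that it increases in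
    \<open>y\<close> everywhere and fixes \<open>y \<le> 0\<close>.\<close>
  define T where "T = (\<lambda>(x, y, z). (x :: real, y + max 0 y * max 0 (min 1 z), z :: real))"
  have dG: "deformation G" unfolding G_def
  proof (rule deformation_shear_z[where m = 1])
    show "continuous_on UNIV (\<lambda>(x, y, z). z - max 0 (1 - \<bar>x + 1 / 4\<bar> * (4 / 3)) * max 0 (min 1 (y -
        (real n - 1))))"
      unfolding case_prod_beta' by (intro continuous_intros)
  qed simp_all
  have dR: "deformation R" unfolding R_def
  proof (rule deformation_shear_y[where m = "min 1 m"])
    have "continuous_on UNIV (\<lambda>p. case (fst p, max (fst (snd p)) 0) of (x, y) \<Rightarrow> F x y)"
      by (rule continuous_on_compose2[OF F(2)]) (auto intro!: continuous_intros)
    then show "continuous_on UNIV (\<lambda>(x, y, z::real). F x (max y 0) + min y 0)"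
      unfolding case_prod_beta' by (intro continuous_intros) simp
    show "F x (max y 0) + min y 0 + min 1 m * s \<le> F x (max (y + s) 0) + min (y + s) 0"
      if "s \<ge> 0" for x y s
    proof -
      \<comment> \<open>The increment \<open>s\<close> splits into a part \<open>a\<close> above the
        bottom line, where \<open>F\<close> acts, and a part \<open>b\<close> below it, where the
        slope is \<open>1\<close>.\<close>
      define a where "a = max (y + s) 0 - max y 0"
      define b where "b = min (y + s) 0 - min y 0"
      have ab: "a \<ge> 0" "b \<ge> 0" "a + b = s" using that by (auto simp: a_def b_def)
      have "F x (max y 0) + m * a \<le> F x (max (y + s) 0)"
        using F(3)[OF ab(1), of x "max y 0"] by (simp add: a_def)
      moreover have "min 1 m * s \<le> m * a + b"
      proof -
        have "min 1 m * a \<le> m * a" "min 1 m * b \<le> 1 * b"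
          using ab by (intro mult_right_mono; simp)+
        then show ?thesis using ab(3) by (simp add: algebra_simps flip: ab(3))
      qed
      ultimately show ?thesis by (simp add: b_def)
    qed
  qed (use F(1) in simp)
  have dT: "deformation T" unfolding T_def
  proof (rule deformation_shear_y[where m = 1])
    show "continuous_on UNIV (\<lambda>(x :: real, y :: real, z :: real). y + max 0 y * max 0 (min 1 z))"
      unfolding case_prod_beta' by (intro continuous_intros)
    show "y + max 0 y * max 0 (min 1 z) + 1 * s \<le> y + s + max 0 (y + s) * max 0 (min 1 z)"
      if "s \<ge> 0" for x y z s :: real
    proof -
      have "max 0 y * max 0 (min 1 z) \<le> max 0 (y + s) * max 0 (min 1 z)"
        using that by (intro mult_right_mono) auto
      then show ?thesis by simp
    qed
  qed simp
  have RT0: "\<exists>y'. 0 \<le> y' \<and> y' \<le> F x h \<and> T (R (x, y, 0)) = (x, y', 0)" if "0 \<le> y" "y \<le> h" for x y h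
    using F_mono[of 0 y x] F_mono[of y h x] F(4) that by (simp add: T_def R_def)
  have n1: "real n \<ge> 1" using row_bounds(1)[OF root_in_sd_set] row_root by simp
  have A_facts: "F x (row A) = len A" "G (x, row A, z) = (x, row A, z)"
    if A: "A \<in> sd_set I" "A \<noteq> sd_root" and x: "x = mid A + (mid (sd_parent A) - mid A) * t" "0 \<le> t"
        "t \<le> 1"
    for A x t z
  proof -
    have pos: "fst A > 0" using fst_pos_iff A by blast
    have "\<bar>x - mid (sd_parent A)\<bar> = (1 - t) * (len (sd_parent A) / 4)"
    proof -
      have "x - mid (sd_parent A) = (1 - t) * (mid A - mid (sd_parent A))"
        by (simp add: x(1) algebra_simps)
      moreover have "\<bar>mid A - mid (sd_parent A)\<bar> = len (sd_parent A) / 4"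
        using mid_parent[OF pos] len_pos[of "sd_parent A"] by auto
      ultimately show ?thesis using x by (simp add: abs_mult)
    qed
    also have "\<dots> \<le> len (sd_parent A) / 4"
      using x len_pos[of "sd_parent A"] by (intro mult_left_le_one_le) auto
    finally show "F x (row A) = len A" using F(6) A by simp
    show "G (x, row A, z) = (x, row A, z)" using row_bounds(3)[OF A] by (simp add: G_def)
  qed
  have RT: "T (R (x, row A, z)) = (x, len A * (1 + z), z)"
    if "A \<in> sd_set I" "A \<noteq> sd_root" "x = mid A + (mid (sd_parent A) - mid A) * t" "0 \<le> t" "t \<le> 1" "0
        \<le> z" "z \<le> 1"
    for A x t z
  proof -
    have "R (x, row A, z) = (x, len A, z)"
      using A_facts(1)[OF that(1-5)] by (simp add: R_def)
    then show ?thesis using that(6,7) len_pos[of A] by (simp add: T_def algebra_simps)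
  qed
  have G_flat: "G (x, real n, z) = (x, real n, 0)" if "0 \<le> z" "1 - \<bar>x + 1 / 4\<bar> * (4 / 3) = z" for x z
    using that(1) unfolding that(2)[symmetric] G_def by simp
  have RTn: "T (R (x, real n, 0)) = (x, 2, 0)" for x
    using F(5) n1 by (simp add: R_def T_def)
  show thesis
  proof (rule that[of "T \<circ> (R \<circ> (G \<circ> W))"])
    show "deformation (T \<circ> (R \<circ> (G \<circ> W)))"
      by (intro deformation_compose dT dR dG W(1))
    show "(T \<circ> (R \<circ> (G \<circ> W))) (x, y, z) = (x, y, z)" if "y \<le> 0" for x y z
      using that n1 W(3)[OF that] F(4) by (simp add: G_def R_def T_def)
    show "\<exists>y'. 0 \<le> y' \<and> y' \<le> (if A = sd_root then 2 else len A) \<and>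
        (T \<circ> (R \<circ> (G \<circ> W))) (mid A, y, 0) = (mid A, y', 0)"
      if A: "A \<in> sd_set I" and y: "0 \<le> y" "y \<le> row A" for A y
    proof (cases "A = sd_root")
      case True
      then have "G (mid A, y, 0) = (mid A, y, 0)" by (simp add: G_def)
      then show ?thesis using RT0[OF y, of "mid A"] W(2) F(5) row_root True by simp
    next
      case False
      have "G (mid A, y, 0) = (mid A, y, 0)" using row_bounds(3)[OF A False] y by (simp add: G_def)
      then show ?thesis using RT0[OF y, of "mid A"] W(2) A_facts(1)[OF A False, of "mid A" 0] False
          by simp
    qed
    show "\<exists>y'. 0 \<le> y' \<and> y' \<le> 2 \<and> (T \<circ> (R \<circ> (G \<circ> W))) (- 1, y, 0) = (- 1, y', 0)"
      if y: "0 \<le> y" "y \<le> real n" for y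
    proof -
      have "G (- 1, y, 0) = (- 1, y, 0)" by (simp add: G_def)
      then show ?thesis using RT0[OF y, of "- 1"] W(2) F(5) by simp
    qed
    show "(T \<circ> (R \<circ> (G \<circ> W))) (mid A, row A, z) =
        (mid A + (mid (sd_parent A) - mid A) * (z / 2), len A * (1 + z / 2), z / 2)"
      if "A \<in> sd_set I" "A \<noteq> sd_root" "0 \<le> z" "z \<le> 1" for A z
      using W(4)[OF that] A_facts(2)[OF that(1,2) refl, of "z / 2"] RT[OF that(1,2) refl, of "z / 2"
          "z / 2"] that
      by simp
    show "(T \<circ> (R \<circ> (G \<circ> W))) (mid A + (mid (sd_parent A) - mid A) * t, row A, 1) =
         (mid A + (mid (sd_parent A) - mid A) * ((1 + t) / 2), len A * (1 + (1 + t) / 2), (1 + t) / 2)"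
      if "A \<in> sd_set I" "A \<noteq> sd_root" "0 \<le> t" "t \<le> 1" for A t
      using W(5)[OF that] A_facts(2)[OF that(1,2) refl, of "(1 + t) / 2"]
        RT[OF that(1,2) refl, of "(1 + t) / 2" "(1 + t) / 2"] that
      by (simp del: divide_const_simps)
    show "(T \<circ> (R \<circ> (G \<circ> W))) (1 / 2, real n, z) = (1 / 2 - 3 / 8 * z, 2, 0)" if "0 \<le> z" "z \<le> 1" for z
    proof -
      have "\<bar>1 / 2 - 3 / 8 * z + 1 / 4\<bar> = 3 / 4 - 3 / 8 * z" using that by linarith
      then have "G (1 / 2 - 3 / 8 * z, real n, z / 2) = (1 / 2 - 3 / 8 * z, real n, 0)"
        using that by (intro G_flat) (simp_all add: field_simps)
      then show ?thesis using W(6)[OF that] RTn by simp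
    qed
    show "(T \<circ> (R \<circ> (G \<circ> W))) (- 1, real n, z) = (- 1 + 3 / 8 * z, 2, 0)" if "0 \<le> z" "z \<le> 1" for z
    proof -
      have "\<bar>- 1 + 3 / 8 * z + 1 / 4\<bar> = 3 / 4 - 3 / 8 * z" using that by linarith
      then have "G (- 1 + 3 / 8 * z, real n, z / 2) = (- 1 + 3 / 8 * z, real n, 0)"
        using that by (intro G_flat) (simp_all add: field_simps)
      then show ?thesis using W(7)[OF that] RTn by simp
    qed
    show "(T \<circ> (R \<circ> (G \<circ> W))) (- 1 / 4 + 3 / 4 * t, real n, 1) = (- 1 / 4 + 3 / 8 * t, 2, 0)" if
        "\<bar>t\<bar> \<le> 1" for t
    proof -
      have "G (- 1 / 4 + 3 / 8 * t, real n, 1 - \<bar>t\<bar> / 2) = (- 1 / 4 + 3 / 8 * t, real n, 0)"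
        using that by (intro G_flat) (simp_all add: abs_mult)
      then show ?thesis using W(8)[OF that] RTn by simp
    qed
  qed
qed
  qed
qed

end

lemma column_segment:
  fixes x h :: real
  assumes "0 \<le> h"
  shows "p \<in> closed_segment (x, 0, 0) (x, h, 0) \<longleftrightarrow> (\<exists>y. 0 \<le> y \<and> y \<le> h \<and> p = (x, y, 0 :: real))"
proof
  assume "p \<in> closed_segment (x, 0, 0) (x, h, 0)"
  then obtain u where "0 \<le> u" "u \<le> 1" "p = (x, u * h, 0)" by (auto simp: closed_segment_triple)
  then show "\<exists>y. 0 \<le> y \<and> y \<le> h \<and> p = (x, y, 0)"
    using assms by (intro exI[of _ "u * h"]) (simp add: mult_left_le_one_le)
next
  assume "\<exists>y. 0 \<le> y \<and> y \<le> h \<and> p = (x, y, 0)"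
  then obtain y where y: "0 \<le> y" "y \<le> h" "p = (x, y, 0)" by blast
  show "p \<in> closed_segment (x, 0, 0) (x, h, 0)"
  proof (cases "h = 0")
    case True then show ?thesis using y by (simp add: closed_segment_triple)
  next
    case False
    then show ?thesis using y assms by (auto simp: closed_segment_triple intro!: exI[of _ "y / h"])
  qed
qed

lemma edge_arc_eq:
  "edge_arc A = {dseg (sd_positive A) (mid A, 0, 0) (mid A, len A, 0)} \<union>
     {dseg (sd_positive A) (mid A, len A, 0) (edge_top A)}"
  by (auto simp: edge_arc_def arc_points_def polyline_def dseg_def)

context dyadic_partition
begin

text \<open>Common coarsening of \<open>hat_tangle\<close> and of the image of the half grid: the
  root strand is one vertical segment without the vertex at height \<open>1\<close>, and the cap is
  undivided.\<close>

definition straight_tangle :: polygon where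
  "straight_tangle =
     (\<Union>A\<in>sd_set I - {sd_root}.
        {dseg (sd_positive A) (mid A, 0, 0) (mid A, len A, 0)} \<union>
        {dseg (sd_positive A) (mid A, len A, 0) (mid (sd_parent A), len (sd_parent A), 1)}) \<union>
     {dseg True (1 / 2, 0, 0) (1 / 2, 2, 0)} \<union> {dseg True (1 / 2, 2, 0) (- 1, 2, 0)} \<union>
     {dseg True (- 1, 2, 0) (- 1, 0, 0)}"

lemma sd_set_insert_root: "sd_set I = insert sd_root (sd_set I - {sd_root})"
  using root_in_sd_set by blast

lemma fin_nonroot: "finite (sd_set I - {sd_root})"
  using finite_sd_set by simp

lemma hat_tangle_subdivides: "subdivides (hat_tangle I) straight_tangle"
proof -
  have root: "edge_arc sd_root = {dseg True (1 / 2, 0, 0) (1 / 2, 1, 0), dseg True (1 / 2, 1, 0) (1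
      / 2, 2, 0)}"
    by (simp add: edge_arc_eq edge_top_def insert_commute)
  have nonroot: "edge_arc A = {dseg (sd_positive A) (mid A, 0, 0) (mid A, len A, 0)} \<union>
      {dseg (sd_positive A) (mid A, len A, 0) (mid (sd_parent A), len (sd_parent A), 1)}"
    if "A \<in> sd_set I - {sd_root}" for A
    using that fst_pos_iff[of A] by (simp add: edge_arc_eq edge_top_def)
  have "tangle I = edge_arc sd_root \<union> (\<Union>A\<in>sd_set I - {sd_root}. edge_arc A)"
    unfolding tangle_def by (subst sd_set_insert_root) (rule UN_insert)
  then have eq: "hat_tangle I = (\<Union>A\<in>sd_set I - {sd_root}. edge_arc A) \<union> edge_arc sd_root \<union>
      {dseg True (1 / 2, 2, 0) (- 1, 2, 0)} \<union> {dseg True (- 1, 2, 0) (- 1, 0, 0)}"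
    unfolding hat_tangle_def by (simp add: polyline_def dseg_def insert_commute Un_ac)
  have "subdivides (edge_arc A) ({dseg (sd_positive A) (mid A, 0, 0) (mid A, len A, 0)} \<union>
      {dseg (sd_positive A) (mid A, len A, 0) (mid (sd_parent A), len (sd_parent A), 1)})"
    if "A \<in> sd_set I - {sd_root}" for A
    unfolding nonroot[OF that] by (rule subdivides_refl) simp
  moreover have "subdivides (edge_arc sd_root) {dseg True (1 / 2, 0, 0) (1 / 2, 2, 0)}"
    unfolding root by (rule subdivides_dseg[where t = "1 / 2"]) simp_all
  ultimately show ?thesis
    unfolding eq straight_tangle_def
    by (intro subdivides_Un subdivides_UN fin_nonroot) (simp_all add: subdivides_refl)
qed

lemma half_link_to_tangle:
  obtains H E2 where "deformation H" "\<And>x y z. y \<le> 0 \<Longrightarrow> H (x, y, z) = (x, y, z)"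
    "carries H (half_link I mid (- 1) row 0) E2" "subdivides E2 straight_tangle"
proof (rule half_deformation)
  fix H assume H: "deformation H" "\<And>x y z. y \<le> 0 \<Longrightarrow> H (x, y, z) = (x, y, z)"
    "\<And>A y. A \<in> sd_set I \<Longrightarrow> 0 \<le> y \<Longrightarrow> y \<le> row A \<Longrightarrow>
       \<exists>y'. 0 \<le> y' \<and> y' \<le> (if A = sd_root then 2 else len A) \<and> H (mid A, y, 0) = (mid A, y', 0)"
    "\<And>y. 0 \<le> y \<Longrightarrow> y \<le> real n \<Longrightarrow> \<exists>y'. 0 \<le> y' \<and> y' \<le> 2 \<and> H (- 1, y, 0) = (- 1, y', 0)"
    "\<And>A z. A \<in> sd_set I \<Longrightarrow> A \<noteq> sd_root \<Longrightarrow> 0 \<le> z \<Longrightarrow> z \<le> 1 \<Longrightarrow>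
       H (mid A, row A, z) = (mid A + (mid (sd_parent A) - mid A) * (z / 2), len A * (1 + z / 2), z / 2)"
    "\<And>A t. A \<in> sd_set I \<Longrightarrow> A \<noteq> sd_root \<Longrightarrow> 0 \<le> t \<Longrightarrow> t \<le> 1 \<Longrightarrow>
       H (mid A + (mid (sd_parent A) - mid A) * t, row A, 1) =
         (mid A + (mid (sd_parent A) - mid A) * ((1 + t) / 2), len A * (1 + (1 + t) / 2), (1 + t) / 2)"
    "\<And>z. 0 \<le> z \<Longrightarrow> z \<le> 1 \<Longrightarrow> H (1 / 2, real n, z) = (1 / 2 - 3 / 8 * z, 2, 0)"
    "\<And>z. 0 \<le> z \<Longrightarrow> z \<le> 1 \<Longrightarrow> H (- 1, real n, z) = (- 1 + 3 / 8 * z, 2, 0)"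
    "\<And>t. \<bar>t\<bar> \<le> 1 \<Longrightarrow> H (- 1 / 4 + 3 / 4 * t, real n, 1) = (- 1 / 4 + 3 / 8 * t, 2, 0)"
  obtain k where "homeomorphism UNIV UNIV H k" by (rule deformation_homeomorphism[OF H(1)])
  then have cont: "continuous_on UNIV H" unfolding homeomorphism_def by blast
  define h where "h = (\<lambda>A. if A = sd_root then 2 else len A)"
  \<comment> \<open>The image of the upper end of a leg is the middle of the tree edge: the leg
    covers the lower half of the edge and the half row the upper half. For the root, the flattened
    legs and bridge divide the cap at \<open>1 / 8\<close> and \<open>- 5 / 8\<close>.\<close>
  define M where "M = (\<lambda>A. if A = sd_root then (1 / 8, 2, 0)
    else (mid A + (mid (sd_parent A) - mid A) * (1 / 2), len A * (3 / 2), 1 / 2 :: real))"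
  define T where "T = (\<lambda>A. if A = sd_root then (- 5 / 8, 2, 0)
    else (mid (sd_parent A), len (sd_parent A), 1 :: real))"
  define E2 where "E2 = (\<Union>A\<in>sd_set I.
      {dseg (sd_positive A) (mid A, 0, 0) (mid A, h A, 0)} \<union>
      {dseg (sd_positive A) (mid A, h A, 0) (M A)} \<union> {dseg (sd_positive A) (M A) (T A)}) \<union>
    {dseg True (- 5 / 8, 2, 0) (- 1, 2, 0)} \<union> {dseg True (- 1, 2, 0) (- 1, 0, 0)}"
  have leg: "H (mid A, row A, u) \<in> closed_segment (mid A, h A, 0) (M A)"
    "H (mid A, row A, 0) = (mid A, h A, 0)" "H (mid A, row A, 1) = M A"
    if A: "A \<in> sd_set I" and u: "0 \<le> u" "u \<le> 1" for A u
  proof -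
    have eq: "H (mid A, row A, u) = (mid A + u * (fst (M A) - mid A), h A + u * (fst (snd (M A)) - h A),
        0 + u * (snd (snd (M A)) - 0))" if u: "0 \<le> u" "u \<le> 1" for u
    proof (cases "A = sd_root")
      case True
      then show ?thesis using H(7)[OF u] row_root by (simp add: M_def h_def)
    next
      case False
      then show ?thesis using H(5)[OF A False u] by (simp add: M_def h_def field_simps)
    qed
    show "H (mid A, row A, u) \<in> closed_segment (mid A, h A, 0) (M A)"
      using eq[OF u] u closed_segment_triple[of "H (mid A, row A, u)" "mid A" "h A" 0
          "fst (M A)" "fst (snd (M A))" "snd (snd (M A))"] by auto
    show "H (mid A, row A, 0) = (mid A, h A, 0)" using eq[of 0] by simp
    show "H (mid A, row A, 1) = M A" using eq[of 1] by (simp add: prod_eq_iff)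
  qed
  define X' where "X' = (\<lambda>A. if A = sd_root then - 1 else mid (sd_parent A))"
  have bridge: "H (mid A + u * (X' A - mid A), row A, 1) \<in> closed_segment (M A) (T A)"
    "H (X' A, row A, 1) = T A"
    if A: "A \<in> sd_set I" and u: "0 \<le> u" "u \<le> 1" for A u
  proof -
    have eq: "H (mid A + u * (X' A - mid A), row A, 1) =
        (fst (M A) + u * (fst (T A) - fst (M A)), fst (snd (M A)) + u * (fst (snd (T A)) - fst (snd
            (M A))),
         snd (snd (M A)) + u * (snd (snd (T A)) - snd (snd (M A))))" if u: "0 \<le> u" "u \<le> 1" for u
    proof (cases "A = sd_root")
      case True
      \<comment> \<open>The root bridge is traversed from its right end, parameter \<open>1\<close>,
        to its left end, parameter \<open>- 1\<close>.\<close>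
      have "\<bar>1 - 2 * u\<bar> \<le> 1" using u by linarith
      moreover have "- 1 / 4 + 3 / 4 * (1 - 2 * u) = mid A + u * (X' A - mid A)"
        using True by (simp add: X'_def field_simps)
      moreover have "- 1 / 4 + 3 / 8 * (1 - 2 * u) = 1 / 8 + u * (- 5 / 8 - 1 / 8)"
        by (simp add: field_simps)
      ultimately show ?thesis using H(9)[of "1 - 2 * u"] True row_root by (simp add: M_def T_def)
    next
      case False
      have pos: "fst A > 0" using fst_pos_iff[OF A] False by blast
      have 1: "mid A + u * (X' A - mid A) = mid A + (mid (sd_parent A) - mid A) * u"
        using False by (simp add: X'_def)
      have 2: "a + (b - a) * ((1 + u) / 2) = a + (b - a) * (1 / 2) + u * (b - (a + (b - a) * (1 / 2)))"
        for a b :: real by (simp add: field_simps)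
      have 3: "a * (1 + (1 + u) / 2) = a * (3 / 2) + u * (2 * a - a * (3 / 2))" for a :: real
        by (simp add: field_simps)
      have 4: "(1 + u) / 2 = 1 / 2 + u * (1 - 1 / 2)" by (simp add: field_simps)
      have M: "M A = (mid A + (mid (sd_parent A) - mid A) * (1 / 2), len A * (3 / 2), 1 / 2)"
        and T: "T A = (mid (sd_parent A), 2 * len A, 1)"
        using False len_parent[OF pos] by (simp_all add: M_def T_def)
      show ?thesis
        unfolding 1 H(6)[OF A False u] M T fst_conv snd_conv prod.inject by (intro conjI 2 3 4)
    qed
    show "H (mid A + u * (X' A - mid A), row A, 1) \<in> closed_segment (M A) (T A)"
      using eq[OF u] u closed_segment_triple[of _ "fst (M A)" "fst (snd (M A))" "snd (snd (M A))"
          "fst (T A)" "fst (snd (T A))" "snd (snd (T A))"] by auto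
    show "H (X' A, row A, 1) = T A" using eq[of 1] by (simp add: prod_eq_iff)
  qed
  have h_nonneg: "0 \<le> h A" for A using len_pos[of A] by (simp add: h_def less_imp_le)
  have c1: "carries H {dseg (sd_positive A) (mid A, 0, 0) (mid A, row A, 0)}
      {dseg (sd_positive A) (mid A, 0, 0) (mid A, h A, 0)}" if A: "A \<in> sd_set I" for A
  proof (rule carries_dseg[OF cont])
    show "H (mid A, 0, 0) = (mid A, 0, 0)" by (rule H(2)) simp
    show "H (mid A, row A, 0) = (mid A, h A, 0)" by (rule leg(2)[OF A, of 0]) simp_all
    fix p :: point assume "p \<in> closed_segment (mid A, 0, 0) (mid A, row A, 0)"
    then obtain y where y: "0 \<le> y" "y \<le> row A" "p = (mid A, y, 0)"
      using column_segment[of "row A" p "mid A"] by auto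
    obtain y' where "0 \<le> y'" "y' \<le> h A" "H p = (mid A, y', 0)"
      using H(3)[OF A y(1,2)] y(3) unfolding h_def by blast
    then show "H p \<in> closed_segment (mid A, 0, 0) (mid A, h A, 0)"
      using column_segment[OF h_nonneg] by blast
  qed
  have c2: "carries H {dseg (sd_positive A) (mid A, row A, 0) (mid A, row A, 1)}
      {dseg (sd_positive A) (mid A, h A, 0) (M A)}" if A: "A \<in> sd_set I" for A
  proof (rule carries_dseg[OF cont])
    show "H (mid A, row A, 0) = (mid A, h A, 0)" by (rule leg(2)[OF A, of 0]) simp_all
    show "H (mid A, row A, 1) = M A" by (rule leg(3)[OF A, of 0]) simp_all
    fix p :: point assume "p \<in> closed_segment (mid A, row A, 0) (mid A, row A, 1)"
    then obtain u where "0 \<le> u" "u \<le> 1" "p = (mid A, row A, u)" by (auto simp: closed_segment_triple)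
    then show "H p \<in> closed_segment (mid A, h A, 0) (M A)" using leg(1)[OF A] by blast
  qed
  have c3: "carries H {dseg (sd_positive A) (mid A, row A, 1) (X' A, row A, 1)}
      {dseg (sd_positive A) (M A) (T A)}" if A: "A \<in> sd_set I" for A
  proof (rule carries_dseg[OF cont])
    show "H (mid A, row A, 1) = M A" by (rule leg(3)[OF A, of 0]) simp_all
    show "H (X' A, row A, 1) = T A" by (rule bridge(2)[OF A, of 0]) simp_all
    fix p :: point assume "p \<in> closed_segment (mid A, row A, 1) (X' A, row A, 1)"
    then obtain u where "0 \<le> u" "u \<le> 1" "p = (mid A + u * (X' A - mid A), row A, 1)"
      by (auto simp: closed_segment_triple)
    then show "H p \<in> closed_segment (M A) (T A)" using bridge(1)[OF A] by blast
  qed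
  have l0: "H (- 1, real n, 0) = (- 1, 2, 0)" "H (- 1, real n, 1) = (- 5 / 8, 2, 0)"
    using H(8)[of 0] H(8)[of 1] by simp_all
  have c4: "carries H {dseg True (- 1, real n, 1) (- 1, real n, 0)} {dseg True (- 5 / 8, 2, 0) (- 1,
      2, 0)}"
  proof (rule carries_dseg[OF cont l0(2,1)])
    fix p :: point assume "p \<in> closed_segment (- 1, real n, 1) (- 1, real n, 0)"
    then obtain u where u: "0 \<le> u" "u \<le> 1" "p = (- 1, real n, 1 - u)" by (auto simp:
        closed_segment_triple)
    then have "H p = (- 5 / 8 + u * (- 1 - - 5 / 8), 2, 0)"
      using H(8)[of "1 - u"] by (simp add: field_simps)
    then show "H p \<in> closed_segment (- 5 / 8, 2, 0) (- 1, 2, 0)"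
      using u(1,2) by (auto simp: closed_segment_triple)
  qed
  have c5: "carries H {dseg True (- 1, real n, 0) (- 1, 0, 0)} {dseg True (- 1, 2, 0) (- 1, 0, 0)}"
  proof (rule carries_dseg[OF cont l0(1)])
    show "H (- 1, 0, 0) = (- 1, 0, 0)" by (rule H(2)) simp
    fix p :: point assume "p \<in> closed_segment (- 1, real n, 0) (- 1, 0, 0)"
    then obtain y where y: "0 \<le> y" "y \<le> real n" "p = (- 1, y, 0)"
      using column_segment[of "real n" p "- 1"] by (auto simp: closed_segment_commute)
    obtain y' where "0 \<le> y'" "y' \<le> 2" "H p = (- 1, y', 0)"
      using H(4)[OF y(1,2)] y(3) by blast
    then have "H p \<in> closed_segment (- 1, 0, 0) (- 1, 2, 0)"
      using column_segment[of 2 "H p" "- 1"] by simp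
    then show "H p \<in> closed_segment (- 1, 2, 0) (- 1, 0, 0)" by (simp only: closed_segment_commute)
  qed
  have link: "carries H (half_link I mid (- 1) row 0) E2"
    unfolding half_link_def E2_def row_root X'_def[symmetric, THEN fun_cong]
    using c1 c2 c3 c4 c5 by (intro carries_Un carries_UN) (simp_all add: X'_def)
  have sub: "subdivides E2 straight_tangle"
  proof -
    have root: "mid sd_root = 1 / 2" "h sd_root = 2" "M sd_root = (1 / 8, 2, 0)" "T sd_root = (- 5 /
        8, 2, 0)"
      by (simp_all add: h_def M_def T_def)
    have eq: "E2 = (\<Union>A\<in>sd_set I - {sd_root}.
        {dseg (sd_positive A) (mid A, 0, 0) (mid A, h A, 0)} \<union>
        {dseg (sd_positive A) (mid A, h A, 0) (M A), dseg (sd_positive A) (M A) (T A)}) \<union>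
      {dseg True (1 / 2, 0, 0) (1 / 2, 2, 0)} \<union>
      ({dseg True (1 / 2, 2, 0) (1 / 8, 2, 0), dseg True (1 / 8, 2, 0) (- 5 / 8, 2, 0)} \<union>
       {dseg True (- 5 / 8, 2, 0) (- 1, 2, 0)}) \<union> {dseg True (- 1, 2, 0) (- 1, 0, 0)}"
      unfolding E2_def
      by (subst sd_set_insert_root, unfold UN_insert root) (simp add: insert_commute Un_ac)
    have "subdivides {dseg True (1 / 2, 2, 0) (1 / 8, 2, 0), dseg True (1 / 8, 2, 0) (- 5 / 8, 2, 0)}
        {dseg True (1 / 2, 2, 0) (- 5 / 8, 2, 0)}"
      \<comment> \<open>The cap has length \<open>3 / 2\<close> and its pieces have lengths
        \<open>3 / 8\<close>, \<open>3 / 4\<close> and \<open>3 / 8\<close>; this gives the ratios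
        \<open>1 / 3\<close> here and \<open>3 / 4\<close> below.\<close>
      by (rule subdivides_dseg[where t = "1 / 3"]) simp_all
    then have "subdivides ({dseg True (1 / 2, 2, 0) (1 / 8, 2, 0), dseg True (1 / 8, 2, 0) (- 5 / 8,
        2, 0)} \<union>
        {dseg True (- 5 / 8, 2, 0) (- 1, 2, 0)})
        ({dseg True (1 / 2, 2, 0) (- 5 / 8, 2, 0)} \<union> {dseg True (- 5 / 8, 2, 0) (- 1, 2, 0)})"
      by (intro subdivides_Un) (simp_all add: subdivides_refl)
    moreover have "subdivides ({dseg True (1 / 2, 2, 0) (- 5 / 8, 2, 0)} \<union> {dseg True (- 5 / 8, 2,
        0) (- 1, 2, 0)})
        {dseg True (1 / 2, 2, 0) (- 1, 2, 0)}"
      unfolding insert_is_Un[symmetric]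
      by (rule subdivides_dseg[where t = "3 / 4"]) simp_all
    ultimately have cap: "subdivides ({dseg True (1 / 2, 2, 0) (1 / 8, 2, 0), dseg True (1 / 8, 2,
        0) (- 5 / 8, 2, 0)} \<union>
        {dseg True (- 5 / 8, 2, 0) (- 1, 2, 0)}) {dseg True (1 / 2, 2, 0) (- 1, 2, 0)}"
      by (rule subdivides_trans)
    have edge: "subdivides ({dseg (sd_positive A) (mid A, 0, 0) (mid A, h A, 0)} \<union>
        {dseg (sd_positive A) (mid A, h A, 0) (M A), dseg (sd_positive A) (M A) (T A)})
        ({dseg (sd_positive A) (mid A, 0, 0) (mid A, len A, 0)} \<union>
         {dseg (sd_positive A) (mid A, len A, 0) (mid (sd_parent A), len (sd_parent A), 1)})"
      if A: "A \<in> sd_set I - {sd_root}" for A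
    proof -
      have nr: "A \<noteq> sd_root" and pos: "fst A > 0" using A fst_pos_iff[of A] by auto
      have eqs: "h A = len A" "M A = (mid A + (mid (sd_parent A) - mid A) * (1 / 2), len A * (3 /
          2), 1 / 2)"
        "T A = (mid (sd_parent A), len (sd_parent A), 1)"
        using nr by (simp_all add: h_def M_def T_def)
      show ?thesis unfolding eqs
      proof (intro subdivides_Un)
        show "subdivides {dseg (sd_positive A) (mid A, len A, 0)
            (mid A + (mid (sd_parent A) - mid A) * (1 / 2), len A * (3 / 2), 1 / 2),
          dseg (sd_positive A) (mid A + (mid (sd_parent A) - mid A) * (1 / 2), len A * (3 / 2), 1 / 2)
            (mid (sd_parent A), len (sd_parent A), 1)}
          {dseg (sd_positive A) (mid A, len A, 0) (mid (sd_parent A), len (sd_parent A), 1)}"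
          by (rule subdivides_dseg[where t = "1 / 2"]) (simp_all add: len_parent[OF pos] field_simps)
      qed (simp add: subdivides_refl)
    qed
    show ?thesis
      unfolding eq straight_tangle_def
      by (intro subdivides_Un subdivides_UN fin_nonroot cap edge) (simp_all add: subdivides_refl)
  qed
  show thesis
  proof (rule that[OF H(1) _ link sub])
    show "H (x, y, z) = (x, y, z)" if "y \<le> 0" for x y z by (rule H(2)[OF that])
  qed
qed

end

lemma swap_dseg [simp]: "prod.swap (dseg b P Q) = dseg (\<not> b) P Q"
  by (simp add: dseg_def)

lemma dseg_flip: "dseg (\<not> b) P Q = dseg b Q P"
  by (simp add: dseg_def)

section \<open>Stretching the grid\<close>

text \<open>The half link is taken apart because its pieces relate differently to the grid: legs
  occur there unchanged, columns pass through both halves, and half rows are joined in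
  pairs.\<close>

definition half_columns :: "sd list \<Rightarrow> (sd \<Rightarrow> real) \<Rightarrow> real \<Rightarrow> (sd \<Rightarrow> real) \<Rightarrow> real \<Rightarrow> polygon" where
  "half_columns I X x0 Y b =
     (\<Union>A\<in>sd_set I. {dseg (sd_positive A) (X A, b, 0) (X A, Y A, 0)}) \<union>
     {dseg True (x0, Y sd_root, 0) (x0, b, 0)}"

definition half_legs :: "sd list \<Rightarrow> (sd \<Rightarrow> real) \<Rightarrow> real \<Rightarrow> (sd \<Rightarrow> real) \<Rightarrow> polygon" where
  "half_legs I X x0 Y =
     (\<Union>A\<in>sd_set I. {dseg (sd_positive A) (X A, Y A, 0) (X A, Y A, 1)}) \<union>
     {dseg True (x0, Y sd_root, 1) (x0, Y sd_root, 0)}"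

definition half_split_rows :: "sd list \<Rightarrow> (sd \<Rightarrow> real) \<Rightarrow> real \<Rightarrow> (sd \<Rightarrow> real) \<Rightarrow> polygon" where
  "half_split_rows I X x0 Y =
     (\<Union>A\<in>sd_set I. {dseg (sd_positive A) (X A, Y A, 1) (if A = sd_root then x0 else X (sd_parent A),
         Y A, 1)})"

definition half_rows :: "sd list \<Rightarrow> (sd \<Rightarrow> real) \<Rightarrow> real \<Rightarrow> (sd \<Rightarrow> real) \<Rightarrow> polygon" where
  "half_rows I X x0 Y =
     (\<Union>A\<in>{A \<in> sd_set I. sd_positive A \<and> A \<noteq> sd_root}. {dseg True (X A, Y A, 1) (X (sd_conjugate A),
         Y A, 1)}) \<union>
     {dseg True (X sd_root, Y sd_root, 1) (x0, Y sd_root, 1)}"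

lemma half_link_eq:
  "half_link I X x0 Y b = half_columns I X x0 Y b \<union> half_legs I X x0 Y \<union> half_split_rows I X x0 Y"
  unfolding half_link_def half_columns_def half_legs_def half_split_rows_def UN_Un_distrib
  by (simp only: Un_ac)

lemma real_segment: "t \<in> closed_segment a b \<longleftrightarrow> (\<exists>u. 0 \<le> u \<and> u \<le> 1 \<and> t = a + u * (b - a))"
  for a b t :: real
proof -
  have "(1 - u) *\<^sub>R a + u *\<^sub>R b = a + u * (b - a)" for u by (simp add: algebra_simps)
  then show ?thesis by (auto simp: closed_segment_def)
qed

lemma x_segment:
  "p \<in> closed_segment (x, y, z) (x', y, z) \<longleftrightarrow> (\<exists>t\<in>closed_segment x x'. p = (t, y, z))"
  for x y z x' :: real
  by (auto simp: closed_segment_triple real_segment)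

lemma y_segment:
  "p \<in> closed_segment (x, y, z) (x, y', z) \<longleftrightarrow> (\<exists>t\<in>closed_segment y y'. p = (x, t, z))"
  for x y z y' :: real
  by (auto simp: closed_segment_triple real_segment)

lemma z_segment:
  "p \<in> closed_segment (x, y, z) (x, y, z') \<longleftrightarrow> (\<exists>t\<in>closed_segment z z'. p = (x, y, t))"
  for x y z z' :: real
  by (auto simp: closed_segment_triple real_segment)

lemma mono_segment:
  fixes f :: "real \<Rightarrow> real"
  assumes "mono f" "t \<in> closed_segment a b"
  shows "f t \<in> closed_segment (f a) (f b)"
proof (cases "a \<le> b")
  case True
  then have "f a \<le> f t" "f t \<le> f b"
    using assms(2) by (auto simp: closed_segment_eq_real_ivl intro: monoD[OF assms(1)])
  then show ?thesis by (simp add: closed_segment_eq_real_ivl)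
next
  case False
  then have "f b \<le> f t" "f t \<le> f a"
    using assms(2) by (auto simp: closed_segment_eq_real_ivl intro: monoD[OF assms(1)])
  then show ?thesis by (auto simp: closed_segment_eq_real_ivl)
qed

lemma convex_segment_mem:
  fixes D :: "real set"
  assumes "convex D" "a \<in> D" "b \<in> D" "t \<in> closed_segment a b"
  shows "t \<in> D"
  using closed_segment_subset[OF assms(2,3,1)] assms(4) by blast

text \<open>Every segment is parallel to an axis, so monotone maps of the coordinates keep it
  straight. The set \<open>D\<close> of heights is there because the horizontal stretching acts on
  \<open>x\<close> alone only outside the strip between the halves.\<close>

lemma half_link_carries:
  assumes cont: "continuous_on UNIV f" and mono: "mono \<phi>" "mono \<beta>" and D: "convex D" "b \<in> D"
    "\<And>A. A \<in> sd_set I \<Longrightarrow> Y A \<in> D" "sd_root \<in> sd_set I"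
    and f: "\<And>x y z. y \<in> D \<Longrightarrow> f (x, y, z) = (\<phi> x, \<beta> y, z)"
  shows "carries f (half_link I X x0 Y b) (half_link I (\<lambda>A. \<phi> (X A)) (\<phi> x0) (\<lambda>A. \<beta> (Y A)) (\<beta> b))"
proof -
  have cx: "carries f {dseg s (x, y, z) (x', y, z)} {dseg s (\<phi> x, \<beta> y, z) (\<phi> x', \<beta> y, z)}"
    if y: "y \<in> D" for s x x' y z
  proof (rule carries_dseg[OF cont f[OF y] f[OF y]])
    fix p assume "p \<in> closed_segment (x, y, z) (x', y, z)"
    then obtain t where "t \<in> closed_segment x x'" "p = (t, y, z)" using x_segment by blast
    then show "f p \<in> closed_segment (\<phi> x, \<beta> y, z) (\<phi> x', \<beta> y, z)"
      using mono_segment[OF mono(1)] f[OF y] by (simp add: x_segment)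
  qed
  have cy: "carries f {dseg s (x, y, z) (x, y', z)} {dseg s (\<phi> x, \<beta> y, z) (\<phi> x, \<beta> y', z)}"
    if y: "y \<in> D" "y' \<in> D" for s x y y' z
  proof (rule carries_dseg[OF cont f[OF y(1)] f[OF y(2)]])
    fix p assume "p \<in> closed_segment (x, y, z) (x, y', z)"
    then obtain t where "t \<in> closed_segment y y'" "p = (x, t, z)" using y_segment by blast
    then show "f p \<in> closed_segment (\<phi> x, \<beta> y, z) (\<phi> x, \<beta> y', z)"
      using mono_segment[OF mono(2)] f[OF convex_segment_mem[OF D(1) y]] by (simp add: y_segment)
  qed
  have cz: "carries f {dseg s (x, y, z) (x, y, z')} {dseg s (\<phi> x, \<beta> y, z) (\<phi> x, \<beta> y, z')}"
    if y: "y \<in> D" for s x y z z'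
  proof (rule carries_dseg[OF cont f[OF y] f[OF y]])
    fix p assume "p \<in> closed_segment (x, y, z) (x, y, z')"
    then obtain t where "t \<in> closed_segment z z'" "p = (x, y, t)" using z_segment by blast
    then show "f p \<in> closed_segment (\<phi> x, \<beta> y, z) (\<phi> x, \<beta> y, z')"
      using f[OF y] by (simp add: z_segment)
  qed
  have "carries f (half_columns I X x0 Y b) (half_columns I (\<lambda>A. \<phi> (X A)) (\<phi> x0) (\<lambda>A. \<beta> (Y A)) (\<beta> b))"
    unfolding half_columns_def by (intro carries_Un carries_UN cy D)
  moreover have "carries f (half_legs I X x0 Y) (half_legs I (\<lambda>A. \<phi> (X A)) (\<phi> x0) (\<lambda>A. \<beta> (Y A)))"
    unfolding half_legs_def by (intro carries_Un carries_UN cz D)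
  moreover have "carries f (half_split_rows I X x0 Y) (half_split_rows I (\<lambda>A. \<phi> (X A)) (\<phi> x0) (\<lambda>A. \<beta>
      (Y A)))"
    unfolding half_split_rows_def if_distrib[of \<phi>, symmetric] by (intro carries_UN cx D)
  ultimately show ?thesis unfolding half_link_eq by (intro carries_Un)
qed

lemma reversed_mirror_half_link:
  "reversed_mirror (half_link I X x0 Y b) = prod.swap ` half_link I X x0 (\<lambda>A. - 1 - Y A) (- 1 - b)"
proof -
  have r: "reversed_mirror E = prod.swap ` map_prod flip_point flip_point ` E" for E
    unfolding reversed_mirror_eq image_image by (rule image_cong) (simp_all add: prod.swap_def)
  have d: "map_prod flip_point flip_point (dseg s (x, y, z) (x', y', z')) = dseg s (x, - 1 - y, z)
      (x', - 1 - y', z')"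
    for s x y z x' y' z'
    by (simp add: dseg_def flip_point_def)
  show ?thesis
    unfolding r half_link_def image_Un image_UN by (simp only: image_insert image_empty d)
qed

context dyadic_partition
begin

text \<open>The column of the parent lies strictly between those of two conjugate intervals, and
  their opposite signs orient both half rows alike, from the positive interval to the negative
  one.\<close>

lemma half_split_rows_subdivides:
  assumes X: "\<And>A B. A \<in> sd_set I \<Longrightarrow> B \<in> sd_set I \<Longrightarrow> mid A < mid B \<Longrightarrow> X A < X B"
    and Y: "\<And>A. A \<in> sd_set I \<Longrightarrow> A \<noteq> sd_root \<Longrightarrow> Y (sd_conjugate A) = Y A"
  shows "subdivides (half_split_rows I X x0 Y) (half_rows I X x0 Y)"
proof -
  let ?Pos = "{A \<in> sd_set I. sd_positive A \<and> A \<noteq> sd_root}"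
  let ?r = "\<lambda>A. dseg (sd_positive A) (X A, Y A, 1) (if A = sd_root then x0 else X (sd_parent A), Y A, 1)"
  have conj: "sd_conjugate A \<in> sd_set I" "sd_conjugate A \<noteq> sd_root" "sd_positive (sd_conjugate A) \<longleftrightarrow>
      \<not> sd_positive A"
    if "A \<in> sd_set I" "A \<noteq> sd_root" for A
  proof -
    have pos: "fst A > 0" using that fst_pos_iff by blast
    show c: "sd_conjugate A \<in> sd_set I" using conjugate_in_sd_set[OF that(1) pos] .
    show "sd_conjugate A \<noteq> sd_root" using pos fst_conjugate[of A] by (metis fst_conv less_irrefl)
    show "sd_positive (sd_conjugate A) \<longleftrightarrow> \<not> sd_positive A" by (rule sd_positive_conjugate[OF pos])
  qed
  \<comment> \<open>Conjugate pairs are indexed by their positive member; the root is alone in its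
    row.\<close>
  have S: "sd_set I = ?Pos \<union> sd_conjugate ` ?Pos \<union> {sd_root}"
  proof (intro equalityI subsetI)
    fix A assume A: "A \<in> sd_set I"
    show "A \<in> ?Pos \<union> sd_conjugate ` ?Pos \<union> {sd_root}"
    proof (cases "A = sd_root \<or> sd_positive A")
      case True then show ?thesis using A by blast
    next
      case False
      then have "sd_conjugate A \<in> ?Pos" using conj[OF A] by blast
      then have "sd_conjugate (sd_conjugate A) \<in> sd_conjugate ` ?Pos" by (rule imageI)
      then show ?thesis by simp
    qed
  next
    fix A assume "A \<in> ?Pos \<union> sd_conjugate ` ?Pos \<union> {sd_root}"
    then show "A \<in> sd_set I" using conj root_in_sd_set by blast
  qed
  have "half_split_rows I X x0 Y = (\<Union>A\<in>sd_set I. {?r A})" unfolding half_split_rows_def ..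
  also have "\<dots> = (\<Union>A\<in>?Pos. {?r A}) \<union> (\<Union>A\<in>sd_conjugate ` ?Pos. {?r A}) \<union> {?r sd_root}"
    by (subst S) (simp only: UN_Un UN_insert UN_empty Un_empty_right)
  also have "(\<Union>A\<in>?Pos. {?r A}) \<union> (\<Union>A\<in>sd_conjugate ` ?Pos. {?r A}) = (\<Union>A\<in>?Pos. {?r A, ?r
      (sd_conjugate A)})"
    by blast
  finally have eq: "half_split_rows I X x0 Y = (\<Union>A\<in>?Pos. {?r A, ?r (sd_conjugate A)}) \<union> {?r sd_root}" .
  have "subdivides {?r A, ?r (sd_conjugate A)} {dseg True (X A, Y A, 1) (X (sd_conjugate A), Y A, 1)}"
    if A: "A \<in> ?Pos" for A
  proof -
    have AS: "A \<in> sd_set I" "A \<noteq> sd_root" "sd_positive A" and pos: "fst A > 0"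
      using A fst_pos_iff by blast+
    have PS: "sd_parent A \<in> sd_set I" using parent_in_sd_set[OF AS(1) pos] .
    have "mid A \<noteq> mid (sd_parent A)" using mid_parent[OF pos] len_pos[of "sd_parent A"] by auto
    then have "mid A < mid (sd_parent A) \<and> mid (sd_parent A) < mid (sd_conjugate A) \<or>
        mid (sd_conjugate A) < mid (sd_parent A) \<and> mid (sd_parent A) < mid A"
      using mid_conjugate[OF pos] by linarith
    then have between: "X A < X (sd_parent A) \<and> X (sd_parent A) < X (sd_conjugate A) \<or>
        X (sd_conjugate A) < X (sd_parent A) \<and> X (sd_parent A) < X A"
      using X AS(1) PS conj(1)[OF AS(1,2)] by blast
    define t where "t = (X (sd_parent A) - X A) / (X (sd_conjugate A) - X A)"
    have t: "0 < t" "t < 1" "X (sd_parent A) - X A = t * (X (sd_conjugate A) - X A)"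
      using between by (auto simp: t_def divide_simps)
    have "?r A = dseg True (X A, Y A, 1) (X (sd_parent A), Y A, 1)" using AS by simp
    moreover have "?r (sd_conjugate A) = dseg True (X (sd_parent A), Y A, 1) (X (sd_conjugate A), Y
        A, 1)"
      using conj[OF AS(1,2)] AS(3) Y[OF AS(1,2)] by (simp add: dseg_def)
    moreover have "subdivides {dseg True (X A, Y A, 1) (X (sd_parent A), Y A, 1),
        dseg True (X (sd_parent A), Y A, 1) (X (sd_conjugate A), Y A, 1)}
        {dseg True (X A, Y A, 1) (X (sd_conjugate A), Y A, 1 :: real)}"
      by (rule subdivides_dseg[where t = t]) (use t between in auto)
    ultimately show ?thesis by simp
  qed
  moreover have "subdivides {?r sd_root} {dseg True (X sd_root, Y sd_root, 1) (x0, Y sd_root, 1)}"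
    using subdivides_refl[of "{?r sd_root}"] by simp
  moreover have "finite ?Pos" using finite_sd_set by simp
  ultimately show ?thesis
    unfolding eq half_rows_def by (intro subdivides_Un subdivides_UN)
qed

end

section \<open>The grid diagram of a compatible pair\<close>

locale compatible_partitions =
  I: dyadic_partition I + J: dyadic_partition J for I J +
  assumes length_eq: "length J = length I" and signs: "sign_seq I = sign_seq J"
begin

definition partner :: "sd \<Rightarrow> sd" where
  "partner A = (SOME B. B \<in> sd_set J \<and> mid_rank J B = mid_rank I A)"

text \<open>Both partitions have the ranks \<open>1..2 * n - 1\<close>, so a partner exists. Its
  sign agrees since signs are determined by the rank and the common sign sequence of the
  leaves.\<close>

lemma partner:
  assumes A: "A \<in> sd_set I"
  shows "partner A \<in> sd_set J" "mid_rank J (partner A) = mid_rank I A"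
    "sd_positive (partner A) = sd_positive A"
proof -
  have "mid_rank I A \<in> mid_rank J ` sd_set J"
    using A unfolding J.mid_rank_range length_eq I.mid_rank_range[symmetric] by (rule imageI)
  then have "\<exists>B. B \<in> sd_set J \<and> mid_rank J B = mid_rank I A" by (elim imageE) metis
  then have *: "partner A \<in> sd_set J \<and> mid_rank J (partner A) = mid_rank I A"
    unfolding partner_def by (rule someI_ex)
  then show 1: "partner A \<in> sd_set J" and 2: "mid_rank J (partner A) = mid_rank I A" by blast+
  let ?k = "mid_rank I A div 2"
  have "mid_rank I A \<in> {1..2 * length I - 1}"
    using A unfolding I.mid_rank_range[symmetric] by (rule imageI)
  then have k: "?k < length I" by auto
  have "map sd_positive I ! ?k = map sd_positive J ! ?k" using signs by (simp add: sign_seq_def)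
  then have "sd_positive (I ! ?k) = sd_positive (J ! ?k)" using k length_eq by simp
  then show "sd_positive (partner A) = sd_positive A"
    using I.sd_positive_rank[OF A] J.sd_positive_rank[OF 1] 2 by simp
qed

lemma partner_eqI:
  assumes "A \<in> sd_set I" "B \<in> sd_set J" "mid_rank J B = mid_rank I A"
  shows "B = partner A"
  using J.mid_rank_inj[OF assms(2) partner(1)[OF assms(1)]] partner(2)[OF assms(1)] assms(3) by simp

lemma partner_image: "partner ` sd_set I = sd_set J"
proof (intro equalityI subsetI)
  fix B assume B: "B \<in> sd_set J"
  then have "mid_rank J B \<in> mid_rank I ` sd_set I"
    unfolding I.mid_rank_range length_eq[symmetric] J.mid_rank_range[symmetric] by (rule imageI)
  then obtain A where "mid_rank J B = mid_rank I A" "A \<in> sd_set I" by (rule imageE)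
  then show "B \<in> partner ` sd_set I" using partner_eqI[OF _ B] by blast
qed (use partner(1) in blast)

abbreviation XI :: "sd \<Rightarrow> real" where "XI A \<equiv> real (grid_x I A)"
abbreviation XJ :: "sd \<Rightarrow> real" where "XJ B \<equiv> real (grid_x J B)"
abbreviation N :: real where "N \<equiv> real (length I)"

text \<open>The upper half is shifted up by the \<open>N\<close> rows of the lower one, in which the
  flip has turned row \<open>k\<close> into row \<open>N + 1 - k\<close>.\<close>

definition YI :: "sd \<Rightarrow> real" where "YI A = N + real (grid_y I A)"
definition YJ :: "sd \<Rightarrow> real" where "YJ B = N + 1 - real (grid_y J B)"

lemma XJ_partner: "A \<in> sd_set I \<Longrightarrow> XJ (partner A) = XI A"
  using partner(2) by (simp add: grid_x_def)

lemma gyI: "A \<in> sd_set I \<Longrightarrow> 1 \<le> grid_y I A" "A \<in> sd_set I \<Longrightarrow> grid_y I A \<le> length I"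
  using I.grid_y_ge_1 I.grid_y_le_n by blast+

lemma gyJ: "B \<in> sd_set J \<Longrightarrow> 1 \<le> grid_y J B" "B \<in> sd_set J \<Longrightarrow> grid_y J B \<le> length I"
  using J.grid_y_ge_1 J.grid_y_le_n length_eq by auto

lemma YJ_nat: "B \<in> sd_set J \<Longrightarrow> YJ B = real (length I + 1 - grid_y J B)"
  using gyJ(2)[of B] by (simp add: YJ_def of_nat_diff)

lemma Y_roots: "YI sd_root = N + N" "YJ sd_root = 1"
  using I.grid_y_root J.grid_y_root length_eq by (simp_all add: YI_def YJ_def)

definition columns :: polygon where
  "columns = (\<Union>A\<in>sd_set I. {dseg (sd_positive A) (XI A, YJ (partner A), 0) (XI A, YI A, 0)}) \<union>
     {dseg False (1, 1, 0) (1, N + N, 0)}"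

text \<open>In the lower half the symbols are exchanged, so negative intervals give an
  \<open>X\<close> and the additional \<open>O\<close> of the top row becomes the \<open>X\<close>
  at \<open>(1, 1)\<close>.\<close>

definition Xs :: "(nat \<times> nat) set" where
  "Xs = {(grid_x I A, grid_y I A + length I) | A. A \<in> sd_set I \<and> sd_positive A} \<union>
     {(grid_x J B, length I + 1 - grid_y J B) | B. B \<in> sd_set J \<and> \<not> sd_positive B} \<union> {(1, 1)}"

definition Os :: "(nat \<times> nat) set" where
  "Os = {(grid_x I A, grid_y I A + length I) | A. A \<in> sd_set I \<and> \<not> sd_positive A} \<union>
     {(grid_x J B, length I + 1 - grid_y J B) | B. B \<in> sd_set J \<and> sd_positive B} \<union>
     {(1, length I + length I)}"

lemma pair_grid_eq: "pair_grid I J = (Xs, Os)"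
proof -
  have F: "F ` {G A | A. P A} = {F (G A) | A. P A}"
    for F :: "nat \<times> nat \<Rightarrow> nat \<times> nat" and G and P :: "sd \<Rightarrow> bool" by blast
  have "length I + 1 - length I = 1" by simp
  then show ?thesis
    unfolding pair_grid_def half_grid_def flip_half_grid_def stack_grids_def Xs_def Os_def length_eq
      case_prod_conv image_insert F
    by (simp only: Un_insert_left Un_insert_right Un_empty_right)
qed

lemma Xs_cases:
  assumes "(x, y) \<in> Xs"
  obtains A where "A \<in> sd_set I" "sd_positive A" "x = grid_x I A" "y = grid_y I A + length I"
  | B where "B \<in> sd_set J" "\<not> sd_positive B" "x = grid_x J B" "y = length I + 1 - grid_y J B"
  | "x = 1" "y = 1"
  using assms unfolding Xs_def by blast

lemma Os_cases:
  assumes "(x, y) \<in> Os"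
  obtains A where "A \<in> sd_set I" "\<not> sd_positive A" "x = grid_x I A" "y = grid_y I A + length I"
  | B where "B \<in> sd_set J" "sd_positive B" "x = grid_x J B" "y = length I + 1 - grid_y J B"
  | "x = 1" "y = length I + length I"
  using assms unfolding Os_def by blast

lemma Xs_I: "A \<in> sd_set I \<Longrightarrow> sd_positive A \<Longrightarrow> (grid_x I A, grid_y I A + length I) \<in> Xs"
  and Xs_J: "B \<in> sd_set J \<Longrightarrow> \<not> sd_positive B \<Longrightarrow> (grid_x J B, length I + 1 - grid_y J B) \<in> Xs"
  and Xs_1: "(1, 1) \<in> Xs"
  and Os_I: "A \<in> sd_set I \<Longrightarrow> \<not> sd_positive A \<Longrightarrow> (grid_x I A, grid_y I A + length I) \<in> Os"
  and Os_J: "B \<in> sd_set J \<Longrightarrow> sd_positive B \<Longrightarrow> (grid_x J B, length I + 1 - grid_y J B) \<in> Os"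
  and Os_1: "(1, length I + length I) \<in> Os"
  unfolding Xs_def Os_def by blast+

lemma point_I: "grid_point (grid_x I A) (grid_y I A + length I) z = (XI A, YI A, z)"
  by (simp add: grid_point_def YI_def)

lemma point_J: "B \<in> sd_set J \<Longrightarrow> grid_point (grid_x J B) (length I + 1 - grid_y J B) z = (XJ B, YJ B, z)"
  by (simp add: grid_point_def YJ_nat)

lemma point_1: "grid_point 1 1 z = (1, YJ sd_root, z)" "grid_point 1 (length I + length I) z = (1,
    YI sd_root, z)"
  by (simp_all add: grid_point_def Y_roots)

lemma conj_I:
  assumes "A \<in> sd_set I" "A \<noteq> sd_root"
  shows "sd_conjugate A \<in> sd_set I" "sd_positive (sd_conjugate A) \<longleftrightarrow> \<not> sd_positive A"
    "grid_y I (sd_conjugate A) = grid_y I A"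
  using assms I.fst_pos_iff I.conjugate_in_sd_set sd_positive_conjugate I.grid_y_conjugate by blast+

lemma conj_J:
  assumes "B \<in> sd_set J" "B \<noteq> sd_root"
  shows "sd_conjugate B \<in> sd_set J" "sd_positive (sd_conjugate B) \<longleftrightarrow> \<not> sd_positive B"
    "grid_y J (sd_conjugate B) = grid_y J B"
  using assms J.fst_pos_iff J.conjugate_in_sd_set sd_positive_conjugate J.grid_y_conjugate by blast+

text \<open>Upper rows are numbered above \<open>N\<close> and lower ones at most \<open>N\<close>,
  so the \<open>X\<close> and \<open>O\<close> of a row come from the same half. They then belong to
  conjugate intervals, or to the root and the additional column. In the lower half the direction is
  reversed.\<close>

lemma rows_eq:
  "{(grid_point x y 1, grid_point x' y 1) | x x' y. (x, y) \<in> Xs \<and> (x', y) \<in> Os} =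
     half_rows I XI 1 YI \<union> prod.swap ` half_rows J XJ 1 YJ"
proof (intro equalityI subsetI)
  fix e assume "e \<in> {(grid_point x y 1, grid_point x' y 1) | x x' y. (x, y) \<in> Xs \<and> (x', y) \<in> Os}"
  then obtain x x' y where X: "(x, y) \<in> Xs" and O: "(x', y) \<in> Os"
    and e: "e = (grid_point x y 1, grid_point x' y 1)" by blast
  from X show "e \<in> half_rows I XI 1 YI \<union> prod.swap ` half_rows J XJ 1 YJ"
  proof (cases rule: Xs_cases)
    case (1 A)
    from O show ?thesis
    proof (cases rule: Os_cases)
      case A': (1 A')
      then have "grid_y I A = grid_y I A'" using 1 by simp
      then have "A' = A \<or> A' = sd_conjugate A" using I.grid_y_eqD 1 A' by blast
      then have A'A: "A' = sd_conjugate A" using 1 A' by auto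
      have nr: "A \<noteq> sd_root"
      proof
        assume "A = sd_root"
        then have "grid_y I A' = length I" using \<open>grid_y I A = grid_y I A'\<close> I.grid_y_root by simp
        then have "A' = sd_root" using I.grid_y_less_n[OF A'(1)] by (metis less_irrefl)
        then show False using A'(2) by simp
      qed
      have "e = dseg True (XI A, YI A, 1) (XI (sd_conjugate A), YI A, 1)"
        unfolding e 1 A'(3) A'A[symmetric] point_I by (simp add: dseg_def grid_point_def YI_def)
      then show ?thesis using 1 nr unfolding half_rows_def by blast
    next
      case (2 B)
      then show ?thesis using 1 gyI[of A] gyJ[of B] by simp
    next
      case 3
      then have "A = sd_root" using 1 I.grid_y_less_n[of A] by auto
      then have "e = dseg True (XI sd_root, YI sd_root, 1) (1, YI sd_root, 1)"
        unfolding e 1(3) 3 using point_1(2) I.grid_y_root by (simp add: dseg_def grid_point_def Y_roots)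
      then show ?thesis unfolding half_rows_def by blast
    qed
  next
    case (2 B)
    from O show ?thesis
    proof (cases rule: Os_cases)
      case (1 A)
      then show ?thesis using 2 gyI[of A] gyJ[of B] by simp
    next
      case B': (2 B')
      then have eq: "grid_y J B' = grid_y J B" using 2 gyJ[of B] gyJ[of B'] by simp
      then have "B = B' \<or> B = sd_conjugate B'" using J.grid_y_eqD 2 B' by blast
      then have BB': "B = sd_conjugate B'" using 2 B' by auto
      have nr: "B' \<noteq> sd_root"
      proof
        assume "B' = sd_root"
        then have "grid_y J B = length J" using eq J.grid_y_root by simp
        then have "B = sd_root" using J.grid_y_less_n[OF 2(1)] by (metis less_irrefl)
        then show False using 2(2) by simp
      qed
      have "e = (grid_point (grid_x J B) y 1, grid_point (grid_x J B') y 1)" unfolding e 2(3) B'(3) ..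
      also have "\<dots> = prod.swap (dseg True (XJ B', YJ B', 1) (XJ (sd_conjugate B'), YJ B', 1))"
        using point_J[OF B'(1), of 1] unfolding BB' B'(4) by (simp add: dseg_def grid_point_def)
      finally show ?thesis using B' nr unfolding half_rows_def by blast
    next
      case 3
      then show ?thesis using 2 gyJ[of B] by simp
    qed
  next
    case 3
    from O show ?thesis
    proof (cases rule: Os_cases)
      case (1 A)
      then show ?thesis using 3 gyI[of A] I.n_pos by simp
    next
      case (2 B)
      then have "grid_y J B = length J" using 3 gyJ[of B] length_eq by simp
      then have B: "B = sd_root" using J.grid_y_less_n[OF 2(1)] by (metis less_irrefl)
      have "e = (grid_point 1 1 1, grid_point (grid_x J sd_root) 1 1)" unfolding e 3 2(3) B ..
      also have "\<dots> = prod.swap (dseg True (XJ sd_root, YJ sd_root, 1) (1, YJ sd_root, 1))"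
        by (simp add: dseg_def grid_point_def Y_roots)
      finally show ?thesis unfolding half_rows_def by blast
    next
      case O3: 3
      then show ?thesis using 3 I.n_pos by simp
    qed
  qed
next
  fix e assume "e \<in> half_rows I XI 1 YI \<union> prod.swap ` half_rows J XJ 1 YJ"
  then consider
    A where "A \<in> sd_set I" "sd_positive A" "A \<noteq> sd_root" "e = dseg True (XI A, YI A, 1) (XI
        (sd_conjugate A), YI A, 1)"
    | "e = dseg True (XI sd_root, YI sd_root, 1) (1, YI sd_root, 1)"
    | B where "B \<in> sd_set J" "sd_positive B" "B \<noteq> sd_root"
       "e = prod.swap (dseg True (XJ B, YJ B, 1) (XJ (sd_conjugate B), YJ B, 1))"
    | "e = prod.swap (dseg True (XJ sd_root, YJ sd_root, 1) (1, YJ sd_root, 1))"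
    unfolding half_rows_def by blast
  then have "\<exists>x x' y. e = (grid_point x y 1, grid_point x' y 1) \<and> (x, y) \<in> Xs \<and> (x', y) \<in> Os"
  proof cases
    case 1
    have "(grid_x I (sd_conjugate A), grid_y I A + length I) \<in> Os"
      using Os_I[of "sd_conjugate A"] conj_I[OF 1(1,3)] 1(2) by simp
    moreover have "e = (grid_point (grid_x I A) (grid_y I A + length I) 1,
        grid_point (grid_x I (sd_conjugate A)) (grid_y I A + length I) 1)"
      using 1(4) by (simp add: dseg_def grid_point_def YI_def)
    ultimately show ?thesis using Xs_I[OF 1(1,2)] by metis
  next
    case 2
    have "(grid_x I sd_root, length I + length I) \<in> Xs"
      using Xs_I[OF I.root_in_sd_set] I.grid_y_root by simp
    moreover have "e = (grid_point (grid_x I sd_root) (length I + length I) 1, grid_point 1 (length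
        I + length I) 1)"
      using 2 by (simp add: dseg_def grid_point_def Y_roots)
    ultimately show ?thesis using Os_1 by metis
  next
    case 3
    have "(grid_x J (sd_conjugate B), length I + 1 - grid_y J B) \<in> Xs"
      using Xs_J[of "sd_conjugate B"] conj_J[OF 3(1,3)] 3(2) by simp
    moreover have "e = (grid_point (grid_x J (sd_conjugate B)) (length I + 1 - grid_y J B) 1,
        grid_point (grid_x J B) (length I + 1 - grid_y J B) 1)"
      using 3(4) by (simp add: dseg_def grid_point_def YJ_nat[OF 3(1)])
    ultimately show ?thesis using Os_J[OF 3(1,2)] by metis
  next
    case 4
    have "(grid_x J sd_root, 1) \<in> Os"
      using Os_J[OF J.root_in_sd_set] J.grid_y_root length_eq by simp
    moreover have "e = (grid_point 1 1 1, grid_point (grid_x J sd_root) 1 1)"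
      using 4 by (simp add: dseg_def grid_point_def Y_roots)
    ultimately show ?thesis using Xs_1 by metis
  qed
  then show "e \<in> {(grid_point x y 1, grid_point x' y 1) | x x' y. (x, y) \<in> Xs \<and> (x', y) \<in> Os}" by blast
qed

lemma legs_eq:
  "{(grid_point x y 0, grid_point x y 1) | x y. (x, y) \<in> Xs} \<union>
     {(grid_point x y 1, grid_point x y 0) | x y. (x, y) \<in> Os} =
     half_legs I XI 1 YI \<union> prod.swap ` half_legs J XJ 1 YJ"
proof (intro equalityI subsetI)
  fix e assume "e \<in> {(grid_point x y 0, grid_point x y 1) | x y. (x, y) \<in> Xs} \<union>
     {(grid_point x y 1, grid_point x y 0) | x y. (x, y) \<in> Os}"
  then consider x y where "(x, y) \<in> Xs" "e = (grid_point x y 0, grid_point x y 1)"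
    | x y where "(x, y) \<in> Os" "e = (grid_point x y 1, grid_point x y 0)" by blast
  then show "e \<in> half_legs I XI 1 YI \<union> prod.swap ` half_legs J XJ 1 YJ"
  proof cases
    case 1
    from 1(1) show ?thesis
    proof (cases rule: Xs_cases)
      case A: (1 A)
      then have "e = dseg (sd_positive A) (XI A, YI A, 0) (XI A, YI A, 1)"
        using 1(2) by (simp add: dseg_def point_I)
      then show ?thesis using A unfolding half_legs_def by blast
    next
      case B: (2 B)
      have "e = prod.swap (dseg (sd_positive B) (XJ B, YJ B, 0) (XJ B, YJ B, 1))"
        unfolding 1(2) B(3,4) point_J[OF B(1)] swap_dseg by (simp add: dseg_def B(2))
      then show ?thesis using B unfolding half_legs_def by blast
    next
      case 3
      have "e = prod.swap (dseg True (1, YJ sd_root, 1) (1, YJ sd_root, 0))"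
        unfolding 1(2) 3 point_1 swap_dseg by (simp add: dseg_def)
      then show ?thesis unfolding half_legs_def by blast
    qed
  next
    case 2
    from 2(1) show ?thesis
    proof (cases rule: Os_cases)
      case A: (1 A)
      then have "e = dseg (sd_positive A) (XI A, YI A, 0) (XI A, YI A, 1)"
        using 2(2) by (simp add: dseg_def point_I)
      then show ?thesis using A unfolding half_legs_def by blast
    next
      case B: (2 B)
      have "e = prod.swap (dseg (sd_positive B) (XJ B, YJ B, 0) (XJ B, YJ B, 1))"
        unfolding 2(2) B(3,4) point_J[OF B(1)] swap_dseg by (simp add: dseg_def B(2))
      then show ?thesis using B unfolding half_legs_def by blast
    next
      case 3
      have "e = dseg True (1, YI sd_root, 1) (1, YI sd_root, 0)"
        unfolding 2(2) 3 point_1 by (simp add: dseg_def)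
      then show ?thesis unfolding half_legs_def by blast
    qed
  qed
next
  fix e assume "e \<in> half_legs I XI 1 YI \<union> prod.swap ` half_legs J XJ 1 YJ"
  then consider A where "A \<in> sd_set I" "e = dseg (sd_positive A) (XI A, YI A, 0) (XI A, YI A, 1)"
    | "e = dseg True (1, YI sd_root, 1) (1, YI sd_root, 0)"
    | B where "B \<in> sd_set J" "e = prod.swap (dseg (sd_positive B) (XJ B, YJ B, 0) (XJ B, YJ B, 1))"
    | "e = prod.swap (dseg True (1, YJ sd_root, 1) (1, YJ sd_root, 0))"
    unfolding half_legs_def by blast
  then have "(\<exists>x y. e = (grid_point x y 0, grid_point x y 1) \<and> (x, y) \<in> Xs) \<or>
     (\<exists>x y. e = (grid_point x y 1, grid_point x y 0) \<and> (x, y) \<in> Os)"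
  proof cases
    case 1
    then show ?thesis
      using Xs_I[OF 1(1)] Os_I[OF 1(1)] point_I[of A] unfolding dseg_def by (cases "sd_positive A")
          metis+
  next
    case 2
    then show ?thesis using Os_1 point_1(2) unfolding dseg_def by metis
  next
    case 3
    then show ?thesis
    proof (cases "sd_positive B")
      case True
      then have "e = (grid_point (grid_x J B) (length I + 1 - grid_y J B) 1, grid_point (grid_x J B)
          (length I + 1 - grid_y J B) 0)"
        unfolding 3(2) swap_dseg point_J[OF 3(1)] by (simp add: dseg_def)
      then show ?thesis using Os_J[OF 3(1) True] by blast
    next
      case False
      then have "e = (grid_point (grid_x J B) (length I + 1 - grid_y J B) 0, grid_point (grid_x J B)
          (length I + 1 - grid_y J B) 1)"
        unfolding 3(2) swap_dseg point_J[OF 3(1)] by (simp add: dseg_def)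
      then show ?thesis using Xs_J[OF 3(1) False] by blast
    qed
  next
    case 4
    then have "e = (grid_point 1 1 0, grid_point 1 1 1)"
      unfolding 4 swap_dseg point_1 by (simp add: dseg_def)
    then show ?thesis using Xs_1 by blast
  qed
  then show "e \<in> {(grid_point x y 0, grid_point x y 1) | x y. (x, y) \<in> Xs} \<union>
     {(grid_point x y 1, grid_point x y 0) | x y. (x, y) \<in> Os}" by blast
qed

text \<open>Two markings in one column with different symbols cannot come from the same half, since
  a column determines its interval there; so they belong to an interval and its partner, or both to
  the additional column.\<close>

lemma columns_eq:
  "{(grid_point x y 0, grid_point x y' 0) | x y y'. (x, y) \<in> Os \<and> (x, y') \<in> Xs} = columns"
proof (intro equalityI subsetI)
  fix e assume "e \<in> {(grid_point x y 0, grid_point x y' 0) | x y y'. (x, y) \<in> Os \<and> (x, y') \<in> Xs}"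
  then obtain x y y' where O: "(x, y) \<in> Os" and X: "(x, y') \<in> Xs"
    and e: "e = (grid_point x y 0, grid_point x y' 0)" by blast
  have mem: "e \<in> columns" if "A \<in> sd_set I"
    "e = dseg (sd_positive A) (XI A, YJ (partner A), 0) (XI A, YI A, 0)" for A
    using that unfolding columns_def by blast
  from X show "e \<in> columns"
  proof (cases rule: Xs_cases)
    case (1 A)
    from O show ?thesis
    proof (cases rule: Os_cases)
      case A': (1 A')
      then have "A = A'" using 1 I.mid_rank_inj[of A A'] by (simp add: grid_x_def)
      then show ?thesis using 1 A' by simp
    next
      case (2 B)
      then have B: "B = partner A" using 1 partner_eqI[of A B] by (simp add: grid_x_def)
      have p: "grid_point x y 0 = (XJ B, YJ B, 0)" "grid_point x y' 0 = (XI A, YI A, 0)"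
        using point_J[OF 2(1)] point_I[of A] 1 2 by simp_all
      then have "e = dseg (sd_positive A) (XI A, YJ (partner A), 0) (XI A, YI A, 0)"
        unfolding e p using B XJ_partner[OF 1(1)] 1(2) by (simp add: dseg_def)
      then show ?thesis using mem 1(1) by blast
    next
      case 3
      then show ?thesis using 1 I.grid_x_ge_2[of A] by simp
    qed
  next
    case (2 B)
    from O show ?thesis
    proof (cases rule: Os_cases)
      case (1 A)
      then have B: "B = partner A" using 2 partner_eqI[of A B] by (simp add: grid_x_def)
      have p: "grid_point x y' 0 = (XJ B, YJ B, 0)" "grid_point x y 0 = (XI A, YI A, 0)"
        using point_J[OF 2(1)] point_I[of A] 1 2 by simp_all
      then have "e = dseg (sd_positive A) (XI A, YJ (partner A), 0) (XI A, YI A, 0)"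
        unfolding e p using B XJ_partner[OF 1(1)] 1(2) by (simp add: dseg_def)
      then show ?thesis using mem 1(1) by blast
    next
      case B': (2 B')
      then have "B = B'" using 2 J.mid_rank_inj[of B B'] by (simp add: grid_x_def)
      then show ?thesis using 2 B' by simp
    next
      case 3
      then show ?thesis using 2 J.grid_x_ge_2[of B] by simp
    qed
  next
    case 3
    from O show ?thesis
    proof (cases rule: Os_cases)
      case (1 A)
      then show ?thesis using 3 I.grid_x_ge_2[of A] by simp
    next
      case (2 B)
      then show ?thesis using 3 J.grid_x_ge_2[of B] by simp
    next
      case O3: 3
      then have "e = dseg False (1, 1, 0) (1, N + N, 0)"
        using 3 e by (simp add: dseg_def grid_point_def)
      then show ?thesis unfolding columns_def by blast
    qed
  qed
next
  fix e assume "e \<in> columns"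
  then consider A where "A \<in> sd_set I" "e = dseg (sd_positive A) (XI A, YJ (partner A), 0) (XI A, YI
      A, 0)"
    | "e = dseg False (1, 1, 0) (1, N + N, 0)" unfolding columns_def by blast
  then have "\<exists>x y y'. e = (grid_point x y 0, grid_point x y' 0) \<and> (x, y) \<in> Os \<and> (x, y') \<in> Xs"
  proof cases
    case 1
    note B = partner[OF 1(1)]
    have x: "grid_x J (partner A) = grid_x I A" using B(2) by (simp add: grid_x_def)
    have pI: "(XI A, YI A, 0) = grid_point (grid_x I A) (grid_y I A + length I) 0" by (rule
        point_I[symmetric])
    have pJ: "(XI A, YJ (partner A), 0) = grid_point (grid_x I A) (length I + 1 - grid_y J (partner
        A)) 0"
      using point_J[OF B(1), of 0] x by simp
    show ?thesis
    proof (cases "sd_positive A")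
      case True
      then have "e = (grid_point (grid_x I A) (length I + 1 - grid_y J (partner A)) 0,
          grid_point (grid_x I A) (grid_y I A + length I) 0)"
        using 1(2) unfolding pI pJ by (simp add: dseg_def)
      then show ?thesis using Xs_I[OF 1(1) True] Os_J[OF B(1)] B(3) True x by metis
    next
      case False
      then have "e = (grid_point (grid_x I A) (grid_y I A + length I) 0,
          grid_point (grid_x I A) (length I + 1 - grid_y J (partner A)) 0)"
        using 1(2) unfolding pI pJ by (simp add: dseg_def)
      then show ?thesis using Os_I[OF 1(1) False] Xs_J[OF B(1)] B(3) False x by metis
    qed
  next
    case 2
    then have "e = (grid_point 1 (length I + length I) 0, grid_point 1 1 0)"
      by (simp add: dseg_def grid_point_def)
    then show ?thesis using Os_1 Xs_1 by metis
  qed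
  then show "e \<in> {(grid_point x y 0, grid_point x y' 0) | x y y'. (x, y) \<in> Os \<and> (x, y') \<in> Xs}" by blast
qed

lemma grid_link_eq:
  "grid_link (pair_grid I J) = columns \<union> (half_legs I XI 1 YI \<union> prod.swap ` half_legs J XJ 1 YJ) \<union>
     (half_rows I XI 1 YI \<union> prod.swap ` half_rows J XJ 1 YJ)"
  unfolding pair_grid_eq grid_link_def case_prod_conv columns_eq rows_eq legs_eq[symmetric]
  by (simp only: Un_ac)

end

section \<open>Supports, vertical bounds and the horizontal stretching of the columns\<close>

lemma support_Un: "support (E \<union> F) = support E \<union> support F"
  unfolding support_def by blast

lemma support_UN: "support (\<Union>i\<in>S. E i) = (\<Union>i\<in>S. support (E i))"
  unfolding support_def by blast

lemma support_dseg: "support {dseg s P Q} = closed_segment P Q"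
  by (cases s) (simp_all add: support_def dseg_def closed_segment_commute)

lemma support_reversed_mirror: "support (reversed_mirror E) = flip_point ` support E"
proof -
  have "support (reversed_mirror E) = (\<Union>e\<in>E. closed_segment (flip_point (snd e)) (flip_point (fst e)))"
    unfolding support_def reversed_mirror_eq by (simp add: case_prod_beta')
  also have "\<dots> = (\<Union>e\<in>E. flip_point ` closed_segment (fst e) (snd e))"
    by (simp only: flip_point_segment closed_segment_commute)
  also have "\<dots> = flip_point ` support E"
    unfolding support_def case_prod_beta' by (simp only: image_UN)
  finally show ?thesis .
qed

lemma segment_y_bounds:
  fixes x y x' y' :: real
  assumes "p \<in> closed_segment (x, y, z) (x', y', z' :: real)" "a \<le> y" "a \<le> y'" "y \<le> b" "y' \<le> b"
  shows "a \<le> fst (snd p)" "fst (snd p) \<le> b"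
proof -
  obtain u where u: "0 \<le> u" "u \<le> 1" "fst (snd p) = y + u * (y' - y)"
    using assms(1) by (auto simp: closed_segment_triple)
  then have "fst (snd p) \<in> closed_segment y y'" using real_segment by blast
  moreover have "closed_segment y y' \<subseteq> {a..b}"
    using assms by (intro closed_segment_subset) auto
  ultimately show "a \<le> fst (snd p)" "fst (snd p) \<le> b" by auto
qed

lemma subdivides_three:
  assumes "y0 < y1" "y1 < y2" "y2 < y3"
  shows "subdivides ({dseg s (x, y0, z) (x, y1, z)} \<union> {dseg s (x, y1, z) (x, y2, z)} \<union>
    {dseg s (x, y2, z) (x, y3, z)}) {dseg s (x, y0, z) (x, y3, z)}"
proof -
  have split: "subdivides {dseg s (x, a, z) (x, b, z), dseg s (x, b, z) (x, c, z)} {dseg s (x, a, z)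
      (x, c, z)}"
    if "a < b" "b < c" for a b c
    by (rule subdivides_dseg[where t = "(b - a) / (c - a)"]) (use that in \<open>auto simp: field_simps\<close>)
  have "subdivides ({dseg s (x, y0, z) (x, y1, z), dseg s (x, y1, z) (x, y2, z)} \<union> {dseg s (x, y2,
      z) (x, y3, z)})
      ({dseg s (x, y0, z) (x, y2, z)} \<union> {dseg s (x, y2, z) (x, y3, z)})"
    using split[OF assms(1,2)] by (intro subdivides_Un) (simp_all add: subdivides_refl)
  moreover have "subdivides ({dseg s (x, y0, z) (x, y2, z)} \<union> {dseg s (x, y2, z) (x, y3, z)})
      {dseg s (x, y0, z) (x, y3, z)}"
    using split[of y0 y2 y3] assms by (simp add: insert_commute)
  ultimately have "subdivides ({dseg s (x, y0, z) (x, y1, z), dseg s (x, y1, z) (x, y2, z)} \<union> {dseg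
      s (x, y2, z) (x, y3, z)})
      {dseg s (x, y0, z) (x, y3, z)}" by (rule subdivides_trans)
  then show ?thesis by (simp add: insert_commute)
qed

context dyadic_partition
begin

lemma half_link_cong:
  assumes "\<And>A. A \<in> sd_set I \<Longrightarrow> X A = X' A" "\<And>A. A \<in> sd_set I \<Longrightarrow> Y A = Y' A"
  shows "half_link I X x0 Y b = half_link I X' x0 Y' b"
proof -
  have P: "X (sd_parent A) = X' (sd_parent A)" if "A \<in> sd_set I" "A \<noteq> sd_root" for A
    using assms(1) parent_in_sd_set fst_pos_iff that by blast
  show ?thesis
    unfolding half_link_def
    using assms P root_in_sd_set by (intro arg_cong2[where f = "(\<union>)"] SUP_cong refl) simp_all
qed

lemma support_half_link:
  assumes "p \<in> support (half_link I X x0 Y 0)" "\<And>A. A \<in> sd_set I \<Longrightarrow> 0 \<le> Y A"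
  shows "0 \<le> fst (snd p)"
proof -
  have Y0: "0 \<le> Y sd_root" using assms(2) root_in_sd_set by blast
  have bound: "0 \<le> fst (snd p)" if "p \<in> closed_segment (x, y, z) (x', y', z')" "0 \<le> y" "0 \<le> y'"
    for x y z x' y' z'
    using segment_y_bounds(1)[OF that, of "max y y'"] by simp
  from assms(1) show ?thesis
    unfolding half_link_def support_Un support_UN support_dseg
    using bound assms(2) Y0 by (elim UnE UN_E) (blast intro: order_refl)+
qed

text \<open>Columns are ordered like midpoints. The additional column, to the left of all others,
  may go to \<open>- 1\<close> because every midpoint is positive.\<close>

lemma column_map:
  obtains \<phi> :: "real \<Rightarrow> real" and m :: real where
    "m > 0" "continuous_on UNIV \<phi>" "\<And>x s. s \<ge> 0 \<Longrightarrow> \<phi> (x + s) \<ge> \<phi> x + m * s"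
    "\<phi> 1 = - 1" "\<And>A. A \<in> sd_set I \<Longrightarrow> \<phi> (real (grid_x I A)) = mid A"
proof -
  define K where "K = insert None (Some ` sd_set I)"
  define r where "r = (\<lambda>a. case a of None \<Rightarrow> 1 | Some A \<Rightarrow> real (grid_x I A))"
  define v where "v = (\<lambda>a. case a of None \<Rightarrow> - 1 | Some A \<Rightarrow> mid A)"
  have K: "finite K" "K \<noteq> {}" using finite_sd_set by (auto simp: K_def)
  have order: "r j < r i \<and> v j < v i" if i: "i \<in> K" and j: "j \<in> K" and neq: "i \<noteq> j" and le: "r j \<le> r
      i" for i j
  proof (cases i)
    case None
    then obtain B where B: "j = Some B" using neq by (cases j) simp_all
    then have "B \<in> sd_set I" using j by (auto simp: K_def)
    then show ?thesis using grid_x_ge_2[of B] le None B by (simp add: r_def)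
  next
    case (Some A)
    then have A: "A \<in> sd_set I" using i by (auto simp: K_def)
    show ?thesis
    proof (cases j)
      case None
      have "0 < mid A" using lo_range[OF is_sd_sd_set[OF A]] len_pos[of A] by (simp add: mid_eq)
      then show ?thesis using grid_x_ge_2[OF A] Some None by (simp add: r_def v_def)
    next
      case B: (Some B)
      then have BS: "B \<in> sd_set I" using j by (auto simp: K_def)
      have "mid_rank I B \<le> mid_rank I A" using le Some B by (simp add: r_def grid_x_def)
      moreover have "mid_rank I B \<noteq> mid_rank I A" using mid_rank_inj[OF A BS] neq Some B by auto
      ultimately have "mid_rank I B < mid_rank I A" by simp
      then show ?thesis using mid_rank_less_iff[OF BS A] Some B by (simp add: r_def v_def grid_x_def)
    qed
  qed
  show thesis
  proof (rule monotone_interpolation[OF K order])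
    fix \<phi> m assume \<phi>: "m > 0" "continuous_on UNIV \<phi>" "\<And>x s. s \<ge> 0 \<Longrightarrow> \<phi> (x + s) \<ge> \<phi> x + m * s"
      "\<And>i. i \<in> K \<Longrightarrow> \<phi> (r i) = v i"
    show thesis
    proof (rule that[OF \<phi>(1-3)])
      show "\<phi> 1 = - 1" using \<phi>(4)[of None] by (simp add: K_def r_def v_def)
      show "\<phi> (real (grid_x I A)) = mid A" if "A \<in> sd_set I" for A
        using \<phi>(4)[of "Some A"] that by (simp add: K_def r_def v_def)
    qed
  qed
qed

end

section \<open>Assembling the two halves and the joining strands\<close>

context compatible_partitions
begin

text \<open>The pieces of the columns in the empty strip between the lower rows, at most
  \<open>N\<close>, and the upper rows, at least \<open>N + 1\<close>. They become the joining
  strands.\<close>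

definition joints :: polygon where
  "joints = (\<Union>A\<in>sd_set I. {dseg (sd_positive A) (XI A, N + 1 / 3, 0) (XI A, N + 2 / 3, 0)}) \<union>
     {dseg False (1, N + 1 / 3, 0) (1, N + 2 / 3, 0)}"

definition divided_grid_link :: polygon where
  "divided_grid_link = half_link I XI 1 YI (N + 2 / 3) \<union> joints \<union> prod.swap ` half_link J XJ 1 YJ (N
      + 1 / 3)"

lemma YI_ge: "A \<in> sd_set I \<Longrightarrow> YI A \<ge> N + 1"
  using gyI(1)[of A] by (simp add: YI_def)

lemma YJ_le: "B \<in> sd_set J \<Longrightarrow> YJ B \<le> N"
  using gyJ(1)[of B] by (simp add: YJ_def)

lemma columns_subdivides:
  "subdivides (half_columns I XI 1 YI (N + 2 / 3) \<union> joints \<union> prod.swap ` half_columns J XJ 1 YJ (N +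
      1 / 3)) columns"
proof -
  \<comment> \<open>The lower columns are reindexed by the intervals of \<open>I\<close> through
    \<open>partner\<close>, so that the three pieces of each column can be put together.\<close>
  have lower: "prod.swap ` half_columns J XJ 1 YJ (N + 1 / 3) =
      (\<Union>A\<in>sd_set I. {dseg (sd_positive A) (XI A, YJ (partner A), 0) (XI A, N + 1 / 3, 0)}) \<union>
      {dseg False (1, 1, 0) (1, N + 1 / 3, 0)}"
  proof -
    have "dseg (\<not> sd_positive (partner A)) (XJ (partner A), N + 1 / 3, 0) (XJ (partner A), YJ
        (partner A), 0) =
        dseg (sd_positive A) (XI A, YJ (partner A), 0) (XI A, N + 1 / 3, 0)" if "A \<in> sd_set I" for A
      using partner[OF that] XJ_partner[OF that] by (simp add: dseg_flip)
    then show ?thesis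
      unfolding half_columns_def image_Un image_UN image_insert image_empty swap_dseg Y_roots
        partner_image[symmetric] image_image
      by (intro arg_cong2[where f = "(\<union>)"]) simp_all
  qed
  have upper: "half_columns I XI 1 YI (N + 2 / 3) =
      (\<Union>A\<in>sd_set I. {dseg (sd_positive A) (XI A, N + 2 / 3, 0) (XI A, YI A, 0)}) \<union>
      {dseg False (1, N + 2 / 3, 0) (1, N + N, 0)}"
    unfolding half_columns_def Y_roots by (simp add: dseg_def)
  have eq: "half_columns I XI 1 YI (N + 2 / 3) \<union> joints \<union> prod.swap ` half_columns J XJ 1 YJ (N + 1
      / 3) =
      (\<Union>A\<in>sd_set I. {dseg (sd_positive A) (XI A, YJ (partner A), 0) (XI A, N + 1 / 3, 0)} \<union>
         {dseg (sd_positive A) (XI A, N + 1 / 3, 0) (XI A, N + 2 / 3, 0)} \<union>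
         {dseg (sd_positive A) (XI A, N + 2 / 3, 0) (XI A, YI A, 0)}) \<union>
      ({dseg False (1, 1, 0) (1, N + 1 / 3, 0)} \<union> {dseg False (1, N + 1 / 3, 0) (1, N + 2 / 3, 0)} \<union>
       {dseg False (1, N + 2 / 3, 0) (1, N + N, 0)})"
    unfolding lower upper joints_def UN_Un_distrib by (simp only: Un_ac)
  have "N \<ge> 1" using gyI[OF I.root_in_sd_set] by simp
  show ?thesis
    unfolding eq columns_def
  proof (intro subdivides_Un subdivides_UN subdivides_three I.finite_sd_set)
    fix A assume A: "A \<in> sd_set I"
    show "YJ (partner A) < N + 1 / 3" using YJ_le[OF partner(1)[OF A]] by simp
    show "N + 2 / 3 < YI A" using YI_ge[OF A] by simp
  qed (use \<open>N \<ge> 1\<close> in simp_all)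
qed

lemma divided_grid_link_subdivides: "subdivides divided_grid_link (grid_link (pair_grid I J))"
proof -
  have rI: "subdivides (half_split_rows I XI 1 YI) (half_rows I XI 1 YI)"
    using I.mid_rank_less_iff conj_I(3)
    by (intro I.half_split_rows_subdivides) (simp_all add: grid_x_def YI_def)
  have rJ: "subdivides (half_split_rows J XJ 1 YJ) (half_rows J XJ 1 YJ)"
    using J.mid_rank_less_iff conj_J(3)
    by (intro J.half_split_rows_subdivides) (simp_all add: grid_x_def YJ_def)
  have fin: "finite (half_legs I XI 1 YI)" "finite (half_legs J XJ 1 YJ)"
    unfolding half_legs_def using I.finite_sd_set J.finite_sd_set by simp_all
  have "divided_grid_link =
      (half_columns I XI 1 YI (N + 2 / 3) \<union> joints \<union> prod.swap ` half_columns J XJ 1 YJ (N + 1 / 3)) \<union>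
      (half_legs I XI 1 YI \<union> prod.swap ` half_legs J XJ 1 YJ) \<union>
      (half_split_rows I XI 1 YI \<union> prod.swap ` half_split_rows J XJ 1 YJ)"
    unfolding divided_grid_link_def half_link_eq image_Un by (simp only: Un_ac)
  then show ?thesis
    unfolding grid_link_eq
    using fin rI subdivides_swap[OF rJ]
    by (simp only:) (intro subdivides_Un columns_subdivides; simp add: subdivides_refl)
qed

lemma joining_strands_eq:
  "joining_strands I J = (\<Union>A\<in>sd_set I. {dseg (sd_positive A) (mid (partner A), - 1, 0) (mid A, 0, 0)}) \<union>
     {dseg False (- 1, - 1, 0) (- 1, 0, 0)}"
proof -
  have "(\<Union>B\<in>{B \<in> sd_set J. mid_rank J B = mid_rank I A}.
        polyline (if sd_positive A then [(mid B, -1, 0), (mid A, 0, 0)] else [(mid A, 0, 0), (mid B,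
            -1, 0)])) =
      {dseg (sd_positive A) (mid (partner A), - 1, 0) (mid A, 0, 0)}" if A: "A \<in> sd_set I" for A
  proof -
    have "{B \<in> sd_set J. mid_rank J B = mid_rank I A} = {partner A}"
      using partner_eqI[OF A] partner[OF A] by blast
    then show ?thesis by (simp add: polyline_def dseg_def)
  qed
  then have "joining_strands I J = polyline [(-1, 0, 0), (-1, -1, 0)] \<union>
      (\<Union>A\<in>sd_set I. {dseg (sd_positive A) (mid (partner A), - 1, 0) (mid A, 0, 0)})"
    unfolding joining_strands_def by (intro arg_cong2[where f = "(\<union>)"] SUP_cong refl)
  then show ?thesis by (simp add: polyline_def dseg_def)
qed

text \<open>The shear \<open>S\<close> opens the strip between the halves to height
  \<open>1\<close>. Then \<open>R\<close> moves the columns to midpoints, by different maps for the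
  two partitions above and below the strip, and tilts the joints inside it.\<close>

lemma divided_grid_link_stretch:
  obtains T where "deformation T"
    "carries T divided_grid_link (half_link I mid (- 1) I.row 0 \<union> joining_strands I J \<union>
       reversed_mirror (half_link J mid (- 1) J.row 0))"
proof (rule I.column_map)
  fix \<phi> m assume \<phi>: "m > 0" "continuous_on UNIV \<phi>" "\<And>x s. s \<ge> 0 \<Longrightarrow> \<phi> (x + s) \<ge> \<phi> x + m * s"
    "\<phi> 1 = - 1" "\<And>A. A \<in> sd_set I \<Longrightarrow> \<phi> (XI A) = mid A"
  show thesis
  proof (rule J.column_map)
  fix \<psi> k assume \<psi>: "k > 0" "continuous_on UNIV \<psi>" "\<And>x s. s \<ge> 0 \<Longrightarrow> \<psi> (x + s) \<ge> \<psi> x + k * s"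
    "\<psi> 1 = - 1" "\<And>B. B \<in> sd_set J \<Longrightarrow> \<psi> (XJ B) = mid B"
  have mono_of_slope: "mono f" if "c > 0" "\<And>x s. s \<ge> 0 \<Longrightarrow> f (x + s) \<ge> f x + c * s" for f :: "real \<Rightarrow>
      real" and c
  proof (rule monoI)
    fix x y :: real assume "x \<le> y"
    then have "0 \<le> c * (y - x)" using that(1) by (intro mult_nonneg_nonneg) auto
    then show "f x \<le> f y" using that(2)[of "y - x" x] \<open>x \<le> y\<close> by simp
  qed
  \<comment> \<open>Slope \<open>1\<close> outside \<open>{N..N + 1}\<close> and slope
    \<open>3\<close> inside: upper rows go to their row numbers, lower rows to \<open>- 1\<close>
    minus theirs, and the strip from \<open>N + 1 / 3\<close> to \<open>N + 2 / 3\<close> is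
    stretched to \<open>{- 1..0}\<close>.\<close>
  define \<beta> where "\<beta> = (\<lambda>y. y - N - 1 + max (- 1) (min 1 (2 * (y - N) - 1)))"
  define l :: "real \<Rightarrow> real" where "l = (\<lambda>y. max 0 (min 1 (y + 1)))"
  define S where "S = (\<lambda>(x :: real, y, z :: real). (x, \<beta> y, z))"
  \<comment> \<open>At each height this is a convex combination of two increasing maps of
    \<open>x\<close>; as \<open>l\<close> is linear on the strip, vertical joints stay
    straight.\<close>
  define R where "R = (\<lambda>(x, y, z :: real). ((1 - l y) * \<psi> x + l y * \<phi> x, y, z))"
  have \<beta>_slope: "\<beta> (y + s) \<ge> \<beta> y + 1 * s" if "s \<ge> 0" for y s
    using that by (simp add: \<beta>_def)
  have dS: "deformation S" unfolding S_def
    by (rule deformation_shear_y[where m = 1])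
       (use \<beta>_slope in \<open>auto simp: \<beta>_def case_prod_beta' intro!: continuous_intros\<close>)
  have l01: "0 \<le> l y" "l y \<le> 1" for y by (simp_all add: l_def)
  have dR: "deformation R" unfolding R_def
  proof (rule deformation_shear_x[where m = "min k m"])
    have "continuous_on UNIV (\<lambda>p. \<psi> (fst p))" "continuous_on UNIV (\<lambda>p. \<phi> (fst p))"
      by (rule continuous_on_compose2[OF \<psi>(2)] continuous_on_compose2[OF \<phi>(2)]; simp add:
          continuous_intros)+
    then show "continuous_on UNIV (\<lambda>(x, y, z :: real). (1 - l y) * \<psi> x + l y * \<phi> x)"
      unfolding case_prod_beta' l_def by (intro continuous_intros)
    show "(1 - l y) * \<psi> x + l y * \<phi> x + min k m * s \<le> (1 - l y) * \<psi> (x + s) + l y * \<phi> (x + s)"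
      if s: "s \<ge> 0" for x y s
    proof -
      have "min k m * s \<le> k * s" "min k m * s \<le> m * s" using s by (intro mult_right_mono; simp)+
      then have "\<psi> x + min k m * s \<le> \<psi> (x + s)" "\<phi> x + min k m * s \<le> \<phi> (x + s)"
        using \<phi>(3)[OF s, of x] \<psi>(3)[OF s, of x] by linarith+
      then have "(1 - l y) * (\<psi> x + min k m * s) + l y * (\<phi> x + min k m * s) \<le>
          (1 - l y) * \<psi> (x + s) + l y * \<phi> (x + s)"
        using l01[of y] by (intro add_mono mult_left_mono) auto
      then show ?thesis by (simp add: algebra_simps)
    qed
  qed (use \<phi>(1) \<psi>(1) in simp)
  have dT: "deformation (R \<circ> S)" by (rule deformation_compose[OF dS dR])
  have cont: "continuous_on UNIV f" if f: "deformation f" for f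
  proof -
    obtain k where "homeomorphism UNIV UNIV f k" by (rule deformation_homeomorphism[OF f])
    then show ?thesis unfolding homeomorphism_def by blast
  qed
  have \<beta>_mono: "mono \<beta>" by (rule mono_of_slope[OF _ \<beta>_slope]) simp_all
  have \<beta>_vals: "\<beta> (N + 2 / 3) = 0" "\<beta> (N + 1 / 3) = - 1" by (simp_all add: \<beta>_def)
  have \<beta>I: "\<beta> (YI A) = I.row A" if "A \<in> sd_set I" for A
    using YI_ge[OF that] by (simp add: \<beta>_def YI_def)
  have \<beta>J: "\<beta> (YJ B) = - 1 - J.row B" if "B \<in> sd_set J" for B
    using YJ_le[OF that] by (simp add: \<beta>_def YJ_def)
  have "carries S (half_link I XI 1 YI (N + 2 / 3)) (half_link I XI 1 (\<lambda>A. \<beta> (YI A)) (\<beta> (N + 2 / 3)))"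
  proof (rule half_link_carries[where D = UNIV and \<phi> = "\<lambda>x. x"])
    show "continuous_on UNIV S" by (rule cont[OF dS])
  qed (simp_all add: mono_def \<beta>_mono I.root_in_sd_set S_def monoD[OF \<beta>_mono])
  then have 1: "carries S (half_link I XI 1 YI (N + 2 / 3)) (half_link I XI 1 I.row 0)"
    unfolding \<beta>_vals using I.half_link_cong[of XI XI "\<lambda>A. \<beta> (YI A)" I.row] \<beta>I by simp
  \<comment> \<open>On \<open>y \<ge> 0\<close> the weight \<open>l y\<close> is \<open>1\<close>,
    so only \<open>\<phi>\<close> acts.\<close>
  have "carries R (half_link I XI 1 I.row 0) (half_link I (\<lambda>A. \<phi> (XI A)) (\<phi> 1) I.row 0)"
  proof (rule half_link_carries[where D = "{0..}" and \<beta> = "\<lambda>y. y"])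
    show "continuous_on UNIV R" by (rule cont[OF dR])
    show "mono \<phi>" by (rule mono_of_slope[OF \<phi>(1,3)])
  qed (simp_all add: mono_def I.root_in_sd_set R_def l_def)
  then have 2: "carries R (half_link I XI 1 I.row 0) (half_link I mid (- 1) I.row 0)"
    unfolding \<phi>(4) using I.half_link_cong[of "\<lambda>A. \<phi> (XI A)" mid I.row I.row] \<phi>(5) by simp
  have up: "carries (R \<circ> S) (half_link I XI 1 YI (N + 2 / 3)) (half_link I mid (- 1) I.row 0)"
    by (rule carries_compose[OF 1 2])
  have "carries S (half_link J XJ 1 YJ (N + 1 / 3)) (half_link J XJ 1 (\<lambda>A. \<beta> (YJ A)) (\<beta> (N + 1 / 3)))"
  proof (rule half_link_carries[where D = UNIV and \<phi> = "\<lambda>x. x"])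
    show "continuous_on UNIV S" by (rule cont[OF dS])
  qed (simp_all add: mono_def \<beta>_mono J.root_in_sd_set S_def monoD[OF \<beta>_mono])
  then have 3: "carries S (half_link J XJ 1 YJ (N + 1 / 3)) (half_link J XJ 1 (\<lambda>B. - 1 - J.row B) (- 1))"
    unfolding \<beta>_vals using J.half_link_cong[of XJ XJ "\<lambda>A. \<beta> (YJ A)" "\<lambda>B. - 1 - J.row B"] \<beta>J by simp
  have "carries R (half_link J XJ 1 (\<lambda>B. - 1 - J.row B) (- 1))
      (half_link J (\<lambda>B. \<psi> (XJ B)) (\<psi> 1) (\<lambda>B. - 1 - J.row B) (- 1))"
  proof (rule half_link_carries[where D = "{..-1}" and \<beta> = "\<lambda>y. y"])
    show "continuous_on UNIV R" by (rule cont[OF dR])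
    show "mono \<psi>" by (rule mono_of_slope[OF \<psi>(1,3)])
  qed (simp_all add: mono_def J.root_in_sd_set R_def l_def)
  then have 4: "carries R (half_link J XJ 1 (\<lambda>B. - 1 - J.row B) (- 1)) (half_link J mid (- 1) (\<lambda>B. -
      1 - J.row B) (- 1))"
    unfolding \<psi>(4) using J.half_link_cong[of "\<lambda>A. \<psi> (XJ A)" mid "\<lambda>B. - 1 - J.row B"] \<psi>(5) by simp
  have down: "carries (R \<circ> S) (prod.swap ` half_link J XJ 1 YJ (N + 1 / 3)) (reversed_mirror
      (half_link J mid (- 1) J.row 0))"
    using carries_swap[OF carries_compose[OF 3 4]] unfolding reversed_mirror_half_link by simp
  have strand: "carries (R \<circ> S) {dseg s (x, N + 1 / 3, 0) (x, N + 2 / 3, 0)} {dseg s (\<psi> x, - 1, 0)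
      (\<phi> x, 0, 0)}" for s x
  proof -
    have eq: "(R \<circ> S) (x, N + 1 / 3 + u * (1 / 3), 0) = (\<psi> x + u * (\<phi> x - \<psi> x), - 1 + u, 0)"
      if "0 \<le> u" "u \<le> 1" for u
    proof -
      have "\<beta> (N + 1 / 3 + u * (1 / 3)) = - 1 + u" using that by (simp add: \<beta>_def)
      then have "(R \<circ> S) (x, N + 1 / 3 + u * (1 / 3), 0) = ((1 - l (- 1 + u)) * \<psi> x + l (- 1 + u) *
          \<phi> x, - 1 + u, 0)"
        unfolding R_def S_def comp_apply case_prod_conv by (simp only:)
      moreover have "l (- 1 + u) = u" using that by (simp add: l_def)
      ultimately show ?thesis by (simp add: algebra_simps)
    qed
    show ?thesis
    proof (rule carries_dseg[OF cont[OF dT]])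
      show "(R \<circ> S) (x, N + 1 / 3, 0) = (\<psi> x, - 1, 0)" using eq[of 0] by simp
      show "(R \<circ> S) (x, N + 2 / 3, 0) = (\<phi> x, 0, 0)" using eq[of 1] by (simp add: add.commute)
      fix p :: point assume "p \<in> closed_segment (x, N + 1 / 3, 0) (x, N + 2 / 3, 0)"
      then obtain u where u: "0 \<le> u" "u \<le> 1" "p = (x, N + 1 / 3 + u * (1 / 3), 0)"
        by (auto simp: closed_segment_triple)
      then show "(R \<circ> S) p \<in> closed_segment (\<psi> x, - 1, 0) (\<phi> x, 0, 0)"
        using eq[OF u(1,2)] by (auto simp: closed_segment_triple)
    qed
  qed
  have "carries (R \<circ> S) {dseg (sd_positive A) (XI A, N + 1 / 3, 0) (XI A, N + 2 / 3, 0)}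
      {dseg (sd_positive A) (mid (partner A), - 1, 0) (mid A, 0, 0)}" if A: "A \<in> sd_set I" for A
    using strand[of "sd_positive A" "XI A"] \<phi>(5)[OF A] \<psi>(5)[OF partner(1)[OF A]] XJ_partner[OF A] by simp
  moreover have "carries (R \<circ> S) {dseg False (1, N + 1 / 3, 0) (1, N + 2 / 3, 0)} {dseg False (- 1,
      - 1, 0) (- 1, 0, 0)}"
    using strand[of False 1] \<phi>(4) \<psi>(4) by simp
  ultimately have "carries (R \<circ> S) joints (joining_strands I J)"
    unfolding joints_def joining_strands_eq by (intro carries_Un carries_UN)
  then have "carries (R \<circ> S) divided_grid_link (half_link I mid (- 1) I.row 0 \<union> joining_strands I J \<union>
       reversed_mirror (half_link J mid (- 1) J.row 0))"
    unfolding divided_grid_link_def by (intro carries_Un up down)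
  then show thesis by (rule that[OF dT])
  qed
qed

lemma joining_strands_support:
  assumes "p \<in> support (joining_strands I J)"
  shows "- 1 \<le> fst (snd p)" "fst (snd p) \<le> 0"
proof -
  have "- 1 \<le> fst (snd p) \<and> fst (snd p) \<le> 0" if "p \<in> closed_segment (x, - 1, 0) (x', 0, 0)" for x x'
    using segment_y_bounds[OF that, of "- 1" 0] by simp
  then show "- 1 \<le> fst (snd p)" "fst (snd p) \<le> 0"
    using assms unfolding joining_strands_eq support_Un support_UN support_dseg by blast+
qed

text \<open>After the stretching, \<open>H\<close> acts on the upper half and the conjugate
  \<open>K'\<close> on the lower half. The strands and the other half are in each case inside the
  region that is fixed pointwise.\<close>

theorem grid_link_isotopic: "isotopic (grid_link (pair_grid I J)) (jones_link_pair I J)"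
proof (rule divided_grid_link_stretch)
  fix T assume T: "deformation T"
    "carries T divided_grid_link (half_link I mid (- 1) I.row 0 \<union> joining_strands I J \<union>
       reversed_mirror (half_link J mid (- 1) J.row 0))"
  show ?thesis
  proof (rule I.half_link_to_tangle)
  fix H E assume H: "deformation H" "\<And>x y z. y \<le> 0 \<Longrightarrow> H (x, y, z) = (x, y, z)"
    "carries H (half_link I mid (- 1) I.row 0) E" "subdivides E I.straight_tangle"
  show ?thesis
  proof (rule J.half_link_to_tangle)
  fix K F assume K: "deformation K" "\<And>x y z. y \<le> 0 \<Longrightarrow> K (x, y, z) = (x, y, z)"
    "carries K (half_link J mid (- 1) J.row 0) F" "subdivides F J.straight_tangle"
  define K' where "K' = flip_point \<circ> K \<circ> flip_point"
  have H_fix: "H p = p" if "fst (snd p) \<le> 0" for p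
    using H(2)[of "fst (snd p)" "fst p" "snd (snd p)"] that by simp
  have K'_fix: "K' p = p" if "fst (snd p) \<ge> - 1" for p
  proof -
    have "fst (snd (flip_point p)) \<le> 0" using that by (simp add: flip_point_def case_prod_beta')
    then have "K (flip_point p) = flip_point p"
      using K(2)[of "fst (snd (flip_point p))" "fst (flip_point p)" "snd (snd (flip_point p))"] by simp
    then show ?thesis by (simp add: K'_def)
  qed
  have J_low: "fst (snd p) \<le> - 1" if p: "p \<in> support (reversed_mirror (half_link J mid (- 1) J.row
      0))" for p
  proof -
    obtain q where q: "q \<in> support (half_link J mid (- 1) J.row 0)" "p = flip_point q"
      using p unfolding support_reversed_mirror by blast
    have "0 \<le> fst (snd q)" by (rule J.support_half_link[OF q(1)]) simp
    then show ?thesis using q(2) by (simp add: flip_point_def case_prod_beta')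
  qed
  \<comment> \<open>Points with \<open>y < 0\<close> are fixed by the injective map
    \<open>H\<close>, so they cannot be images of points of the upper half.\<close>
  have E_high: "fst (snd p) \<ge> 0" if p: "p \<in> support E" for p
  proof (rule ccontr)
    assume "\<not> fst (snd p) \<ge> 0"
    then have "H p = p" using H_fix by simp
    obtain q where q: "q \<in> support (half_link I mid (- 1) I.row 0)" "p = H q"
      using p support_carries[OF H(3)] by blast
    obtain k where "homeomorphism UNIV UNIV H k" by (rule deformation_homeomorphism[OF H(1)])
    then have "q = p" using \<open>H p = p\<close> q(2) unfolding homeomorphism_def by (metis UNIV_I)
    then show False using I.support_half_link[OF q(1)] \<open>\<not> fst (snd p) \<ge> 0\<close> by simp
  qed
  have cH: "carries H (half_link I mid (- 1) I.row 0 \<union> joining_strands I J \<union>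
       reversed_mirror (half_link J mid (- 1) J.row 0))
     (E \<union> joining_strands I J \<union> reversed_mirror (half_link J mid (- 1) J.row 0))"
  proof (intro carries_Un H(3) carries_fixed H_fix)
    show "fst (snd p) \<le> 0" if "p \<in> support (joining_strands I J)" for p
      using joining_strands_support(2)[OF that] .
    show "fst (snd p) \<le> 0" if "p \<in> support (reversed_mirror (half_link J mid (- 1) J.row 0))" for p
      using J_low[OF that] by simp
  qed
  have cK: "carries K' (E \<union> joining_strands I J \<union> reversed_mirror (half_link J mid (- 1) J.row 0))
      (E \<union> joining_strands I J \<union> reversed_mirror F)"
  proof (intro carries_Un carries_fixed K'_fix)
    show "- 1 \<le> fst (snd p)" if "p \<in> support E" for p using E_high[OF that] by simp
    show "- 1 \<le> fst (snd p)" if "p \<in> support (joining_strands I J)" for p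
      using joining_strands_support(1)[OF that] .
    show "carries K' (reversed_mirror (half_link J mid (- 1) J.row 0)) (reversed_mirror F)"
      unfolding K'_def by (rule carries_reversed_mirror[OF K(3)])
  qed
  have d: "deformation (K' \<circ> (H \<circ> T))"
    unfolding K'_def
    by (intro deformation_compose deformation_conjugate K(1) H(1) T(1) continuous_flip_point) simp
  have c: "carries (K' \<circ> (H \<circ> T)) divided_grid_link (E \<union> joining_strands I J \<union> reversed_mirror F)"
    by (rule carries_compose[OF carries_compose[OF T(2) cH] cK])
  have fin: "subdivides (joining_strands I J) (joining_strands I J)"
    unfolding joining_strands_eq using I.finite_sd_set by (intro subdivides_refl) simp
  \<comment> \<open>The image of the divided grid link and the polygon of Jones both subdivide this
    third polygon, so their supports and parametrizations coincide.\<close>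
  have s1: "subdivides (E \<union> joining_strands I J \<union> reversed_mirror F)
      (I.straight_tangle \<union> joining_strands I J \<union> reversed_mirror J.straight_tangle)"
    by (intro subdivides_Un H(4) fin subdivides_reversed_mirror K(4))
  have s2: "subdivides (jones_link_pair I J)
      (I.straight_tangle \<union> joining_strands I J \<union> reversed_mirror J.straight_tangle)"
    unfolding jones_link_pair_def
    by (intro subdivides_Un I.hat_tangle_subdivides fin subdivides_reversed_mirror
        J.hat_tangle_subdivides)
  show ?thesis
  proof (rule isotopic_carries[OF d c])
    show "support divided_grid_link = support (grid_link (pair_grid I J))"
      by (rule subdivides_support[OF divided_grid_link_subdivides])
    show "oriented_components divided_grid_link = oriented_components (grid_link (pair_grid I J))"
      by (rule oriented_components_subdivides[OF divided_grid_link_subdivides])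
    show "support (E \<union> joining_strands I J \<union> reversed_mirror F) = support (jones_link_pair I J)"
      using subdivides_support[OF s1] subdivides_support[OF s2] by simp
    show "oriented_components (E \<union> joining_strands I J \<union> reversed_mirror F) =
        oriented_components (jones_link_pair I J)"
      using oriented_components_subdivides[OF s1] oriented_components_subdivides[OF s2] by simp
  qed
  qed
  qed
qed

end

theorem theorem4p10:
  fixes I J :: "sd list"
  assumes "compatible I J"
  shows "isotopic (grid_link (pair_grid I J)) (jones_link_pair I J) \<and>
    (\<forall>g \<in> oriented_thompson_F. reduced_pair I J \<and> represents I J g \<longrightarrow>
       isotopic (grid_link (pair_grid I J)) (jones_link g))"
proof -
  interpret compatible_partitions I J
    using assms by unfold_locales (simp_all add: compatible_def sd_pair_def)
  show ?thesis using grid_link_isotopic jones_link_eq by metis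
qed

end
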